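(* The commutator ideal $K$ is a coideal in $(C^*_{red}(S),\Delta)$. The compact quantum semigroup $(C^*_{red}(S),\Delta)$ contains the classical compact quantum group $(C(G),\Delta_G)$ as a compact quantum subgroup, where $\Delta_G(f)(\alpha,\beta)=f(\alpha\beta)$.
   Context: $\Gamma$ is a discrete torsion-free abelian group written additively, $G$ is its compact dual group, and $\chi^a$ is the character of $G$ corresponding to $a\in\Gamma$. $S\subseteq\Gamma$ is a subsemigroup with $0\in S$ and $\Gamma=\{a-b : a,b\in S\}$. $\{e_a\}_{a\in S}$ is the canonical orthonormal basis of $\ell^2(S)$, and $T_a$ ($a\in S$) is the isometry $T_ae_b=e_{a+b}$. $C^*_{red}(S)\subseteq B(\ell^2(S))$ is the $C^*$-algebra generated by all $T_a,T_a^*$, $a\in S$. For $c=b-a\in\Gamma$ with $a,b\in S$ put $T_c=T_a^*T_b$ (independent of the choice of $a,b$). The commutator ideal $K$ is the closed two-sided ideal of $C^*_{red}(S)$ generated by the commutators $T_cT_d-T_dT_c$, $c,d\in\Gamma$. A monomial is a finite product of operators $T_a$ and $T_b^*$ ($a,b\in S$). $\Delta\colon C^*_{red}(S)\to C^*_{red}(S)\otimes C^*_{red}(S)$ (minimal tensor product) is the continuous extension of the map $\sum_i\lambda_iV_i\mapsto\sum_i\lambda_iV_i\otimes V_i$ on finite linear combinations of monomials $V_i$. A closed ideal $J\subset\mathcal{A}$ is a coideal in $(\mathcal{A},\Delta)$ if $\Delta(J)\subseteq J\otimes\mathcal{A}+\mathcal{A}\otimes J$. $(\mathcal{A}',\Delta')$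 is a compact quantum subsemigroup of $(\mathcal{A},\Delta)$ if there is a $*$-epimorphism $\pi\colon\mathcal{A}\to\mathcal{A}'$ with $\Delta'\pi=(\pi\otimes\pi)\Delta$; it is called a compact quantum subgroup if it is moreover a compact quantum group. *)

theory Defs
  imports "HOL-Analysis.Analysis"
begin

section \<open>The Hilbert space \<open>\<ell>\<^sup>2(X)\<close>\<close>

definition square_summable :: "('x \<Rightarrow> complex) \<Rightarrow> bool" where
  "square_summable f \<longleftrightarrow> (\<lambda>x. (cmod (f x))\<^sup>2) summable_on UNIV"

lemma square_summable_bounded:
  assumes "\<And>F. finite F \<Longrightarrow> (\<Sum>x\<in>F. (cmod (f x))\<^sup>2) \<le> B"
  shows "square_summable f" "(\<Sum>\<^sub>\<infinity>x. (cmod (f x))\<^sup>2) \<le> B"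
proof -
  have s: "(\<lambda>x. (cmod (f x))\<^sup>2) summable_on UNIV"
    by (rule nonneg_bounded_partial_sums_imp_summable_on[where C = B])
       (use assms in \<open>auto simp: eventually_finite_subsets_at_top\<close>)
  then show "square_summable f" by (simp add: square_summable_def)
  show "(\<Sum>\<^sub>\<infinity>x. (cmod (f x))\<^sup>2) \<le> B"
    by (rule infsum_le_finite_sums[OF s]) (use assms in auto)
qed

lemma square_summable_comparison:
  assumes "square_summable g" "\<And>x. cmod (f x) \<le> cmod (g x)"
  shows "square_summable f"
  using assms unfolding square_summable_def
  by (auto intro: summable_on_comparison_test simp: power_mono)

lemma square_summable_prod:
  assumes "square_summable f" "square_summable g"
  shows "(\<lambda>x. cnj (f x) * g x) summable_on UNIV"
    and "(\<lambda>x. Re (cnj (f x) * g x)) summable_on UNIV"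
proof -
  have s: "(\<lambda>x. (cmod (f x))\<^sup>2 + (cmod (g x))\<^sup>2) summable_on UNIV"
    using assms unfolding square_summable_def by (rule summable_on_add)
  have le: "cmod (cnj (f x) * g x) \<le> (cmod (f x))\<^sup>2 + (cmod (g x))\<^sup>2" for x
  proof -
    have "2 * (cmod (f x) * cmod (g x)) \<le> (cmod (f x))\<^sup>2 + (cmod (g x))\<^sup>2"
      using sum_squares_bound[of "cmod (f x)" "cmod (g x)"] by simp
    moreover have "0 \<le> cmod (f x) * cmod (g x)" by simp
    ultimately show ?thesis unfolding norm_mult complex_mod_cnj by linarith
  qed
  have "(\<lambda>x. norm (cnj (f x) * g x)) summable_on UNIV"
    by (rule summable_on_comparison_test[OF s]) (use le in auto)
  then show *: "(\<lambda>x. cnj (f x) * g x) summable_on UNIV"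
    by (rule abs_summable_summable)
  show "(\<lambda>x. Re (cnj (f x) * g x)) summable_on UNIV"
    using summable_on_Re[OF *] by simp
qed

lemma square_summable_add:
  assumes "square_summable f" "square_summable g"
  shows "square_summable (\<lambda>x. f x + g x)"
proof -
  have "(\<lambda>x. 2 * ((cmod (f x))\<^sup>2 + (cmod (g x))\<^sup>2)) summable_on UNIV"
    using assms unfolding square_summable_def by (intro summable_on_cmult_right summable_on_add)
  moreover have "(cmod (f x + g x))\<^sup>2 \<le> 2 * ((cmod (f x))\<^sup>2 + (cmod (g x))\<^sup>2)" for x
  proof -
    have "(cmod (f x + g x))\<^sup>2 \<le> (cmod (f x) + cmod (g x))\<^sup>2"
      by (simp add: norm_triangle_ineq power_mono)
    also have "\<dots> \<le> 2 * ((cmod (f x))\<^sup>2 + (cmod (g x))\<^sup>2)"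
      using sum_squares_bound[of "cmod (f x)" "cmod (g x)"] by (simp add: power2_sum)
    finally show ?thesis .
  qed
  ultimately show ?thesis unfolding square_summable_def
    by (rule summable_on_comparison_test) auto
qed

lemma square_summable_cmult: "square_summable f \<Longrightarrow> square_summable (\<lambda>x. c * f x)"
  unfolding square_summable_def by (simp add: norm_mult power_mult_distrib summable_on_cmult_right)

lemma square_summable_0: "square_summable (\<lambda>_. 0)"
  by (simp add: square_summable_def)

typedef 'x ell2 = "{f :: 'x \<Rightarrow> complex. square_summable f}"
  by (rule exI[of _ "\<lambda>_. 0"]) (simp add: square_summable_0)

setup_lifting type_definition_ell2

lift_definition ket :: "'x \<Rightarrow> 'x ell2" is "\<lambda>x y. if y = x then 1 else 0"
  subgoal for x
    by (rule square_summable_bounded[where B = 1])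
       (auto simp: if_distrib[of cmod] if_distrib[of "\<lambda>t. t\<^sup>2"] sum.delta' sum.delta cong: if_cong)
  done

instantiation ell2 :: (type) real_vector
begin

lift_definition zero_ell2 :: "'a ell2" is "\<lambda>_. 0" by (rule square_summable_0)
lift_definition plus_ell2 :: "'a ell2 \<Rightarrow> 'a ell2 \<Rightarrow> 'a ell2" is "\<lambda>f g x. f x + g x"
  by (rule square_summable_add)
lift_definition uminus_ell2 :: "'a ell2 \<Rightarrow> 'a ell2" is "\<lambda>f x. - f x"
  by (simp add: square_summable_def)
lift_definition minus_ell2 :: "'a ell2 \<Rightarrow> 'a ell2 \<Rightarrow> 'a ell2" is "\<lambda>f g x. f x - g x"
  using square_summable_add[where g = "\<lambda>x. - g x" for g :: "'a \<Rightarrow> complex"] by (simp add: square_summable_def)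
lift_definition scaleR_ell2 :: "real \<Rightarrow> 'a ell2 \<Rightarrow> 'a ell2" is "\<lambda>r f x. of_real r * f x"
  by (rule square_summable_cmult)

instance
  by standard (transfer; simp add: algebra_simps)+

end

instantiation ell2 :: (type) real_inner
begin

lift_definition inner_ell2 :: "'a ell2 \<Rightarrow> 'a ell2 \<Rightarrow> real"
  is "\<lambda>f g. \<Sum>\<^sub>\<infinity>x. Re (cnj (f x) * g x)" .
definition norm_ell2 :: "'a ell2 \<Rightarrow> real" where "norm_ell2 f = sqrt (inner f f)"
definition dist_ell2 :: "'a ell2 \<Rightarrow> 'a ell2 \<Rightarrow> real" where "dist_ell2 f g = norm (f - g)"
definition sgn_ell2 :: "'a ell2 \<Rightarrow> 'a ell2" where "sgn_ell2 f = f /\<^sub>R norm f"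
definition uniformity_ell2 :: "('a ell2 \<times> 'a ell2) filter"
  where "uniformity_ell2 = (INF e\<in>{0 <..}. principal {(x, y). dist x y < e})"
definition open_ell2 :: "'a ell2 set \<Rightarrow> bool"
  where "open_ell2 U = (\<forall>x\<in>U. \<forall>\<^sub>F (x', y) in uniformity. x' = x \<longrightarrow> y \<in> U)"

instance
proof
  fix f g h :: "'a ell2" and r :: real
  show "dist f g = norm (f - g)" by (rule dist_ell2_def)
  show "sgn f = f /\<^sub>R norm f" by (rule sgn_ell2_def)
  show "norm f = sqrt (inner f f)" by (rule norm_ell2_def)
  show "inner f g = inner g f"
    by transfer (auto intro!: infsum_cong simp: algebra_simps)
  show "inner (f + g) h = inner f h + inner g h"
  proof transfer
    fix f g h :: "'a \<Rightarrow> complex"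
    assume "square_summable f" "square_summable g" "square_summable h"
    then have "(\<Sum>\<^sub>\<infinity>x. Re (cnj (f x) * h x) + Re (cnj (g x) * h x))
        = (\<Sum>\<^sub>\<infinity>x. Re (cnj (f x) * h x)) + (\<Sum>\<^sub>\<infinity>x. Re (cnj (g x) * h x))"
      by (intro infsum_add square_summable_prod)
    then show "(\<Sum>\<^sub>\<infinity>x. Re (cnj (f x + g x) * h x))
        = (\<Sum>\<^sub>\<infinity>x. Re (cnj (f x) * h x)) + (\<Sum>\<^sub>\<infinity>x. Re (cnj (g x) * h x))"
      by (simp add: algebra_simps)
  qed
  show "inner (r *\<^sub>R f) g = r * inner f g"
    by transfer (simp add: infsum_cmult_right' [symmetric] algebra_simps)
  show "0 \<le> inner f f"
    by transfer (auto intro!: infsum_nonneg)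
  show "inner f f = 0 \<longleftrightarrow> f = 0"
  proof transfer
    fix f :: "'a \<Rightarrow> complex"
    assume f: "square_summable f"
    have *: "Re (cnj (f x) * f x) = (cmod (f x))\<^sup>2" for x
      by (simp add: cmod_power2 flip: power2_eq_square)
    show "(\<Sum>\<^sub>\<infinity>x. Re (cnj (f x) * f x)) = 0 \<longleftrightarrow> f = (\<lambda>_. 0)"
    proof
      assume "(\<Sum>\<^sub>\<infinity>x. Re (cnj (f x) * f x)) = 0"
      then have 0: "(\<Sum>\<^sub>\<infinity>x. (cmod (f x))\<^sup>2) = 0" by (simp only: *)
      have "(cmod (f x))\<^sup>2 = 0" for x
        using nonneg_infsum_le_0D[of "\<lambda>x. (cmod (f x))\<^sup>2" UNIV x] 0 f
        by (auto simp: square_summable_def)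
      then show "f = (\<lambda>_. 0)" by auto
    qed simp
  qed
qed (rule uniformity_ell2_def open_ell2_def)+

end

lift_definition app :: "'x ell2 \<Rightarrow> 'x \<Rightarrow> complex" is "\<lambda>f. f" .

lemma ell2_eqI: "(\<And>x. app f x = app g x) \<Longrightarrow> f = g"
  by transfer auto

lemma app_simps [simp]:
  "app 0 x = 0" "app (f + g) x = app f x + app g x" "app (f - g) x = app f x - app g x"
  "app (- f) x = - app f x" "app (r *\<^sub>R f) x = of_real r * app f x"
  by (transfer; simp)+

lemma app_ket: "app (ket x) y = (if y = x then 1 else 0)"
  by transfer simp

lemma square_summable_app: "square_summable (app f)"
  by transfer

lemma norm_ell2_infsum: "(norm f)\<^sup>2 = (\<Sum>\<^sub>\<infinity>x. (cmod (app f x))\<^sup>2)"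
proof -
  have "(norm f)\<^sup>2 = inner f f" by (simp add: power2_norm_eq_inner)
  also have "\<dots> = (\<Sum>\<^sub>\<infinity>x. (cmod (app f x))\<^sup>2)"
    by transfer (simp add: cmod_power2 flip: power2_eq_square)
  finally show ?thesis .
qed

lemma ell2_sum_le: "finite F \<Longrightarrow> (\<Sum>x\<in>F. (cmod (app f x))\<^sup>2) \<le> (norm f)\<^sup>2"
  unfolding norm_ell2_infsum
  using square_summable_app[of f]
  by (intro finite_sum_le_infsum) (auto simp: square_summable_def)

lemma norm_app_le: "cmod (app f x) \<le> norm f"
  using ell2_sum_le[of "{x}" f] by (simp add: abs_le_square_iff[symmetric])

lemma norm_ell2_le:
  assumes "\<And>F. finite F \<Longrightarrow> (\<Sum>x\<in>F. (cmod (app f x))\<^sup>2) \<le> B\<^sup>2" "0 \<le> B"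
  shows "norm f \<le> B"
proof -
  have "(norm f)\<^sup>2 \<le> B\<^sup>2"
    unfolding norm_ell2_infsum using assms(1) by (rule square_summable_bounded(2))
  then show ?thesis using assms(2) by (rule power2_le_imp_le)
qed

instance ell2 :: (type) banach
proof
  fix X :: "nat \<Rightarrow> 'a ell2"
  assume X: "Cauchy X"
  have "Cauchy (\<lambda>n. app (X n) x)" for x
    unfolding Cauchy_def
  proof (intro allI impI)
    fix e :: real assume "e > 0"
    then obtain M where M: "\<And>m n. m \<ge> M \<Longrightarrow> n \<ge> M \<Longrightarrow> dist (X m) (X n) < e"
      using metric_CauchyD[OF X] by metis
    have "dist (app (X m) x) (app (X n) x) < e" if "m \<ge> M" "n \<ge> M" for m n
      using M[OF that] norm_app_le[of "X m - X n" x] by (simp add: dist_norm)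
    then show "\<exists>M. \<forall>m\<ge>M. \<forall>n\<ge>M. dist (app (X m) x) (app (X n) x) < e" by blast
  qed
  then have "\<forall>x. \<exists>l. (\<lambda>n. app (X n) x) \<longlonglongrightarrow> l"
    using Cauchy_convergent_iff convergent_def by blast
  then obtain g where g: "\<And>x. (\<lambda>n. app (X n) x) \<longlonglongrightarrow> g x" by metis
  have tail: "(\<Sum>x\<in>F. (cmod (app (X m) x - g x))\<^sup>2) \<le> e\<^sup>2"
    if "finite F" "\<And>n. n \<ge> M \<Longrightarrow> dist (X m) (X n) < e" for F m M e
  proof -
    have "(\<lambda>n. \<Sum>x\<in>F. (cmod (app (X m) x - app (X n) x))\<^sup>2) \<longlonglongrightarrow> (\<Sum>x\<in>F. (cmod (app (X m) x - g x))\<^sup>2)"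
      by (intro tendsto_intros g)
    moreover have "(\<Sum>x\<in>F. (cmod (app (X m) x - app (X n) x))\<^sup>2) \<le> e\<^sup>2" if "n \<ge> M" for n
    proof -
      have "(\<Sum>x\<in>F. (cmod (app (X m) x - app (X n) x))\<^sup>2) \<le> (norm (X m - X n))\<^sup>2"
        using ell2_sum_le[OF \<open>finite F\<close>, of "X m - X n"] by simp
      also have "\<dots> \<le> e\<^sup>2"
        using \<open>\<And>n. n \<ge> M \<Longrightarrow> dist (X m) (X n) < e\<close>[OF that] by (intro power_mono) (auto simp: dist_norm)
      finally show ?thesis .
    qed
    ultimately show ?thesis by (intro LIMSEQ_le_const2) blast+
  qed
  have diff: "square_summable (\<lambda>x. app (X m) x - g x)"
    if "\<And>n. n \<ge> M \<Longrightarrow> dist (X m) (X n) < e" for m M e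
    by (rule square_summable_bounded(1)[where B = "e\<^sup>2"]) (rule tail[OF _ that])
  have sg: "square_summable g"
  proof -
    obtain M where M: "\<And>m n. m \<ge> M \<Longrightarrow> n \<ge> M \<Longrightarrow> dist (X m) (X n) < 1"
      using metric_CauchyD[OF X zero_less_one] by metis
    have "square_summable (\<lambda>x. app (X M) x + (- 1) * (app (X M) x - g x))"
      by (intro square_summable_add square_summable_app square_summable_cmult diff[of M M 1]) (use M in auto)
    then show ?thesis by simp
  qed
  define L where "L = Abs_ell2 g"
  have L: "app L x = g x" for x
    using sg by (simp add: L_def app.rep_eq Abs_ell2_inverse)
  have "X \<longlonglongrightarrow> L"
  proof (rule LIMSEQ_I)
    fix r :: real assume r: "r > 0"
    then obtain M where M: "\<And>m n. m \<ge> M \<Longrightarrow> n \<ge> M \<Longrightarrow> dist (X m) (X n) < r / 2"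
      using metric_CauchyD[OF X half_gt_zero[OF r]] by metis
    have "norm (X m - L) < r" if "m \<ge> M" for m
    proof -
      have "norm (X m - L) \<le> r / 2"
      proof (rule norm_ell2_le)
        fix F :: "'a set" assume "finite F"
        then show "(\<Sum>x\<in>F. (cmod (app (X m - L) x))\<^sup>2) \<le> (r / 2)\<^sup>2"
          using tail[of F M m "r / 2"] M[OF that] by (simp add: L)
      qed (use r in simp)
      then show ?thesis using r by linarith
    qed
    then show "\<exists>M. \<forall>m\<ge>M. norm (X m - L) < r" by blast
  qed
  then show "convergent X" by (rule convergentI)
qed

lift_definition cscale :: "complex \<Rightarrow> 'x ell2 \<Rightarrow> 'x ell2" is "\<lambda>c f x. c * f x"
  by (rule square_summable_cmult)

lift_definition cinner :: "'x ell2 \<Rightarrow> 'x ell2 \<Rightarrow> complex" is "\<lambda>f g. \<Sum>\<^sub>\<infinity>x. cnj (f x) * g x" .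

lemma app_cscale [simp]: "app (cscale c f) x = c * app f x"
  by transfer simp

lemma cscale_simps:
  "cscale c (f + g) = cscale c f + cscale c g" "cscale (c + d) f = cscale c f + cscale d f"
  "cscale c (cscale d f) = cscale (c * d) f" "cscale 1 f = f" "cscale c 0 = 0" "cscale 0 f = 0"
  "cscale (of_real r) f = r *\<^sub>R f" "cscale c (r *\<^sub>R f) = r *\<^sub>R cscale c f"
  "cscale c (f - g) = cscale c f - cscale c g" "cscale c (- f) = - cscale c f"
  by (auto intro!: ell2_eqI simp: algebra_simps)

lemma norm_cscale: "norm (cscale c f) = cmod c * norm f"
proof -
  have "(norm (cscale c f))\<^sup>2 = (cmod c * norm f)\<^sup>2"
    by (simp add: norm_ell2_infsum power_mult_distrib norm_mult infsum_cmult_right')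
  then show ?thesis by (simp add: power2_eq_iff_nonneg)
qed

lemma cinner_simps:
  "cinner (f + g) h = cinner f h + cinner g h"
  "cinner f (g + h) = cinner f g + cinner f h"
  "cinner (cscale c f) g = cnj c * cinner f g"
  "cinner f (cscale c g) = c * cinner f g"
  "cinner (r *\<^sub>R f) g = r *\<^sub>R cinner f g"
  "cinner f (r *\<^sub>R g) = r *\<^sub>R cinner f g"
proof -
  have "(\<Sum>\<^sub>\<infinity>x. cnj (f x) * h x + cnj (g x) * h x)
      = (\<Sum>\<^sub>\<infinity>x. cnj (f x) * h x) + (\<Sum>\<^sub>\<infinity>x. cnj (g x) * h x)"
    if "square_summable f" "square_summable g" "square_summable h" for f g h :: "'a \<Rightarrow> complex"
    using that by (intro infsum_add square_summable_prod)
  then show "cinner (f + g) h = cinner f h + cinner g h"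
    by transfer (simp add: algebra_simps)
  have "(\<Sum>\<^sub>\<infinity>x. cnj (f x) * g x + cnj (f x) * h x)
      = (\<Sum>\<^sub>\<infinity>x. cnj (f x) * g x) + (\<Sum>\<^sub>\<infinity>x. cnj (f x) * h x)"
    if "square_summable f" "square_summable g" "square_summable h" for f g h :: "'a \<Rightarrow> complex"
    using that by (intro infsum_add square_summable_prod)
  then show "cinner f (g + h) = cinner f g + cinner f h"
    by transfer (simp add: algebra_simps)
  show *: "cinner (cscale c f) g = cnj c * cinner f g" for c
    by transfer (simp add: infsum_cmult_right' [symmetric] algebra_simps)
  show **: "cinner f (cscale c g) = c * cinner f g" for c
    by transfer (simp add: infsum_cmult_right' [symmetric] algebra_simps)
  show "cinner (r *\<^sub>R f) g = r *\<^sub>R cinner f g"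
    using *[of "of_real r"] by (simp add: cscale_simps scaleR_conv_of_real)
  show "cinner f (r *\<^sub>R g) = r *\<^sub>R cinner f g"
    using **[of "of_real r"] by (simp add: cscale_simps scaleR_conv_of_real)
qed

lemma cinner_commute: "cinner f g = cnj (cinner g f)"
  by transfer (simp add: algebra_simps flip: infsum_cnj)

lemma Re_cinner: "Re (cinner f g) = inner f g"
proof transfer
  fix f g :: "'a \<Rightarrow> complex"
  assume "square_summable f" "square_summable g"
  then show "Re (\<Sum>\<^sub>\<infinity>x. cnj (f x) * g x) = (\<Sum>\<^sub>\<infinity>x. Re (cnj (f x) * g x))"
    by (intro infsum_Re [symmetric] square_summable_prod)
qed

lemma cinner_self: "cinner f f = of_real ((norm f)\<^sup>2)"
proof (rule complex_eqI)
  show "Re (cinner f f) = Re (of_real ((norm f)\<^sup>2))"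
    by (simp add: Re_cinner power2_norm_eq_inner)
  have "Im (cinner f f) = - Im (cinner f f)"
    using arg_cong[OF cinner_commute[of f f], of Im] by simp
  then show "Im (cinner f f) = Im (of_real ((norm f)\<^sup>2))" by simp
qed

lemma norm_cinner_le: "cmod (cinner f g) \<le> norm f * norm g"
proof (cases "cinner f g = 0")
  case False
  define u where "u = sgn (cinner f g)"
  have u: "cmod u = 1" using False by (simp add: u_def norm_sgn)
  have "cinner (cscale u f) g = of_real (cmod (cinner f g))"
  proof -
    define z where "z = cinner f g"
    have z: "cmod z \<noteq> 0" using False by (simp add: z_def)
    have "cnj z * z = complex_of_real (cmod z) * complex_of_real (cmod z)"
      using complex_norm_square[of z] by (simp only: power2_eq_square mult.commute[of "cnj z"] of_real_mult)
    then have "cnj (sgn z) * z = of_real (cmod z)"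
      using z by (simp add: sgn_eq)
    then show ?thesis by (simp only: cinner_simps u_def z_def)
  qed
  then have "cmod (cinner f g) = inner (cscale u f) g"
    by (metis Re_cinner Re_complex_of_real)
  also have "\<dots> \<le> norm (cscale u f) * norm g" by (rule norm_cauchy_schwarz)
  finally show ?thesis using u by (simp add: norm_cscale)
qed simp

lemma bounded_linear_cinner: "bounded_linear (cinner f)" "bounded_linear (\<lambda>f. cnj (cinner f g))"
proof -
  show *: "bounded_linear (cinner f)" for f
    by (rule bounded_linear_intro[where K = "norm f"])
       (use norm_cinner_le[of f] in \<open>auto simp: cinner_simps mult.commute\<close>)
  show "bounded_linear (\<lambda>f. cnj (cinner f g))"
    using *[of g] by (subst cinner_commute) simp
qed

lemma cinner_ket: "cinner (ket x) f = app f x"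
proof -
  have "(\<Sum>\<^sub>\<infinity>y. cnj (app (ket x) y) * app f y) = (\<Sum>\<^sub>\<infinity>y\<in>{x}. app f y)"
    by (rule infsum_cong_neutral) (auto simp: app_ket)
  then show ?thesis by (simp add: cinner_def app_def)
qed

lemma app_sum: "app (\<Sum>i\<in>F. g i) x = (\<Sum>i\<in>F. app (g i) x)"
  by (induction F rule: infinite_finite_induct) auto

lemma has_sum_ket: "((\<lambda>x. cscale (app f x) (ket x)) has_sum f) UNIV"
proof -
  have s: "(\<lambda>x. (cmod (app f x))\<^sup>2) summable_on UNIV"
    using square_summable_app[of f] by (simp add: square_summable_def)
  show ?thesis
    unfolding has_sum_def tendsto_iff eventually_finite_subsets_at_top
  proof (intro allI impI)
    fix e :: real assume e: "e > 0"
    then obtain F where F: "finite F"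
        "\<And>G. finite G \<Longrightarrow> F \<subseteq> G \<Longrightarrow> dist (\<Sum>x\<in>G. (cmod (app f x))\<^sup>2) ((norm f)\<^sup>2) < (e/2)\<^sup>2"
      using has_sum_infsum[OF s]
      unfolding has_sum_def tendsto_iff eventually_finite_subsets_at_top norm_ell2_infsum[symmetric]
      by (metis half_gt_zero subset_UNIV zero_less_power)
    have "dist (\<Sum>x\<in>G. cscale (app f x) (ket x)) f < e" if G: "finite G" "F \<subseteq> G" for G
    proof -
      define h where "h = f - (\<Sum>x\<in>G. cscale (app f x) (ket x))"
      have h: "app h x = (if x \<in> G then 0 else app f x)" for x
        using G(1) by (simp add: h_def app_sum app_ket if_distrib sum.delta cong: if_cong)
      have "norm h \<le> e / 2"
      proof (rule norm_ell2_le)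
        fix H :: "'a set" assume H: "finite H"
        have "(\<Sum>x\<in>H. (cmod (app h x))\<^sup>2) = (\<Sum>x\<in>H - G. (cmod (app f x))\<^sup>2)"
          using H by (intro sum.mono_neutral_cong_right) (auto simp: h)
        also have "\<dots> + (\<Sum>x\<in>G. (cmod (app f x))\<^sup>2) = (\<Sum>x\<in>(H - G) \<union> G. (cmod (app f x))\<^sup>2)"
          using H G(1) by (intro sum.union_disjoint [symmetric]) auto
        also have "\<dots> \<le> (norm f)\<^sup>2" using H G(1) by (intro ell2_sum_le) auto
        finally show "(\<Sum>x\<in>H. (cmod (app h x))\<^sup>2) \<le> (e / 2)\<^sup>2"
          using F(2)[OF G] by (simp add: dist_real_def)
      qed (use e in simp)
      then show ?thesis using e by (simp add: dist_norm h_def norm_minus_commute)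
    qed
    then show "\<exists>F. finite F \<and> F \<subseteq> UNIV \<and> (\<forall>G. finite G \<and> F \<subseteq> G \<and> G \<subseteq> UNIV \<longrightarrow>
        dist (\<Sum>x\<in>G. cscale (app f x) (ket x)) f < e)"
      using F(1) by blast
  qed
qed

lemma bounded_linear_ket_eqI:
  assumes "bounded_linear h" "bounded_linear k"
    and "\<And>c x. h (cscale c (ket x)) = k (cscale c (ket x))"
  shows "h f = k f"
proof -
  have "((\<lambda>x. h (cscale (app f x) (ket x))) has_sum h f) UNIV"
    by (rule has_sum_bounded_linear[OF assms(1) has_sum_ket, unfolded o_def])
  moreover have "((\<lambda>x. h (cscale (app f x) (ket x))) has_sum k f) UNIV"
    unfolding assms(3) by (rule has_sum_bounded_linear[OF assms(2) has_sum_ket, unfolded o_def])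
  ultimately show ?thesis by (rule has_sum_unique)
qed

section \<open>C*-algebras and bounded operators\<close>

class cstar_algebra = real_normed_algebra + banach +
  fixes scaleC :: "complex \<Rightarrow> 'a \<Rightarrow> 'a"  (infixr \<open>*\<^sub>C\<close> 75)
    and star :: "'a \<Rightarrow> 'a"
  assumes scaleC_add_right: "c *\<^sub>C (x + y) = c *\<^sub>C x + c *\<^sub>C y"
    and scaleC_add_left: "(c + d) *\<^sub>C x = c *\<^sub>C x + d *\<^sub>C x"
    and scaleC_scaleC: "c *\<^sub>C d *\<^sub>C x = (c * d) *\<^sub>C x"
    and scaleC_of_real: "of_real r *\<^sub>C x = r *\<^sub>R x"
    and mult_scaleC_left: "(c *\<^sub>C x) * y = c *\<^sub>C (x * y)"
    and mult_scaleC_right: "x * (c *\<^sub>C y) = c *\<^sub>C (x * y)"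
    and star_add: "star (x + y) = star x + star y"
    and star_scaleC: "star (c *\<^sub>C x) = cnj c *\<^sub>C star x"
    and star_mult: "star (x * y) = star y * star x"
    and star_star: "star (star x) = x"
    and norm_star_mult: "norm (star x * x) = (norm x)\<^sup>2"

lifting_forget ell2.lifting

text \<open>\<open>'x op\<close> is \<open>B(\<ell>\<^sup>2(X))\<close>; the library type of bounded linear maps only demands real linearity.\<close>

typedef 'x op = "{T :: 'x ell2 \<Rightarrow>\<^sub>L 'x ell2. \<forall>c f. blinfun_apply T (cscale c f) = cscale c (blinfun_apply T f)}"
  by (rule exI[of _ 0]) (auto simp: cscale_simps)

setup_lifting type_definition_op

lift_definition op_apply :: "'x op \<Rightarrow> 'x ell2 \<Rightarrow> 'x ell2"  (infixr \<open>\<triangleright>\<close> 75) is blinfun_apply .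

lemma op_eqI: "(\<And>f. S \<triangleright> f = T \<triangleright> f) \<Longrightarrow> S = T"
  by transfer (rule blinfun_eqI)

lemma op_apply_cscale [simp]: "T \<triangleright> cscale c f = cscale c (T \<triangleright> f)"
  by transfer simp

lemma bounded_linear_op_apply: "bounded_linear (op_apply T)"
  by transfer (rule blinfun.bounded_linear_right)

instantiation op :: (type) real_vector
begin

lift_definition zero_op :: "'a op" is 0 by (simp add: cscale_simps)
lift_definition plus_op :: "'a op \<Rightarrow> 'a op \<Rightarrow> 'a op" is "(+)"
  by (simp add: blinfun.add_left cscale_simps)
lift_definition minus_op :: "'a op \<Rightarrow> 'a op \<Rightarrow> 'a op" is "(-)"
  by (simp add: blinfun.diff_left cscale_simps)
lift_definition uminus_op :: "'a op \<Rightarrow> 'a op" is "uminus"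
  by (simp add: blinfun.minus_left cscale_simps)
lift_definition scaleR_op :: "real \<Rightarrow> 'a op \<Rightarrow> 'a op" is "scaleR"
  by (simp add: blinfun.scaleR_left cscale_simps)

instance
  by standard (transfer; simp add: algebra_simps)+

end

instantiation op :: (type) real_normed_algebra
begin

lift_definition times_op :: "'a op \<Rightarrow> 'a op \<Rightarrow> 'a op" is "blinfun_compose"
  by simp
lift_definition norm_op :: "'a op \<Rightarrow> real" is norm .
definition dist_op :: "'a op \<Rightarrow> 'a op \<Rightarrow> real" where "dist_op S T = norm (S - T)"
definition sgn_op :: "'a op \<Rightarrow> 'a op" where "sgn_op T = T /\<^sub>R norm T"
definition uniformity_op :: "('a op \<times> 'a op) filter"
  where "uniformity_op = (INF e\<in>{0 <..}. principal {(x, y). dist x y < e})"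
definition open_op :: "'a op set \<Rightarrow> bool"
  where "open_op U = (\<forall>x\<in>U. \<forall>\<^sub>F (x', y) in uniformity. x' = x \<longrightarrow> y \<in> U)"

instance
proof
  fix R S T :: "'a op" and r :: real
  show "dist S T = norm (S - T)" by (rule dist_op_def)
  show "sgn T = T /\<^sub>R norm T" by (rule sgn_op_def)
  show "norm T = 0 \<longleftrightarrow> T = 0" "norm (S + T) \<le> norm S + norm T" "norm (r *\<^sub>R T) = \<bar>r\<bar> * norm T"
    by (transfer; simp add: norm_triangle_ineq)+
  show "norm (S * T) \<le> norm S * norm T"
    by transfer (rule norm_blinfun_compose)
  show "R * S * T = R * (S * T)" "(R + S) * T = R * T + S * T" "R * (S + T) = R * S + R * T"
    "(r *\<^sub>R S) * T = r *\<^sub>R (S * T)" "S * (r *\<^sub>R T) = r *\<^sub>R (S * T)"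
    by (transfer; auto intro!: blinfun_eqI simp: blinfun.bilinear_simps)+
qed (rule uniformity_op_def open_op_def)+

end

lemma op_apply_simps [simp]:
  "0 \<triangleright> f = 0" "(S + T) \<triangleright> f = S \<triangleright> f + T \<triangleright> f" "(S - T) \<triangleright> f = S \<triangleright> f - T \<triangleright> f"
  "(- T) \<triangleright> f = - (T \<triangleright> f)" "(r *\<^sub>R T) \<triangleright> f = r *\<^sub>R (T \<triangleright> f)" "(S * T) \<triangleright> f = S \<triangleright> T \<triangleright> f"
  "T \<triangleright> 0 = 0" "T \<triangleright> (f + g) = T \<triangleright> f + T \<triangleright> g" "T \<triangleright> (f - g) = T \<triangleright> f - T \<triangleright> g"
  "T \<triangleright> (r *\<^sub>R f) = r *\<^sub>R (T \<triangleright> f)"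
  by (transfer; simp add: blinfun.bilinear_simps)+

lemma norm_op_apply_le: "norm (T \<triangleright> f) \<le> norm T * norm f"
  by transfer (rule norm_blinfun)

lemma norm_op_le: "0 \<le> B \<Longrightarrow> (\<And>f. norm (T \<triangleright> f) \<le> B * norm f) \<Longrightarrow> norm T \<le> B"
  by transfer (rule norm_blinfun_bound)

definition make_op :: "('x ell2 \<Rightarrow> 'x ell2) \<Rightarrow> 'x op" where
  "make_op h = (THE T. \<forall>f. T \<triangleright> f = h f)"

lemma make_op:
  assumes "bounded_linear h" "\<And>c f. h (cscale c f) = cscale c (h f)"
  shows "make_op h \<triangleright> f = h f"
proof -
  define T where "T = Abs_op (Blinfun h)"
  have T: "T \<triangleright> f = h f" for f
    using assms by (simp add: T_def op_apply.rep_eq Abs_op_inverse bounded_linear_Blinfun_apply)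
  have "\<exists>!T. \<forall>f. T \<triangleright> f = h f"
    by (rule ex1I[of _ T]) (auto intro: op_eqI simp: T)
  from theI'[OF this] show ?thesis by (simp add: make_op_def)
qed

instance op :: (type) banach
proof
  fix X :: "nat \<Rightarrow> 'a op"
  assume "Cauchy X"
  then have "Cauchy (\<lambda>n. Rep_op (X n))"
    by (simp add: Cauchy_def dist_norm norm_op.rep_eq minus_op.rep_eq)
  then obtain L where L: "(\<lambda>n. Rep_op (X n)) \<longlonglongrightarrow> L"
    using Cauchy_convergent_iff convergent_def by blast
  have app: "(\<lambda>n. X n \<triangleright> f) \<longlonglongrightarrow> blinfun_apply L f" for f
    unfolding op_apply.rep_eq by (intro tendsto_intros L)
  have bl: "bounded_linear (cscale c :: 'a ell2 \<Rightarrow> _)" for c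
    by (rule bounded_linear_intro[where K = "cmod c"]) (auto simp: cscale_simps norm_cscale)
  have "blinfun_apply L (cscale c f) = cscale c (blinfun_apply L f)" for c f
  proof (rule LIMSEQ_unique)
    show "(\<lambda>n. X n \<triangleright> cscale c f) \<longlonglongrightarrow> blinfun_apply L (cscale c f)" by (rule app)
    show "(\<lambda>n. X n \<triangleright> cscale c f) \<longlonglongrightarrow> cscale c (blinfun_apply L f)"
      using bounded_linear.tendsto[OF bl app] by simp
  qed
  then have R: "Rep_op (Abs_op L) = L" by (simp add: Abs_op_inverse)
  have "X \<longlonglongrightarrow> Abs_op L"
    using L by (simp add: LIMSEQ_def dist_norm norm_op.rep_eq minus_op.rep_eq R)
  then show "convergent X" by (rule convergentI)
qed


lemma app_Abs_ell2: "square_summable f \<Longrightarrow> app (Abs_ell2 f) = f"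
  by (simp add: app.rep_eq Abs_ell2_inverse)

definition adjoint_vec :: "'x op \<Rightarrow> 'x ell2 \<Rightarrow> 'x ell2" where
  "adjoint_vec T f = Abs_ell2 (\<lambda>x. cinner (T \<triangleright> ket x) f)"

lemma cinner_sum_left: "cinner (\<Sum>i\<in>F. g i) f = (\<Sum>i\<in>F. cinner (g i) f)"
proof (induction F rule: infinite_finite_induct)
  case empty
  show ?case using cinner_simps(3)[of 0 0 f] by (simp add: cscale_simps)
qed (use cinner_simps(3)[of 0 0 f] in \<open>auto simp: cinner_simps cscale_simps\<close>)

lemma op_apply_sum: "T \<triangleright> (\<Sum>i\<in>F. g i) = (\<Sum>i\<in>F. T \<triangleright> g i)"
  by (induction F rule: infinite_finite_induct) auto

lemma adjoint_sum_le:
  assumes "finite F"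
  shows "(\<Sum>x\<in>F. (cmod (cinner (T \<triangleright> ket x) f))\<^sup>2) \<le> (norm T * norm f)\<^sup>2"
proof -
  define c where "c = (\<lambda>x. cinner (T \<triangleright> ket x) f)"
  define s where "s = (\<Sum>x\<in>F. (cmod (c x))\<^sup>2)"
  define v where "v = (\<Sum>x\<in>F. cscale (c x) (ket x))"
  have s0: "s \<ge> 0" by (simp add: s_def sum_nonneg)
  have v: "app v x = (if x \<in> F then c x else 0)" for x
    using assms by (simp add: v_def app_sum app_ket if_distrib sum.delta cong: if_cong)
  have "norm v \<le> sqrt s"
  proof (rule norm_ell2_le)
    fix H :: "'a set" assume H: "finite H"
    have "(\<Sum>x\<in>H. (cmod (app v x))\<^sup>2) = (\<Sum>x\<in>H \<inter> F. (cmod (c x))\<^sup>2)"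
      using H by (intro sum.mono_neutral_cong_right) (auto simp: v)
    also have "\<dots> \<le> s" unfolding s_def using assms by (intro sum_mono2) auto
    finally show "(\<Sum>x\<in>H. (cmod (app v x))\<^sup>2) \<le> (sqrt s)\<^sup>2" using s0 by simp
  qed (use s0 in simp)
  have "cinner (T \<triangleright> v) f = (\<Sum>x\<in>F. cnj (c x) * c x)"
    unfolding v_def op_apply_sum cinner_sum_left op_apply_cscale cinner_simps by (simp add: c_def)
  also have "\<dots> = of_real s"
    unfolding s_def of_real_sum by (rule sum.cong) (simp_all only: complex_norm_square mult.commute)
  finally have "s = cmod (cinner (T \<triangleright> v) f)" using s0 by simp
  also have "\<dots> \<le> norm (T \<triangleright> v) * norm f" by (rule norm_cinner_le)
  also have "\<dots> \<le> (norm T * norm v) * norm f"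
    by (intro mult_right_mono norm_op_apply_le) auto
  also have "\<dots> \<le> (norm T * sqrt s) * norm f"
    using \<open>norm v \<le> sqrt s\<close> by (intro mult_right_mono mult_left_mono) auto
  finally have *: "s \<le> norm T * norm f * sqrt s" by (simp only: mult_ac)
  have "sqrt s \<le> norm T * norm f"
  proof (cases "s = 0")
    case False
    with s0 have "sqrt s > 0" by simp
    moreover have "sqrt s * sqrt s \<le> norm T * norm f * sqrt s" using * s0 by simp
    ultimately show ?thesis by (rule mult_right_le_imp_le[rotated])
  qed simp
  then have "(sqrt s)\<^sup>2 \<le> (norm T * norm f)\<^sup>2" using s0 by (intro power_mono) auto
  then show ?thesis using s0 by (simp add: s_def c_def)
qed

lemma app_adjoint_vec: "app (adjoint_vec T f) x = cinner (T \<triangleright> ket x) f"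
  unfolding adjoint_vec_def
  by (subst app_Abs_ell2) (auto intro!: square_summable_bounded(1) adjoint_sum_le)

lemma norm_adjoint_vec: "norm (adjoint_vec T f) \<le> norm T * norm f"
  by (rule norm_ell2_le) (auto simp: app_adjoint_vec adjoint_sum_le)

lemma bounded_linear_adjoint_vec: "bounded_linear (adjoint_vec T)"
  by (rule bounded_linear_intro[where K = "norm T"])
     (use norm_adjoint_vec[of T] in
       \<open>auto intro!: ell2_eqI simp: app_adjoint_vec cinner_simps scaleR_conv_of_real mult.commute\<close>)

lemma cinner_adjoint_vec: "cinner (adjoint_vec T f) g = cinner f (T \<triangleright> g)"
proof (rule bounded_linear_ket_eqI[where h = "cinner (adjoint_vec T f)" and k = "\<lambda>g. cinner f (T \<triangleright> g)"])
  show "bounded_linear (cinner (adjoint_vec T f))" by (rule bounded_linear_cinner)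
  show "bounded_linear (\<lambda>g. cinner f (T \<triangleright> g))"
    by (rule bounded_linear_compose[OF bounded_linear_cinner(1) bounded_linear_op_apply])
  fix c x
  have "cinner (adjoint_vec T f) (ket x) = cinner f (T \<triangleright> ket x)"
    by (metis app_adjoint_vec cinner_commute cinner_ket)
  then show "cinner (adjoint_vec T f) (cscale c (ket x)) = cinner f (T \<triangleright> cscale c (ket x))"
    by (simp add: cinner_simps)
qed

lemma cinner_ext: "(\<And>g. cinner f g = cinner f' g) \<Longrightarrow> f = f'"
  by (rule ell2_eqI) (metis cinner_commute cinner_ket)

instantiation op :: (type) cstar_algebra
begin

definition scaleC_op :: "complex \<Rightarrow> 'a op \<Rightarrow> 'a op" where
  "c *\<^sub>C T = make_op (\<lambda>f. cscale c (T \<triangleright> f))"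

definition star_op :: "'a op \<Rightarrow> 'a op" where
  "star T = (THE R. \<forall>f g. cinner (R \<triangleright> f) g = cinner f (T \<triangleright> g))"

lemma op_apply_scaleC [simp]: "(c *\<^sub>C T) \<triangleright> f = cscale c (T \<triangleright> f)"
  for T :: "'a op"
  unfolding scaleC_op_def
proof (rule make_op)
  show "bounded_linear (\<lambda>f. cscale c (T \<triangleright> f))"
  proof (rule bounded_linear_intro[where K = "cmod c * norm T"])
    show "norm (cscale c (T \<triangleright> f)) \<le> norm f * (cmod c * norm T)" for f
      using mult_left_mono[OF norm_op_apply_le[of T f], of "cmod c"]
      by (simp add: norm_cscale mult.commute mult.left_commute)
  qed (auto simp: cscale_simps)
qed (auto simp: cscale_simps mult.commute)

lemma op_apply_star: "star T \<triangleright> f = adjoint_vec T f"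
  for T :: "'a op"
proof -
  define R where "R = make_op (adjoint_vec T)"
  have R: "R \<triangleright> f = adjoint_vec T f" for f
    unfolding R_def
    by (rule make_op[OF bounded_linear_adjoint_vec])
       (auto intro!: ell2_eqI simp: app_adjoint_vec cinner_simps)
  have "\<exists>!R. \<forall>f g. cinner (R \<triangleright> f) g = cinner f (T \<triangleright> g)"
  proof (rule ex1I[of _ R])
    fix R' assume R': "\<forall>f g. cinner (R' \<triangleright> f) g = cinner f (T \<triangleright> g)"
    show "R' = R"
      by (intro op_eqI cinner_ext) (simp add: R' R cinner_adjoint_vec)
  qed (simp add: R cinner_adjoint_vec)
  from theI'[OF this] show ?thesis
    by (intro cinner_ext) (simp only: star_op_def cinner_adjoint_vec)
qed

lemma cinner_star: "cinner (star T \<triangleright> f) g = cinner f (T \<triangleright> g)"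
  for T :: "'a op"
  by (simp add: op_apply_star cinner_adjoint_vec)

lemma cinner_star': "cinner f (star T \<triangleright> g) = cinner (T \<triangleright> f) g"
  for T :: "'a op"
  by (metis cinner_commute cinner_star)

instance
proof
  fix S T :: "'a op" and c d :: complex and r :: real
  show "c *\<^sub>C (S + T) = c *\<^sub>C S + c *\<^sub>C T" "(c + d) *\<^sub>C T = c *\<^sub>C T + d *\<^sub>C T"
    "c *\<^sub>C d *\<^sub>C T = (c * d) *\<^sub>C T" "of_real r *\<^sub>C T = r *\<^sub>R T"
    "(c *\<^sub>C S) * T = c *\<^sub>C (S * T)" "S * (c *\<^sub>C T) = c *\<^sub>C (S * T)"
    by (rule op_eqI, simp add: cscale_simps)+
  show "star (S + T) = star S + star T" "star (c *\<^sub>C T) = cnj c *\<^sub>C star T"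
    "star (S * T) = star T * star S" "star (star T) = T"
    by (rule op_eqI, rule cinner_ext, simp add: cinner_simps cinner_star cinner_star')+
  have le: "norm (star R) \<le> norm R" for R :: "'a op"
    by (rule norm_op_le) (auto simp: op_apply_star norm_adjoint_vec)
  show "norm (star T * T) = (norm T)\<^sup>2"
  proof (rule antisym)
    show "norm (star T * T) \<le> (norm T)\<^sup>2"
      using norm_mult_ineq[of "star T" T] mult_right_mono[OF le[of T], of "norm T"]
      by (simp add: power2_eq_square)
    have "norm T \<le> sqrt (norm (star T * T))"
    proof (rule norm_op_le)
      fix f
      have "(norm (T \<triangleright> f))\<^sup>2 = Re (cinner ((star T * T) \<triangleright> f) f)"
        by (simp add: cinner_star cinner_self)
      also have "\<dots> \<le> cmod (cinner ((star T * T) \<triangleright> f) f)" by (rule complex_Re_le_cmod)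
      also have "\<dots> \<le> norm ((star T * T) \<triangleright> f) * norm f" by (rule norm_cinner_le)
      also have "\<dots> \<le> norm (star T * T) * norm f * norm f"
        by (intro mult_right_mono norm_op_apply_le) auto
      also have "\<dots> = (sqrt (norm (star T * T)) * norm f)\<^sup>2"
        by (simp add: power_mult_distrib power2_eq_square)
      finally show "norm (T \<triangleright> f) \<le> sqrt (norm (star T * T)) * norm f"
        by (rule power2_le_imp_le) simp
    qed simp
    then have "(norm T)\<^sup>2 \<le> (sqrt (norm (star T * T)))\<^sup>2" by (intro power_mono) auto
    then show "(norm T)\<^sup>2 \<le> norm (star T * T)" by simp
  qed
qed

end

lemma op_ket_eqI: "(\<And>x. S \<triangleright> ket x = T \<triangleright> ket x) \<Longrightarrow> S = T"
  by (rule op_eqI, rule bounded_linear_ket_eqI[OF bounded_linear_op_apply bounded_linear_op_apply]) simp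

lemma bounded_linear_ell2I:
  assumes "\<And>f g x. app (h (f + g)) x = app (h f) x + app (h g) x"
    and "\<And>c f x. app (h (cscale c f)) x = c * app (h f) x"
    and "\<And>F f. finite F \<Longrightarrow> (\<Sum>x\<in>F. (cmod (app (h f) x))\<^sup>2) \<le> (B * norm f)\<^sup>2" and "0 \<le> B"
  shows "bounded_linear h" "h (cscale c f) = cscale c (h f)" "norm (h f) \<le> B * norm f"
proof -
  show *: "h (cscale c f) = cscale c (h f)" for c f by (rule ell2_eqI) (simp add: assms)
  show le: "norm (h f) \<le> B * norm f" for f
    by (rule norm_ell2_le) (use assms in auto)
  show "bounded_linear h"
  proof (rule bounded_linear_intro[where K = B])
    show "h (f + g) = h f + h g" for f g by (rule ell2_eqI) (simp add: assms)
    show "h (r *\<^sub>R f) = r *\<^sub>R h f" for r f using *[of "of_real r"] by (simp add: cscale_simps)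
    show "norm (h f) \<le> norm f * B" for f using le[of f] by (simp add: mult.commute)
  qed
qed

lemma square_summable_reindex:
  assumes "inj_on h {x. P x}" "finite F"
  shows "(\<Sum>x\<in>F. (cmod (if P x then app f (h x) else 0))\<^sup>2) \<le> (1 * norm f)\<^sup>2"
proof -
  have "(\<Sum>x\<in>F. (cmod (if P x then app f (h x) else 0))\<^sup>2) = (\<Sum>x\<in>{x\<in>F. P x}. (cmod (app f (h x)))\<^sup>2)"
    using assms(2) by (intro sum.mono_neutral_cong_right) auto
  also have "\<dots> = (\<Sum>y\<in>h ` {x\<in>F. P x}. (cmod (app f y))\<^sup>2)"
    using assms(1) by (subst sum.reindex) (auto simp: inj_on_def)
  also have "\<dots> \<le> (norm f)\<^sup>2" using assms(2) by (intro ell2_sum_le) auto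
  finally show ?thesis by simp
qed

definition reindex_vec :: "('y \<Rightarrow> bool) \<Rightarrow> ('y \<Rightarrow> 'x) \<Rightarrow> 'x ell2 \<Rightarrow> 'y ell2" where
  "reindex_vec P h f = Abs_ell2 (\<lambda>y. if P y then app f (h y) else 0)"

lemma
  assumes "inj_on h {x. P x}"
  shows app_reindex_vec: "app (reindex_vec P h f) y = (if P y then app f (h y) else 0)"
    and bounded_linear_reindex_vec: "bounded_linear (reindex_vec P h)"
    and reindex_vec_cscale: "reindex_vec P h (cscale c f) = cscale c (reindex_vec P h f)"
    and norm_reindex_vec_le: "norm (reindex_vec P h f) \<le> norm f"
proof -
  show *: "app (reindex_vec P h f) y = (if P y then app f (h y) else 0)" for f y
    unfolding reindex_vec_def
    by (subst app_Abs_ell2) (auto intro!: square_summable_bounded(1) square_summable_reindex[OF assms])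
  note b = bounded_linear_ell2I[where h = "reindex_vec P h" and B = 1]
  show "bounded_linear (reindex_vec P h)"
    by (rule b) (use square_summable_reindex[OF assms] in \<open>auto simp: *\<close>)
  show "reindex_vec P h (cscale c f) = cscale c (reindex_vec P h f)"
    by (rule b) (use square_summable_reindex[OF assms] in \<open>auto simp: *\<close>)
  have "norm (reindex_vec P h f) \<le> 1 * norm f"
    by (rule b) (use square_summable_reindex[OF assms] in \<open>auto simp: *\<close>)
  then show "norm (reindex_vec P h f) \<le> norm f" by simp
qed

definition tensor_vec :: "'x ell2 \<Rightarrow> 'y ell2 \<Rightarrow> ('x \<times> 'y) ell2" where
  "tensor_vec f g = Abs_ell2 (\<lambda>(x, y). app f x * app g y)"

lemma app_tensor_vec [simp]: "app (tensor_vec f g) (x, y) = app f x * app g y"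
proof -
  have "square_summable (\<lambda>(x, y). app f x * app g y)"
  proof (rule square_summable_bounded(1))
    fix F :: "('a \<times> 'b) set" assume F: "finite F"
    have "(\<Sum>p\<in>F. (cmod (case p of (x, y) \<Rightarrow> app f x * app g y))\<^sup>2)
        \<le> (\<Sum>p\<in>fst ` F \<times> snd ` F. (cmod (case p of (x, y) \<Rightarrow> app f x * app g y))\<^sup>2)"
      using F by (intro sum_mono2) (auto intro: rev_image_eqI)
    also have "\<dots> = (\<Sum>x\<in>fst ` F. (cmod (app f x))\<^sup>2) * (\<Sum>y\<in>snd ` F. (cmod (app g y))\<^sup>2)"
      by (simp add: sum_product sum.cartesian_product norm_mult power_mult_distrib case_prod_unfold)
    also have "\<dots> \<le> (norm f)\<^sup>2 * (norm g)\<^sup>2"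
      using F by (intro mult_mono ell2_sum_le sum_nonneg) auto
    finally show "(\<Sum>p\<in>F. (cmod (case p of (x, y) \<Rightarrow> app f x * app g y))\<^sup>2) \<le> (norm f)\<^sup>2 * (norm g)\<^sup>2" .
  qed
  then show ?thesis by (simp add: tensor_vec_def app_Abs_ell2)
qed

lemma tensor_vec_ket: "tensor_vec (ket x) (ket y) = ket (x, y)"
  by (rule ell2_eqI) (auto simp: app_ket split: if_splits)

text \<open>Auxiliary constructions showing that the operator tensor product \<open>op_tensor\<close> below exists.\<close>

definition slice_vec :: "('i \<times> 'x) ell2 \<Rightarrow> 'i \<Rightarrow> 'x ell2" where
  "slice_vec f i = reindex_vec (\<lambda>_. True) (\<lambda>x. (i, x)) f"

lemma app_slice_vec: "app (slice_vec f i) x = app f (i, x)"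
  unfolding slice_vec_def by (subst app_reindex_vec) (auto simp: inj_on_def)

lemma infsum_sum_swap:
  fixes g :: "'i \<Rightarrow> 'x \<Rightarrow> real"
  assumes "finite I" "\<And>i. g i summable_on UNIV"
  shows "(\<lambda>x. \<Sum>i\<in>I. g i x) summable_on UNIV"
    and "(\<Sum>\<^sub>\<infinity>x. \<Sum>i\<in>I. g i x) = (\<Sum>i\<in>I. \<Sum>\<^sub>\<infinity>x. g i x)"
proof -
  have "(\<lambda>x. \<Sum>i\<in>I. g i x) summable_on UNIV \<and> (\<Sum>\<^sub>\<infinity>x. \<Sum>i\<in>I. g i x) = (\<Sum>i\<in>I. \<Sum>\<^sub>\<infinity>x. g i x)"
    using assms(1) by (induction I) (use assms(2) in \<open>auto simp: summable_on_add infsum_add\<close>)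
  then show "(\<lambda>x. \<Sum>i\<in>I. g i x) summable_on UNIV"
    and "(\<Sum>\<^sub>\<infinity>x. \<Sum>i\<in>I. g i x) = (\<Sum>i\<in>I. \<Sum>\<^sub>\<infinity>x. g i x)" by auto
qed

lemma sum_norm_slice_le:
  assumes "finite I"
  shows "(\<Sum>i\<in>I. (norm (slice_vec f i))\<^sup>2) \<le> (norm f)\<^sup>2"
proof -
  have s: "(\<lambda>x. (cmod (app f (i, x)))\<^sup>2) summable_on UNIV" for i
    using square_summable_app[of "slice_vec f i"] by (simp add: square_summable_def app_slice_vec)
  have "(\<Sum>i\<in>I. (norm (slice_vec f i))\<^sup>2) = (\<Sum>i\<in>I. \<Sum>\<^sub>\<infinity>x. (cmod (app f (i, x)))\<^sup>2)"
    by (simp add: norm_ell2_infsum app_slice_vec)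
  also have "\<dots> = (\<Sum>\<^sub>\<infinity>x. \<Sum>i\<in>I. (cmod (app f (i, x)))\<^sup>2)"
    by (rule infsum_sum_swap(2) [OF assms s, symmetric])
  also have "\<dots> \<le> (norm f)\<^sup>2"
  proof (rule infsum_le_finite_sums)
    show "(\<lambda>x. \<Sum>i\<in>I. (cmod (app f (i, x)))\<^sup>2) summable_on UNIV"
      by (rule infsum_sum_swap(1) [OF assms s])
    fix X :: "'b set" assume "finite X"
    have "(\<Sum>x\<in>X. \<Sum>i\<in>I. (cmod (app f (i, x)))\<^sup>2) = (\<Sum>p\<in>I \<times> X. (cmod (app f p))\<^sup>2)"
      by (subst sum.swap) (simp add: sum.cartesian_product)
    also have "\<dots> \<le> (norm f)\<^sup>2" using assms \<open>finite X\<close> by (intro ell2_sum_le) auto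
    finally show "(\<Sum>x\<in>X. \<Sum>i\<in>I. (cmod (app f (i, x)))\<^sup>2) \<le> (norm f)\<^sup>2" .
  qed
  finally show ?thesis .
qed

definition amp_right :: "'x op \<Rightarrow> ('i \<times> 'x) op" where
  "amp_right T = make_op (\<lambda>f. Abs_ell2 (\<lambda>(i, x). app (T \<triangleright> slice_vec f i) x))"

lemma app_amp_right:
  fixes T :: "'b op" and f :: "('a \<times> 'b) ell2"
  shows "app (amp_right T \<triangleright> f) (i, x) = app (T \<triangleright> slice_vec f i) x"
proof -
  define h where "h = (\<lambda>f :: ('a \<times> 'b) ell2. Abs_ell2 (\<lambda>(i, x). app (T \<triangleright> slice_vec f i) x))"
  have le: "(\<Sum>p\<in>F. (cmod (case p of (i, x) \<Rightarrow> app (T \<triangleright> slice_vec f i) x))\<^sup>2) \<le> (norm T * norm f)\<^sup>2"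
    if F: "finite F" for F and f :: "('a \<times> 'b) ell2"
  proof -
    have "(\<Sum>p\<in>F. (cmod (case p of (i, x) \<Rightarrow> app (T \<triangleright> slice_vec f i) x))\<^sup>2)
        \<le> (\<Sum>p\<in>fst ` F \<times> snd ` F. (cmod (case p of (i, x) \<Rightarrow> app (T \<triangleright> slice_vec f i) x))\<^sup>2)"
      using F by (intro sum_mono2) (auto intro: rev_image_eqI)
    also have "\<dots> = (\<Sum>i\<in>fst ` F. \<Sum>x\<in>snd ` F. (cmod (app (T \<triangleright> slice_vec f i) x))\<^sup>2)"
      by (simp add: sum.cartesian_product case_prod_unfold)
    also have "\<dots> \<le> (\<Sum>i\<in>fst ` F. (norm T)\<^sup>2 * (norm (slice_vec f i))\<^sup>2)"
    proof (rule sum_mono)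
      fix i
      have "(\<Sum>x\<in>snd ` F. (cmod (app (T \<triangleright> slice_vec f i) x))\<^sup>2) \<le> (norm (T \<triangleright> slice_vec f i))\<^sup>2"
        using F by (intro ell2_sum_le) auto
      also have "\<dots> \<le> (norm T * norm (slice_vec f i))\<^sup>2"
        by (intro power_mono norm_op_apply_le) auto
      finally show "(\<Sum>x\<in>snd ` F. (cmod (app (T \<triangleright> slice_vec f i) x))\<^sup>2) \<le> (norm T)\<^sup>2 * (norm (slice_vec f i))\<^sup>2"
        by (simp add: power_mult_distrib)
    qed
    also have "\<dots> \<le> (norm T)\<^sup>2 * (norm f)\<^sup>2"
      unfolding sum_distrib_left [symmetric] using F by (intro mult_left_mono sum_norm_slice_le) auto
    finally show ?thesis by (simp add: power_mult_distrib)
  qed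
  have h: "app (h f) (i, x) = app (T \<triangleright> slice_vec f i) x" for f i x
    unfolding h_def by (subst app_Abs_ell2) (use le in \<open>auto intro!: square_summable_bounded(1)\<close>)
  have slice: "slice_vec (f + g) i = slice_vec f i + slice_vec g i"
      "slice_vec (cscale c f) i = cscale c (slice_vec f i)" for f g :: "('a \<times> 'b) ell2" and c i
    by (auto intro!: ell2_eqI simp: app_slice_vec)
  have h_add: "app (h (f + g)) p = app (h f) p + app (h g) p"
    and h_cscale: "app (h (cscale c f)) p = c * app (h f) p" for f g c p
    by (cases p; simp add: h slice)+
  have h_le: "(\<Sum>p\<in>F. (cmod (app (h f) p))\<^sup>2) \<le> (norm T * norm f)\<^sup>2" if "finite F" for F f
  proof -
    have "app (h f) = (\<lambda>(i, x). app (T \<triangleright> slice_vec f i) x)" by (auto simp: h)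
    then show ?thesis using le[OF that, of f] by simp
  qed
  note b = bounded_linear_ell2I[where h = h and B = "norm T", OF h_add h_cscale h_le norm_ge_zero]
  have "amp_right T \<triangleright> f = h f"
    unfolding amp_right_def h_def[symmetric]
  proof (rule make_op)
    show "bounded_linear h" by (rule b(1))
    show "h (cscale c f) = cscale c (h f)" for c f by (rule b(2))
  qed
  then show ?thesis by (simp add: h)
qed

definition swap_vec :: "('x \<times> 'y) ell2 \<Rightarrow> ('y \<times> 'x) ell2" where
  "swap_vec = reindex_vec (\<lambda>_. True) prod.swap"

lemma app_swap_vec: "app (swap_vec f) (y, x) = app f (x, y)"
  unfolding swap_vec_def by (subst app_reindex_vec) auto

definition amp_left :: "'x op \<Rightarrow> ('x \<times> 'i) op" where
  "amp_left T = make_op (\<lambda>f. swap_vec (amp_right T \<triangleright> swap_vec f))"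

lemma amp_left: "amp_left T \<triangleright> f = swap_vec (amp_right T \<triangleright> swap_vec f)"
  unfolding amp_left_def
proof (rule make_op)
  have bl: "bounded_linear (swap_vec :: ('a \<times> 'b) ell2 \<Rightarrow> _)" "bounded_linear (swap_vec :: ('b \<times> 'a) ell2 \<Rightarrow> _)"
    unfolding swap_vec_def by (rule bounded_linear_reindex_vec; simp)+
  show "bounded_linear (\<lambda>f. swap_vec (amp_right T \<triangleright> (swap_vec f :: ('b \<times> 'a) ell2)))"
    by (rule bounded_linear_compose[OF bl(2)], rule bounded_linear_compose[OF bounded_linear_op_apply bl(1)])
  have sc: "swap_vec (cscale c f) = cscale c (swap_vec f)" for c and f :: "('u \<times> 'v) ell2"
    unfolding swap_vec_def by (rule reindex_vec_cscale) simp
  show "swap_vec (amp_right T \<triangleright> swap_vec (cscale c f)) = cscale c (swap_vec (amp_right T \<triangleright> swap_vec f))"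
    for c and f :: "('a \<times> 'b) ell2"
    by (simp add: sc)
qed

definition op_tensor :: "'x op \<Rightarrow> 'y op \<Rightarrow> ('x \<times> 'y) op"  (infixr \<open>\<otimes>\<close> 70) where
  "S \<otimes> T = (THE R. \<forall>f g. R \<triangleright> tensor_vec f g = tensor_vec (S \<triangleright> f) (T \<triangleright> g))"

lemma op_tensor: "(S \<otimes> T) \<triangleright> tensor_vec f g = tensor_vec (S \<triangleright> f) (T \<triangleright> g)"
proof -
  have s: "slice_vec (tensor_vec f g) i = cscale (app f i) g" for f :: "'u ell2" and g :: "'v ell2" and i
    by (rule ell2_eqI) (simp add: app_slice_vec)
  have r: "amp_right T \<triangleright> tensor_vec f g = tensor_vec f (T \<triangleright> g)" for f :: "'u ell2" and T :: "'v op" and g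
    by (rule ell2_eqI) (auto simp: app_amp_right s)
  have w: "swap_vec (tensor_vec f g) = tensor_vec g f" for f :: "'u ell2" and g :: "'v ell2"
    by (rule ell2_eqI) (auto simp: app_swap_vec)
  have ex: "(amp_left S * amp_right T) \<triangleright> tensor_vec f g = tensor_vec (S \<triangleright> f) (T \<triangleright> g)" for f g
    by (simp add: r w amp_left)
  have "\<exists>!R. \<forall>f g. R \<triangleright> tensor_vec f g = tensor_vec (S \<triangleright> f) (T \<triangleright> g)"
  proof (rule ex1I[of _ "amp_left S * amp_right T"])
    fix R assume R: "\<forall>f g. R \<triangleright> tensor_vec f g = tensor_vec (S \<triangleright> f) (T \<triangleright> g)"
    show "R = amp_left S * amp_right T"
    proof (rule op_ket_eqI)
      fix p :: "'a \<times> 'b"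
      obtain x y where "p = (x, y)" by (cases p)
      then show "R \<triangleright> ket p = (amp_left S * amp_right T) \<triangleright> ket p"
        using R ex by (metis tensor_vec_ket)
    qed
  qed (use ex in simp)
  from theI'[OF this] show ?thesis by (simp add: op_tensor_def)
qed

section \<open>Translation operators\<close>

text \<open>
  \<open>\<ell>\<^sup>2(S)\<close> is the closed subspace of \<open>\<ell>\<^sup>2(\<Gamma>)\<close> of vectors supported in \<open>S\<close>, and an operator on
  \<open>\<ell>\<^sup>2(S)\<close> is identified with its extension by zero to the orthogonal complement. Thus \<open>B(\<ell>\<^sup>2(S))\<close> is
  the corner \<open>P B(\<ell>\<^sup>2(\<Gamma>)) P\<close>, where the projection \<open>P = shift S 0\<close> onto \<open>\<ell>\<^sup>2(S)\<close> is its unit, and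
  \<open>B(\<ell>\<^sup>2(S) \<otimes> \<ell>\<^sup>2(S))\<close> is the corner given by \<open>P \<otimes> P\<close>. The operator \<open>shift S a\<close> is the isometry
  \<open>T\<^sub>a\<close> of \<open>\<ell>\<^sup>2(S)\<close>, for \<open>a \<in> S\<close>, and \<open>toeplitz S c\<close> is \<open>T\<^sub>c\<close>, for \<open>c \<in> \<Gamma>\<close>.
\<close>

definition shift :: "'g::ab_group_add set \<Rightarrow> 'g \<Rightarrow> 'g op" where
  "shift S a = (THE T. \<forall>b. T \<triangleright> ket b = (if b \<in> S then ket (a + b) else 0))"

lemma app_shift: "app (shift S a \<triangleright> f) x = (if x - a \<in> S then app f (x - a) else 0)"
proof -
  have inj: "inj_on (\<lambda>x. x - a) {x. x - a \<in> S}" by (auto simp: inj_on_def)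
  define T where "T = make_op (reindex_vec (\<lambda>x. x - a \<in> S) (\<lambda>x. x - a))"
  have T: "T \<triangleright> f = reindex_vec (\<lambda>x. x - a \<in> S) (\<lambda>x. x - a) f" for f
    unfolding T_def by (intro make_op bounded_linear_reindex_vec reindex_vec_cscale inj)
  have Tk: "T \<triangleright> ket b = (if b \<in> S then ket (a + b) else 0)" for b
    by (rule ell2_eqI) (auto simp: T app_reindex_vec[OF inj] app_ket)
  have "\<exists>!T. \<forall>b. T \<triangleright> ket b = (if b \<in> S then ket (a + b) else 0)"
    by (rule ex1I[of _ T]) (auto intro!: op_ket_eqI simp: Tk)
  from theI'[OF this] have "shift S a = T"
    by (intro op_ket_eqI) (simp add: shift_def Tk)
  then show ?thesis by (simp add: T app_reindex_vec[OF inj])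
qed

lemma shift_ket: "shift S a \<triangleright> ket b = (if b \<in> S then ket (a + b) else 0)"
  by (rule ell2_eqI) (auto simp: app_shift app_ket)

definition toeplitz :: "'g::ab_group_add set \<Rightarrow> 'g \<Rightarrow> 'g op" where
  "toeplitz S c = (THE T. \<exists>a\<in>S. \<exists>b\<in>S. c = b - a \<and> T = star (shift S a) * shift S b)"

lemma app_star_shift: "app (star (shift S a) \<triangleright> f) x = (if x \<in> S then app f (a + x) else 0)"
proof -
  have "app (star (shift S a) \<triangleright> f) x = cinner (shift S a \<triangleright> ket x) f"
    by (simp add: op_apply_star app_adjoint_vec)
  also have "\<dots> = (if x \<in> S then app f (a + x) else 0)"
    using cinner_simps(3)[of 0 0 f] by (simp add: shift_ket cinner_ket cscale_simps)
  finally show ?thesis .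
qed

lemma toeplitz_diff:
  assumes "a \<in> S" "b \<in> S"
  shows "toeplitz S (b - a) = star (shift S a) * shift S b"
  unfolding toeplitz_def
proof (rule the_equality)
  fix T assume "\<exists>a'\<in>S. \<exists>b'\<in>S. b - a = b' - a' \<and> T = star (shift S a') * shift S b'"
  then obtain a' b' where *: "b - a = b' - a'" and T: "T = star (shift S a') * shift S b'" by blast
  have "a + x - b = x - (b - a)" "a' + x - b' = x - (b' - a')" for x by (simp_all add: algebra_simps)
  then have e: "a' + x - b' = a + x - b" for x by (simp only: *)
  show "T = star (shift S a) * shift S b"
    unfolding T by (intro op_eqI ell2_eqI) (simp only: op_apply_simps app_star_shift app_shift e)
qed (use assms in blast)

section \<open>The C*-algebra \<open>C(K)\<close>\<close>

text \<open>
  Bounded continuous functions with the supremum norm; on a compact space every continuous function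
  is bounded (\<open>cfun_apply_make_compact\<close>), so that this is \<open>C(K)\<close>.
\<close>

typedef (overloaded) ('k::topological_space) cfun = "UNIV :: ('k \<Rightarrow>\<^sub>C complex) set"
  by simp

setup_lifting type_definition_cfun

definition cfun_apply :: "'k::topological_space cfun \<Rightarrow> 'k \<Rightarrow> complex" where
  "cfun_apply f = apply_bcontfun (Rep_cfun f)"

definition make_cfun :: "('k::topological_space \<Rightarrow> complex) \<Rightarrow> 'k cfun" where
  "make_cfun f = Abs_cfun (Bcontfun f)"

lemma cfun_eqI: "(\<And>x. cfun_apply f x = cfun_apply g x) \<Longrightarrow> f = g"
  unfolding cfun_apply_def Rep_cfun_inject [symmetric] by (rule bcontfun_eqI)

lemma cfun_apply_make:
  "continuous_on UNIV f \<Longrightarrow> bounded (range f) \<Longrightarrow> cfun_apply (make_cfun f) = f"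
  by (simp add: cfun_apply_def make_cfun_def Abs_cfun_inverse Bcontfun_inverse bcontfun_def)

lemma cfun_apply_make_compact:
  fixes f :: "'k::topological_space \<Rightarrow> complex"
  assumes "compact (UNIV :: 'k set)" "continuous_on UNIV f"
  shows "cfun_apply (make_cfun f) = f"
  using assms by (intro cfun_apply_make compact_imp_bounded compact_continuous_image)

lemma continuous_on_cfun_apply: "continuous_on X (cfun_apply f)"
  by (simp add: cfun_apply_def)

lemma bounded_cfun_apply: "bounded (range (cfun_apply f))"
  by (simp add: cfun_apply_def)

instantiation cfun :: (topological_space) real_vector
begin

lift_definition zero_cfun :: "'a cfun" is 0 .
lift_definition plus_cfun :: "'a cfun \<Rightarrow> 'a cfun \<Rightarrow> 'a cfun" is "(+)" .
lift_definition minus_cfun :: "'a cfun \<Rightarrow> 'a cfun \<Rightarrow> 'a cfun" is "(-)" .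
lift_definition uminus_cfun :: "'a cfun \<Rightarrow> 'a cfun" is "uminus" .
lift_definition scaleR_cfun :: "real \<Rightarrow> 'a cfun \<Rightarrow> 'a cfun" is "scaleR" .

instance
  by standard (transfer; simp add: algebra_simps)+

end

lemma cfun_apply_simps [simp]:
  "cfun_apply 0 x = 0" "cfun_apply (f + g) x = cfun_apply f x + cfun_apply g x"
  "cfun_apply (f - g) x = cfun_apply f x - cfun_apply g x"
  "cfun_apply (- f) x = - cfun_apply f x" "cfun_apply (r *\<^sub>R f) x = r *\<^sub>R cfun_apply f x"
  unfolding cfun_apply_def by (transfer; simp)+

lemma bounded_range_mult:
  fixes f g :: "'a \<Rightarrow> complex"
  assumes "bounded (range f)" "bounded (range g)"
  shows "bounded (range (\<lambda>x. f x * g x))"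
proof -
  obtain B C where "\<And>x. cmod (f x) \<le> B" "\<And>x. cmod (g x) \<le> C"
    using assms unfolding bounded_iff by auto
  then have "cmod (f x * g x) \<le> B * C" for x
    unfolding norm_mult by (intro mult_mono) (auto intro: order_trans[OF norm_ge_zero])
  then show ?thesis unfolding bounded_iff by blast
qed

instantiation cfun :: (topological_space) real_normed_algebra
begin

definition times_cfun :: "'a cfun \<Rightarrow> 'a cfun \<Rightarrow> 'a cfun" where
  "f * g = make_cfun (\<lambda>x. cfun_apply f x * cfun_apply g x)"

lift_definition norm_cfun :: "'a cfun \<Rightarrow> real" is norm .
definition dist_cfun :: "'a cfun \<Rightarrow> 'a cfun \<Rightarrow> real" where "dist_cfun f g = norm (f - g)"
definition sgn_cfun :: "'a cfun \<Rightarrow> 'a cfun" where "sgn_cfun f = f /\<^sub>R norm f"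
definition uniformity_cfun :: "('a cfun \<times> 'a cfun) filter"
  where "uniformity_cfun = (INF e\<in>{0 <..}. principal {(x, y). dist x y < e})"
definition open_cfun :: "'a cfun set \<Rightarrow> bool"
  where "open_cfun U = (\<forall>x\<in>U. \<forall>\<^sub>F (x', y) in uniformity. x' = x \<longrightarrow> y \<in> U)"

lemma cfun_apply_times [simp]: "cfun_apply (f * g) x = cfun_apply f x * cfun_apply g x"
  for f g :: "'a cfun"
  unfolding times_cfun_def
  by (subst cfun_apply_make)
     (auto intro!: continuous_on_mult continuous_on_cfun_apply bounded_range_mult bounded_cfun_apply)

lemma norm_cfun_apply_le: "cmod (cfun_apply f x) \<le> norm f" for f :: "'a cfun"
  unfolding cfun_apply_def norm_cfun.rep_eq by (rule norm_bounded)

lemma norm_cfun_le: "(\<And>x. cmod (cfun_apply f x) \<le> B) \<Longrightarrow> norm f \<le> B" for f :: "'a cfun"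
  unfolding cfun_apply_def norm_cfun.rep_eq by (rule norm_bound)

instance
proof
  fix f g h :: "'a cfun" and r :: real
  show "dist f g = norm (f - g)" by (rule dist_cfun_def)
  show "sgn f = f /\<^sub>R norm f" by (rule sgn_cfun_def)
  show "norm f = 0 \<longleftrightarrow> f = 0" "norm (f + g) \<le> norm f + norm g" "norm (r *\<^sub>R f) = \<bar>r\<bar> * norm f"
    by (transfer; simp add: norm_triangle_ineq)+
  show "norm (f * g) \<le> norm f * norm g"
    by (rule norm_cfun_le) (simp add: norm_mult mult_mono norm_cfun_apply_le order_trans[OF norm_ge_zero norm_cfun_apply_le])
  show "f * g * h = f * (g * h)" "(f + g) * h = f * h + g * h" "f * (g + h) = f * g + f * h"
    "(r *\<^sub>R f) * g = r *\<^sub>R (f * g)" "f * (r *\<^sub>R g) = r *\<^sub>R (f * g)"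
    by (rule cfun_eqI; simp add: algebra_simps)+
qed (rule uniformity_cfun_def open_cfun_def)+

end

instance cfun :: (topological_space) banach
proof
  fix X :: "nat \<Rightarrow> 'a cfun"
  assume X: "Cauchy X"
  have "\<exists>g. uniform_limit UNIV (\<lambda>n. apply_bcontfun (Rep_cfun (X n))) g sequentially"
  proof -
    have "\<forall>e>0. \<exists>N. \<forall>m n x. N \<le> m \<and> N \<le> n \<and> True \<longrightarrow>
        dist (apply_bcontfun (Rep_cfun (X m)) x) (apply_bcontfun (Rep_cfun (X n)) x) < e"
    proof (intro allI impI)
      fix e :: real assume "e > 0"
      from metric_CauchyD[OF X this] obtain N where N: "\<And>m n. m \<ge> N \<Longrightarrow> n \<ge> N \<Longrightarrow> dist (X m) (X n) < e"
        by metis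
      have "dist (apply_bcontfun (Rep_cfun (X m)) x) (apply_bcontfun (Rep_cfun (X n)) x) < e"
        if "m \<ge> N" "n \<ge> N" for m n x
        using N[OF that] norm_cfun_apply_le[of "X m - X n" x] by (simp add: dist_norm cfun_apply_def [symmetric])
      then show "\<exists>N. \<forall>m n x. N \<le> m \<and> N \<le> n \<and> True \<longrightarrow>
        dist (apply_bcontfun (Rep_cfun (X m)) x) (apply_bcontfun (Rep_cfun (X n)) x) < e" by blast
    qed
    then show ?thesis
      using uniformly_convergent_eq_cauchy[of "\<lambda>_. True" "\<lambda>n. apply_bcontfun (Rep_cfun (X n))"]
      unfolding uniform_limit_sequentially_iff by simp
  qed
  then obtain l where "(\<lambda>n. Rep_cfun (X n)) \<longlonglongrightarrow> l"
    using uniform_limit_bcontfunE[OF _ sequentially_bot] by metis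
  then have "X \<longlonglongrightarrow> Abs_cfun l"
    by (simp add: LIMSEQ_def dist_norm norm_cfun.rep_eq minus_cfun.rep_eq Abs_cfun_inverse)
  then show "convergent X" by (rule convergentI)
qed

instantiation cfun :: (topological_space) cstar_algebra
begin

definition scaleC_cfun :: "complex \<Rightarrow> 'a cfun \<Rightarrow> 'a cfun" where
  "c *\<^sub>C f = make_cfun (\<lambda>x. c * cfun_apply f x)"

definition star_cfun :: "'a cfun \<Rightarrow> 'a cfun" where
  "star f = make_cfun (\<lambda>x. cnj (cfun_apply f x))"

lemma cfun_apply_scaleC [simp]: "cfun_apply (c *\<^sub>C f) x = c * cfun_apply f x" for f :: "'a cfun"
  unfolding scaleC_cfun_def
  by (subst cfun_apply_make)
     (auto intro!: continuous_on_mult continuous_on_const continuous_on_cfun_apply bounded_range_mult bounded_cfun_apply)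

lemma cfun_apply_star [simp]: "cfun_apply (star f) x = cnj (cfun_apply f x)" for f :: "'a cfun"
  unfolding star_cfun_def
proof (subst cfun_apply_make)
  show "bounded (range (\<lambda>x. cnj (cfun_apply f x)))"
    using bounded_cfun_apply[of f] by (simp add: bounded_iff)
qed (auto intro!: continuous_on_cnj continuous_on_cfun_apply)

instance
proof
  fix f g :: "'a cfun" and c d :: complex and r :: real
  show "c *\<^sub>C (f + g) = c *\<^sub>C f + c *\<^sub>C g" "(c + d) *\<^sub>C f = c *\<^sub>C f + d *\<^sub>C f"
    "c *\<^sub>C d *\<^sub>C f = (c * d) *\<^sub>C f" "of_real r *\<^sub>C f = r *\<^sub>R f"
    "(c *\<^sub>C f) * g = c *\<^sub>C (f * g)" "f * (c *\<^sub>C g) = c *\<^sub>C (f * g)"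
    "star (f + g) = star f + star g" "star (c *\<^sub>C f) = cnj c *\<^sub>C star f"
    "star (f * g) = star g * star f" "star (star f) = f"
    by (rule cfun_eqI; simp add: algebra_simps scaleR_conv_of_real)+
  show "norm (star f * f) = (norm f)\<^sup>2"
  proof (rule antisym)
    have "norm (star f) \<le> norm f"
      by (rule norm_cfun_le) (simp add: norm_cfun_apply_le)
    then show "norm (star f * f) \<le> (norm f)\<^sup>2"
      using norm_mult_ineq[of "star f" f] mult_right_mono[of "norm (star f)" "norm f" "norm f"]
      by (simp add: power2_eq_square)
    have "norm f \<le> sqrt (norm (star f * f))"
    proof (rule norm_cfun_le)
      fix x
      have "(cmod (cfun_apply f x))\<^sup>2 = cmod (cfun_apply (star f * f) x)"
        by (simp add: norm_mult power2_eq_square)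
      also have "\<dots> \<le> norm (star f * f)" by (rule norm_cfun_apply_le)
      finally show "cmod (cfun_apply f x) \<le> sqrt (norm (star f * f))"
        by (rule real_le_rsqrt)
    qed
    then have "(norm f)\<^sup>2 \<le> (sqrt (norm (star f * f)))\<^sup>2" by (intro power_mono) auto
    then show "(norm f)\<^sup>2 \<le> norm (star f * f)" by simp
  qed
qed

end

text \<open>The faithful representation of \<open>C(K)\<close> on \<open>\<ell>\<^sup>2(K)\<close> by multiplication operators.\<close>

definition mult_op :: "'k::topological_space cfun \<Rightarrow> 'k op" where
  "mult_op f = (THE T. \<forall>v x. app (T \<triangleright> v) x = cfun_apply f x * app v x)"

lemma app_mult_op: "app (mult_op f \<triangleright> v) x = cfun_apply f x * app v x"
proof -
  define h where "h = (\<lambda>v. Abs_ell2 (\<lambda>x. cfun_apply f x * app v x))"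
  have le: "(\<Sum>x\<in>F. (cmod (cfun_apply f x * app v x))\<^sup>2) \<le> (norm f * norm v)\<^sup>2" if "finite F" for F v
  proof -
    have "(\<Sum>x\<in>F. (cmod (cfun_apply f x * app v x))\<^sup>2) \<le> (\<Sum>x\<in>F. (norm f)\<^sup>2 * (cmod (app v x))\<^sup>2)"
      unfolding norm_mult power_mult_distrib
      by (intro sum_mono mult_right_mono power_mono norm_cfun_apply_le) auto
    also have "\<dots> \<le> (norm f * norm v)\<^sup>2"
      unfolding sum_distrib_left [symmetric] power_mult_distrib
      using that by (intro mult_left_mono ell2_sum_le) auto
    finally show ?thesis .
  qed
  have h: "app (h v) x = cfun_apply f x * app v x" for v x
    unfolding h_def by (subst app_Abs_ell2) (auto intro!: square_summable_bounded(1) le)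
  have le': "(\<Sum>x\<in>F. (cmod (app (h v) x))\<^sup>2) \<le> (norm f * norm v)\<^sup>2" if "finite F" for F v
    using le[OF that] by (simp only: h)
  have h_add: "app (h (v + w)) x = app (h v) x + app (h w) x"
    and h_cscale: "app (h (cscale c v)) x = c * app (h v) x" for v w x c
    by (simp_all add: h algebra_simps)
  note b = bounded_linear_ell2I[where h = h and B = "norm f", OF h_add h_cscale le' norm_ge_zero]
  define T where "T = make_op h"
  have "T \<triangleright> v = h v" for v
    unfolding T_def
  proof (rule make_op)
    show "bounded_linear h" by (rule b(1))
    show "h (cscale c v) = cscale c (h v)" for c v by (rule b(2))
  qed
  then have T: "app (T \<triangleright> v) x = cfun_apply f x * app v x" for v x by (simp add: h)
  have "\<exists>!T. \<forall>v x. app (T \<triangleright> v) x = cfun_apply f x * app v x"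
    by (rule ex1I[of _ T]) (auto intro!: op_eqI ell2_eqI simp: T)
  from theI'[OF this] show ?thesis by (simp add: mult_op_def)
qed

section \<open>The dual group of a discrete abelian group\<close>

typedef (overloaded) ('g::ab_group_add) dual =
  "{\<phi> :: 'g \<Rightarrow> complex. (\<forall>a. cmod (\<phi> a) = 1) \<and> (\<forall>a b. \<phi> (a + b) = \<phi> a * \<phi> b)}"
  morphisms dual_apply Abs_dual
  by (rule exI[of _ "\<lambda>_. 1"]) simp

setup_lifting type_definition_dual

instantiation dual :: (ab_group_add) comm_monoid_mult
begin

lift_definition one_dual :: "'a dual" is "\<lambda>_. 1" by simp
lift_definition times_dual :: "'a dual \<Rightarrow> 'a dual \<Rightarrow> 'a dual" is "\<lambda>\<phi> \<psi> a. \<phi> a * \<psi> a"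
  by (simp add: norm_mult)

instance
  by standard (transfer; simp add: mult_ac fun_eq_iff)+

end

text \<open>Pointwise convergence, which for discrete \<open>\<Gamma>\<close> is the compact-open topology.\<close>

instantiation dual :: (ab_group_add) topological_space
begin

definition open_dual :: "'a dual set \<Rightarrow> bool" where
  "open_dual U \<longleftrightarrow> (\<exists>V :: ('a \<Rightarrow> complex) set. open V \<and> U = dual_apply -` V)"

instance
proof
  show "open (UNIV :: 'a dual set)" unfolding open_dual_def by (rule exI[of _ UNIV]) simp
  fix S T :: "'a dual set" assume "open S" "open T"
  then obtain V W where "open V" "S = dual_apply -` V" "open W" "T = dual_apply -` W"
    unfolding open_dual_def by blast
  then show "open (S \<inter> T)" unfolding open_dual_def by (intro exI[of _ "V \<inter> W"]) auto
next
  fix K :: "'a dual set set" assume "\<forall>S\<in>K. open S"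
  then obtain V where V: "\<And>S. S \<in> K \<Longrightarrow> open (V S) \<and> S = dual_apply -` V S"
    unfolding open_dual_def by metis
  then have "open (\<Union>(V ` K))" "\<Union>K = dual_apply -` \<Union>(V ` K)" by auto
  then show "open (\<Union>K)" unfolding open_dual_def by blast
qed

end

lemma continuous_on_dual_apply_fun: "continuous_on X dual_apply"
proof -
  have "continuous_on UNIV (dual_apply :: 'a dual \<Rightarrow> _)"
    unfolding continuous_on_open_vimage[OF open_UNIV] by (auto simp: open_dual_def)
  then show ?thesis by (rule continuous_on_subset) simp
qed

lemma continuous_on_dual_apply: "continuous_on X (\<lambda>\<phi>. dual_apply \<phi> a)"
  using continuous_on_compose2[OF continuous_on_product_coordinates continuous_on_dual_apply_fun] by simp

lemma continuous_on_dualI: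
  assumes "\<And>a. continuous_on UNIV (\<lambda>x. dual_apply (h x) a)"
  shows "continuous_on UNIV h"
proof -
  have c: "continuous_on UNIV (\<lambda>x. dual_apply (h x))"
    using assms by (rule continuous_on_coordinatewise_then_product)
  have "open (h -` U)" if U: "open U" for U
  proof -
    obtain V where V: "open V" "U = dual_apply -` V" using U unfolding open_dual_def by blast
    have "open ((\<lambda>x. dual_apply (h x)) -` V)" using c V(1) by (simp add: continuous_on_open_vimage)
    then show ?thesis by (simp add: V(2) vimage_def)
  qed
  then show ?thesis by (simp add: continuous_on_open_vimage)
qed

lemma continuous_on_dual_mult: "continuous_on UNIV (\<lambda>(\<alpha> :: 'g::ab_group_add dual, \<beta>). \<alpha> * \<beta>)"
  unfolding case_prod_unfold
proof (rule continuous_on_dualI)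
  fix a :: 'g
  have "continuous_on UNIV (\<lambda>p :: 'g dual \<times> 'g dual. dual_apply (fst p) a * dual_apply (snd p) a)"
    by (intro continuous_on_mult continuous_on_compose2[OF continuous_on_dual_apply[of UNIV]]
        continuous_on_fst continuous_on_snd continuous_on_id) auto
  then show "continuous_on UNIV (\<lambda>p :: 'g dual \<times> 'g dual. dual_apply (fst p * snd p) a)"
    by (simp add: times_dual.rep_eq)
qed

lemma compact_dual: "compact (UNIV :: 'g::ab_group_add dual set)"
proof -
  let ?R = "range (dual_apply :: 'g dual \<Rightarrow> _)"
  have R: "?R = {\<phi>. (\<forall>a. cmod (\<phi> a) = 1) \<and> (\<forall>a b. \<phi> (a + b) = \<phi> a * \<phi> b)}"
    using type_definition.Rep_range[OF type_definition_dual] .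
  have P: "compact (PiE UNIV (\<lambda>_ :: 'g. sphere (0 :: complex) 1))"
    using compactin_PiE[of "\<lambda>_ :: 'g. euclidean :: complex topology" UNIV "\<lambda>_. sphere 0 1"]
    by (simp add: euclidean_product_topology)
  have "closed ?R"
  proof -
    have "?R = (\<Inter>a. {\<phi>. cmod (\<phi> a) = 1}) \<inter> (\<Inter>a. \<Inter>b. {\<phi>. \<phi> (a + b) = \<phi> a * \<phi> b})"
      unfolding R by auto
    also have "closed \<dots>"
      by (intro closed_Int closed_INT ballI closed_Collect_eq continuous_intros
          continuous_on_product_coordinates)
    finally show ?thesis .
  qed
  moreover have "?R \<subseteq> PiE UNIV (\<lambda>_. sphere 0 1)" unfolding R by (auto simp: dist_norm)
  ultimately have cR: "compact ?R"
    using compact_Int_closed[OF P] by (metis inf.absorb_iff2)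
  show ?thesis
  proof (rule compactI)
    fix C :: "'g dual set set" assume C: "\<forall>t\<in>C. open t" "UNIV \<subseteq> \<Union>C"
    then obtain V where V: "\<And>S. S \<in> C \<Longrightarrow> open (V S) \<and> S = dual_apply -` V S"
      unfolding open_dual_def by metis
    have mem: "x \<in> S \<longleftrightarrow> dual_apply x \<in> V S" if "S \<in> C" for x S
      using V[OF that] by (metis vimage_eq)
    have R_sub: "?R \<subseteq> \<Union>(V ` C)"
    proof
      fix y assume "y \<in> ?R"
      then obtain x where "y = dual_apply x" by blast
      moreover obtain S where "S \<in> C" "x \<in> S" using C(2) by blast
      ultimately show "y \<in> \<Union>(V ` C)" using mem by blast
    qed
    have "\<And>S. S \<in> C \<Longrightarrow> open (V S)" using V by simp
    from compactE_image[OF cR this R_sub]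
    obtain C' where C': "C' \<subseteq> C" "finite C'" "?R \<subseteq> \<Union>(V ` C')" by blast
    have "UNIV \<subseteq> \<Union>C'"
    proof
      fix x :: "'g dual"
      obtain S where "S \<in> C'" "dual_apply x \<in> V S" using C'(3) by blast
      then show "x \<in> \<Union>C'" using mem C'(1) by blast
    qed
    with C' show "\<exists>C'\<subseteq>C. finite C' \<and> UNIV \<subseteq> \<Union>C'" by blast
  qed
qed

text \<open>
  \<open>\<Delta>\<^sub>G(f)(\<alpha>, \<beta>) = f(\<alpha>\<beta>)\<close>. The function \<open>\<Delta>\<^sub>G(f) \<in> C(G \<times> G)\<close> is given as a multiplication operator on
  \<open>\<ell>\<^sup>2(G \<times> G)\<close>, because \<open>C(G) \<otimes> C(G)\<close> is taken to be the spatial tensor product \<open>min_tensor\<close> (see below)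
  with respect to \<open>mult_op\<close>; there \<open>f \<otimes> g\<close> is multiplication by \<open>f(\<alpha>) g(\<beta>)\<close>.
\<close>

definition dual_comult :: "'g::ab_group_add dual cfun \<Rightarrow> ('g dual \<times> 'g dual) op" where
  "dual_comult f = mult_op (make_cfun (\<lambda>(\<alpha>, \<beta>). cfun_apply f (\<alpha> * \<beta>)))"

lemma cfun_apply_dual_comult:
  fixes f :: "'a::ab_group_add dual cfun"
  shows "cfun_apply (make_cfun (\<lambda>(\<alpha>, \<beta>). cfun_apply f (\<alpha> * \<beta>))) (\<alpha>, \<beta>) = cfun_apply f (\<alpha> * \<beta>)"
proof -
  have "continuous_on UNIV (\<lambda>p :: 'a dual \<times> 'a dual. cfun_apply f (case p of (\<alpha>, \<beta>) \<Rightarrow> \<alpha> * \<beta>))"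
    by (rule continuous_on_compose2[OF continuous_on_cfun_apply[of UNIV] continuous_on_dual_mult]) simp
  then have "continuous_on UNIV (\<lambda>(\<alpha>, \<beta>). cfun_apply f (\<alpha> * \<beta>))"
    by (simp add: case_prod_unfold)
  moreover have "compact (UNIV :: ('a dual \<times> 'a dual) set)"
    using compact_Times[OF compact_dual compact_dual] by simp
  ultimately show ?thesis by (simp add: cfun_apply_make_compact)
qed


section \<open>C*-algebraic notions\<close>

definition cspan :: "'a::cstar_algebra set \<Rightarrow> 'a set" where
  "cspan X = {\<Sum>x\<in>F. r x *\<^sub>C x | r F. finite F \<and> F \<subseteq> X}"

definition clinear_on :: "'a::cstar_algebra set \<Rightarrow> ('a \<Rightarrow> 'b::cstar_algebra) \<Rightarrow> bool" where
  "clinear_on A \<phi> \<longleftrightarrow> (\<forall>x\<in>A. \<forall>y\<in>A. \<phi> (x + y) = \<phi> x + \<phi> y) \<and> (\<forall>c. \<forall>x\<in>A. \<phi> (c *\<^sub>C x) = c *\<^sub>C \<phi> x)"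

definition star_hom :: "'a::cstar_algebra set \<Rightarrow> ('a \<Rightarrow> 'b::cstar_algebra) \<Rightarrow> bool" where
  "star_hom A \<phi> \<longleftrightarrow> clinear_on A \<phi> \<and> (\<forall>x\<in>A. \<forall>y\<in>A. \<phi> (x * y) = \<phi> x * \<phi> y)
    \<and> (\<forall>x\<in>A. \<phi> (star x) = star (\<phi> x))"

definition cstar_subalgebra :: "'a::cstar_algebra set \<Rightarrow> bool" where
  "cstar_subalgebra A \<longleftrightarrow> closed A \<and> 0 \<in> A \<and> (\<forall>x\<in>A. \<forall>y\<in>A. x + y \<in> A \<and> x * y \<in> A)
    \<and> (\<forall>c. \<forall>x\<in>A. c *\<^sub>C x \<in> A) \<and> (\<forall>x\<in>A. star x \<in> A)"

definition cstar_generated :: "'a::cstar_algebra set \<Rightarrow> 'a set" where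
  "cstar_generated X = \<Inter>{A. cstar_subalgebra A \<and> X \<subseteq> A}"

definition closed_ideal :: "'a::cstar_algebra set \<Rightarrow> 'a set \<Rightarrow> bool" where
  "closed_ideal A J \<longleftrightarrow> J \<subseteq> A \<and> closed J \<and> 0 \<in> J \<and> (\<forall>x\<in>J. \<forall>y\<in>J. x + y \<in> J)
    \<and> (\<forall>c. \<forall>x\<in>J. c *\<^sub>C x \<in> J) \<and> (\<forall>a\<in>A. \<forall>x\<in>J. a * x \<in> J \<and> x * a \<in> J)"

definition closed_ideal_generated :: "'a::cstar_algebra set \<Rightarrow> 'a set \<Rightarrow> 'a set" where
  "closed_ideal_generated A X = \<Inter>{J. closed_ideal A J \<and> X \<subseteq> J}"

text \<open>
  Units are elements of the subalgebra: an algebra of operators on \<open>\<ell>\<^sup>2(S)\<close> is not required to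
  contain the identity operator of the ambient space.
\<close>

definition is_unit :: "'a::cstar_algebra set \<Rightarrow> 'a \<Rightarrow> bool" where
  "is_unit A u \<longleftrightarrow> u \<in> A \<and> (\<forall>x\<in>A. u * x = x \<and> x * u = x)"

definition faithful_rep :: "'a::cstar_algebra set \<Rightarrow> ('a \<Rightarrow> 'x op) \<Rightarrow> bool" where
  "faithful_rep A \<rho> \<longleftrightarrow> star_hom A \<rho> \<and> inj_on \<rho> A"

text \<open>
  The minimal (spatial) tensor product of C*-algebras of operators. For abstract C*-algebras \<open>A\<close> and
  \<open>B\<close> with faithful representations \<open>\<rho>\<close> and \<open>\<sigma>\<close> it is \<open>min_tensor (\<rho> ` A) (\<sigma> ` B)\<close>, which up to
  isomorphism does not depend on the choice of \<open>\<rho>\<close> and \<open>\<sigma>\<close>. Below, a C*-algebra \<open>A\<close> always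
  comes with such a \<open>\<rho>\<close>, and a comultiplication on \<open>A\<close> takes its values in \<open>min_tensor (\<rho> ` A) (\<rho> ` A)\<close>.
\<close>

definition min_tensor :: "'x op set \<Rightarrow> 'y op set \<Rightarrow> ('x \<times> 'y) op set" where
  "min_tensor A B = closure (cspan {S \<otimes> T | S T. S \<in> A \<and> T \<in> B})"

text \<open>
  \<open>tensor_map A \<rho> \<phi> B \<sigma> \<psi> \<Theta>\<close>: on the minimal tensor product of \<open>A\<close> and \<open>B\<close>, the map \<open>\<Theta>\<close> is \<open>\<phi> \<otimes> \<psi>\<close>.
\<close>

definition tensor_map ::
  "'a::cstar_algebra set \<Rightarrow> ('a \<Rightarrow> 'x op) \<Rightarrow> ('a \<Rightarrow> 'u op) \<Rightarrow>
   'b::cstar_algebra set \<Rightarrow> ('b \<Rightarrow> 'y op) \<Rightarrow> ('b \<Rightarrow> 'v op) \<Rightarrow>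
   (('x \<times> 'y) op \<Rightarrow> ('u \<times> 'v) op) \<Rightarrow> bool" where
  "tensor_map A \<rho> \<phi> B \<sigma> \<psi> \<Theta> \<longleftrightarrow>
     clinear_on (min_tensor (\<rho> ` A) (\<sigma> ` B)) \<Theta> \<and>
     continuous_on (min_tensor (\<rho> ` A) (\<sigma> ` B)) \<Theta> \<and>
     (\<forall>a\<in>A. \<forall>b\<in>B. \<Theta> (\<rho> a \<otimes> \<sigma> b) = \<phi> a \<otimes> \<psi> b)"


section \<open>Compact quantum semigroups and groups\<close>

definition assoc_vec :: "(('x \<times> 'y) \<times> 'z) ell2 \<Rightarrow> ('x \<times> 'y \<times> 'z) ell2" where
  "assoc_vec f = Abs_ell2 (\<lambda>(x, y, z). app f ((x, y), z))"

lemma app_assoc_vec: "app (assoc_vec f) (x, y, z) = app f ((x, y), z)"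
proof -
  define h where "h = (\<lambda>(x :: 'a, y :: 'b, z :: 'c). ((x, y), z))"
  have inj: "inj_on h {x. True}" by (auto simp: h_def inj_on_def)
  have "assoc_vec f = reindex_vec (\<lambda>_. True) h f"
    by (simp add: assoc_vec_def reindex_vec_def h_def case_prod_unfold)
  then show ?thesis by (simp add: app_reindex_vec[OF inj]) (simp add: h_def)
qed

text \<open>
  \<open>(\<Delta> \<otimes> id) \<Delta> = (id \<otimes> \<Delta>) \<Delta>\<close>, where operators on \<open>\<ell>\<^sup>2((X \<times> X) \<times> X)\<close> and on
  \<open>\<ell>\<^sup>2(X \<times> (X \<times> X))\<close> are identified by means of the unitary \<open>assoc_vec\<close>.
\<close>

definition coassociative :: "'a::cstar_algebra set \<Rightarrow> ('a \<Rightarrow> 'x op) \<Rightarrow> ('a \<Rightarrow> ('x \<times> 'x) op) \<Rightarrow> bool" where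
  "coassociative A \<rho> \<Delta> \<longleftrightarrow>
     (\<exists>\<Theta>\<^sub>1 \<Theta>\<^sub>2. tensor_map A \<rho> \<Delta> A \<rho> \<rho> \<Theta>\<^sub>1 \<and> tensor_map A \<rho> \<rho> A \<rho> \<Delta> \<Theta>\<^sub>2 \<and>
       (\<forall>a\<in>A. \<forall>f. assoc_vec (\<Theta>\<^sub>1 (\<Delta> a) \<triangleright> f) = \<Theta>\<^sub>2 (\<Delta> a) \<triangleright> assoc_vec f))"

definition compact_quantum_semigroup ::
  "'a::cstar_algebra set \<Rightarrow> ('a \<Rightarrow> 'x op) \<Rightarrow> ('a \<Rightarrow> ('x \<times> 'x) op) \<Rightarrow> bool" where
  "compact_quantum_semigroup A \<rho> \<Delta> \<longleftrightarrow>
     cstar_subalgebra A \<and> faithful_rep A \<rho> \<and>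
     star_hom A \<Delta> \<and> \<Delta> ` A \<subseteq> min_tensor (\<rho> ` A) (\<rho> ` A) \<and>
     (\<exists>u. is_unit A u \<and> \<Delta> u = \<rho> u \<otimes> \<rho> u) \<and>
     coassociative A \<rho> \<Delta>"

text \<open>
  Woronowicz's definition: \<open>\<Delta>(A)(A \<otimes> 1)\<close> and \<open>\<Delta>(A)(1 \<otimes> A)\<close> are linearly dense in \<open>A \<otimes> A\<close>.
\<close>

definition compact_quantum_group ::
  "'a::cstar_algebra set \<Rightarrow> ('a \<Rightarrow> 'x op) \<Rightarrow> ('a \<Rightarrow> ('x \<times> 'x) op) \<Rightarrow> bool" where
  "compact_quantum_group A \<rho> \<Delta> \<longleftrightarrow>
     compact_quantum_semigroup A \<rho> \<Delta> \<and>
     (\<exists>u. is_unit A u \<and>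
       closure (cspan {\<Delta> a * (\<rho> b \<otimes> \<rho> u) | a b. a \<in> A \<and> b \<in> A}) = min_tensor (\<rho> ` A) (\<rho> ` A) \<and>
       closure (cspan {\<Delta> a * (\<rho> u \<otimes> \<rho> b) | a b. a \<in> A \<and> b \<in> A}) = min_tensor (\<rho> ` A) (\<rho> ` A))"

definition coideal ::
  "'a::cstar_algebra set \<Rightarrow> ('a \<Rightarrow> 'x op) \<Rightarrow> ('a \<Rightarrow> ('x \<times> 'x) op) \<Rightarrow> 'a set \<Rightarrow> bool" where
  "coideal A \<rho> \<Delta> J \<longleftrightarrow> closed_ideal A J \<and>
     \<Delta> ` J \<subseteq> {x + y | x y. x \<in> min_tensor (\<rho> ` J) (\<rho> ` A) \<and> y \<in> min_tensor (\<rho> ` A) (\<rho> ` J)}"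

text \<open>\<open>(A', \<Delta>')\<close> as a compact quantum subsemigroup or subgroup of \<open>(A, \<Delta>)\<close>; here \<open>\<Theta> = \<pi> \<otimes> \<pi>\<close>.\<close>

definition compact_quantum_subsemigroup ::
  "'b::cstar_algebra set \<Rightarrow> ('b \<Rightarrow> 'y op) \<Rightarrow> ('b \<Rightarrow> ('y \<times> 'y) op) \<Rightarrow>
   'a::cstar_algebra set \<Rightarrow> ('a \<Rightarrow> 'x op) \<Rightarrow> ('a \<Rightarrow> ('x \<times> 'x) op) \<Rightarrow> bool" where
  "compact_quantum_subsemigroup A' \<rho>' \<Delta>' A \<rho> \<Delta> \<longleftrightarrow>
     compact_quantum_semigroup A' \<rho>' \<Delta>' \<and> compact_quantum_semigroup A \<rho> \<Delta> \<and>
     (\<exists>\<pi>. star_hom A \<pi> \<and> \<pi> ` A = A' \<and>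
       (\<exists>\<Theta>. tensor_map A \<rho> (\<rho>' \<circ> \<pi>) A \<rho> (\<rho>' \<circ> \<pi>) \<Theta> \<and> (\<forall>a\<in>A. \<Delta>' (\<pi> a) = \<Theta> (\<Delta> a))))"

definition compact_quantum_subgroup ::
  "'b::cstar_algebra set \<Rightarrow> ('b \<Rightarrow> 'y op) \<Rightarrow> ('b \<Rightarrow> ('y \<times> 'y) op) \<Rightarrow>
   'a::cstar_algebra set \<Rightarrow> ('a \<Rightarrow> 'x op) \<Rightarrow> ('a \<Rightarrow> ('x \<times> 'x) op) \<Rightarrow> bool" where
  "compact_quantum_subgroup A' \<rho>' \<Delta>' A \<rho> \<Delta> \<longleftrightarrow>
     compact_quantum_subsemigroup A' \<rho>' \<Delta>' A \<rho> \<Delta> \<and> compact_quantum_group A' \<rho>' \<Delta>'"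


section \<open>The reduced semigroup C*-algebra\<close>

definition cstar_red :: "'g::ab_group_add set \<Rightarrow> 'g op set" where
  "cstar_red S = cstar_generated (shift S ` S \<union> (\<lambda>a. star (shift S a)) ` S)"

definition commutator_ideal :: "'g::ab_group_add set \<Rightarrow> 'g op set" where
  "commutator_ideal S = closed_ideal_generated (cstar_red S)
     {toeplitz S c * toeplitz S d - toeplitz S d * toeplitz S c | c d. True}"

inductive_set monomials :: "'g::ab_group_add set \<Rightarrow> 'g op set" for S where
  "a \<in> S \<Longrightarrow> shift S a \<in> monomials S"
| "b \<in> S \<Longrightarrow> star (shift S b) \<in> monomials S"
| "V \<in> monomials S \<Longrightarrow> W \<in> monomials S \<Longrightarrow> V * W \<in> monomials S"

text \<open>
  \<open>\<Delta>\<close> is the continuous extension of \<open>\<Sum>\<lambda>\<^sub>i V\<^sub>i \<mapsto> \<Sum>\<lambda>\<^sub>i V\<^sub>i \<otimes> V\<^sub>i\<close>, with \<open>V\<^sub>i\<close> monomials. This determines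
  \<open>\<Delta>\<close> on \<open>cstar_red S\<close>, where linear combinations of monomials are dense. Existence is part of the
  predicate: for \<open>S = {0, 2, 3, ...} \<subseteq> \<int>\<close>, for instance, the map on linear combinations is not well defined.
\<close>

definition is_diagonal_comult :: "'g::ab_group_add set \<Rightarrow> ('g op \<Rightarrow> ('g \<times> 'g) op) \<Rightarrow> bool" where
  "is_diagonal_comult S \<Delta> \<longleftrightarrow>
     \<Delta> ` cstar_red S \<subseteq> min_tensor (cstar_red S) (cstar_red S) \<and>
     continuous_on (cstar_red S) \<Delta> \<and>
     (\<forall>(n::nat) c V. (\<forall>i<n. V i \<in> monomials S) \<longrightarrow>
        \<Delta> (\<Sum>i<n. c i *\<^sub>C V i) = (\<Sum>i<n. c i *\<^sub>C (V i \<otimes> V i)))"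

end

theory Submission
  imports Defs
begin

text \<open>
  A monomial \<open>V\<close> acts on the basis vectors deep in \<open>S\<close> as the translation by its degree, so it has a symbol,
  the corresponding character of \<open>G\<close>. Translating finitely supported vectors deep into \<open>S\<close> shows that a linear
  combination of monomials dominates in norm the combination of translations \<open>U\<^sub>v\<close> of \<open>\<ell>\<^sup>2(\<Gamma>)\<close>, which in turn
  has the norm of the combination of characters in \<open>C(G)\<close>: one inequality follows from the polynomial growth of
  abelian groups, the other from Parseval's identity for finite sets of characters, which exist in abundance
  because \<open>\<Gamma>\<close> is torsion-free. Hence the symbol extends to a \<open>*\<close>-homomorphism \<open>\<pi>\<close> onto \<open>C(G)\<close>. Both
  comultiplications are determined by \<open>V \<mapsto> V \<otimes> V\<close> on generators, so coassociativity and compatibility with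
  \<open>\<pi>\<close> only have to be checked there, given that tensor products of bounded \<open>*\<close>-homomorphisms exist.

  The projections \<open>p = 1 - T\<^sub>b T\<^sub>b*\<close> are commutators and form an approximate unit of \<open>K\<close>. Every \<open>k \<in> K\<close> is a
  series of elements \<open>k\<^sub>n p\<^sub>n\<close>, and \<open>\<Delta>(p) = p \<otimes> 1 + (1 - p) \<otimes> p\<close> gives the coideal property.
\<close>

section \<open>Subspaces of C*-algebras and bounded extensions\<close>

text \<open>The two comparisons between characters and translations serve different ends. That
  translations dominate characters bounds the symbol map and thereby makes it well defined. That
  characters dominate translations bounds the linear map sending a character to the Toeplitz
  operator of the same degree; it is a right inverse of the symbol map, so surjectivity is obtained
  without the theorem that *-homomorphisms have closed range. Torsion-freeness enters through this
  second comparison, which needs enough characters.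

  The other obstacle is the tensor product of two maps. Boundedness of the factors alone does not
  bound \<open>\<phi> \<otimes> \<psi>\<close> on \<open>min_tensor\<close>, since the norms of the
  amplifications of a linear map to matrices may grow with their size. For a *-homomorphism each
  amplification is multiplicative and compatible with \<open>star\<close>, and the C*-identity then
  turns any bound, however it depends on the size, into 1.

  The hypothesis on \<open>\<Delta>\<close> prescribes its values on finite sums of monomials. Its
  linearity, multiplicativity and compatibility with \<open>star\<close> have to be extracted from
  that formula and from continuity.\<close>

lemma scaleC_zero [simp]: "0 *\<^sub>C x = 0" "c *\<^sub>C (0 :: 'a::cstar_algebra) = 0"
  using scaleC_of_real[of 0 x] scaleC_scaleC[of c 0 "0::'a"] scaleC_of_real[of 0 "0::'a"] 
  by simp_all

lemma scaleC_one [simp]: "1 *\<^sub>C x = x" for x :: "'a::cstar_algebra"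
  using scaleC_of_real[of 1 x] by simp

lemma scaleC_minus_one: "(-1) *\<^sub>C x = - x" for x :: "'a::cstar_algebra"
  using scaleC_of_real[of "-1" x] by simp

lemma scaleC_sum_right: "c *\<^sub>C (\<Sum>i\<in>I. f i) = (\<Sum>i\<in>I. c *\<^sub>C f i)" for f :: "'i \<Rightarrow> 'a::cstar_algebra"
  by (induction I rule: infinite_finite_induct) (auto simp: scaleC_add_right)

lemma norm_star [simp]: "norm (star x) = norm x" for x :: "'a::cstar_algebra"
proof -
  have le: "norm y \<le> norm (star y)" for y :: 'a
  proof (cases "norm y = 0")
    case False
    have "norm y * norm y \<le> norm (star y) * norm y"
      using norm_mult_ineq[of "star y" y] by (simp add: norm_star_mult power2_eq_square)
    then show ?thesis using False by (simp add: mult_le_cancel_right)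
  qed simp
  show ?thesis using le[of x] le[of "star x"] by (simp add: star_star)
qed

text \<open>The class axioms tie the norm to real scalars only; the C*-identity reduces a complex
  factor to the real number \<open>cnj c * c\<close>.\<close>

lemma norm_scaleC [simp]: "norm (c *\<^sub>C x) = cmod c * norm x" for x :: "'a::cstar_algebra"
proof -
  have "(norm (c *\<^sub>C x))\<^sup>2 = norm ((cnj c * c) *\<^sub>C (star x * x))"
    by (simp add: norm_star_mult[symmetric] star_scaleC mult_scaleC_left mult_scaleC_right scaleC_scaleC
        mult.commute)
  also have "cnj c * c = of_real ((cmod c)\<^sup>2)"
    by (simp only: complex_norm_square mult.commute)
  also have "norm (of_real ((cmod c)\<^sup>2) *\<^sub>C (star x * x)) = (cmod c * norm x)\<^sup>2"
    by (simp only: scaleC_of_real norm_scaleR norm_star_mult power_mult_distrib) simp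
  finally show ?thesis by (simp add: power2_eq_iff_nonneg)
qed

lemma bounded_linear_scaleC: "bounded_linear ((*\<^sub>C) c :: 'a::cstar_algebra \<Rightarrow> 'a)"
  by (rule bounded_linear_intro[where K = "cmod c"])
     (auto simp: scaleC_add_right scaleC_scaleC scaleC_of_real[symmetric] mult.commute)

lemma bounded_linear_star: "bounded_linear (star :: 'a::cstar_algebra \<Rightarrow> 'a)"
  by (rule bounded_linear_intro[where K = 1])
     (auto simp: star_add star_scaleC scaleC_of_real[symmetric])

lemma star_zero [simp]: "star (0 :: 'a::cstar_algebra) = 0"
  by (rule linear_0[OF bounded_linear.linear[OF bounded_linear_star]])

lemma star_sum: "star (\<Sum>i\<in>I. f i) = (\<Sum>i\<in>I. star (f i :: 'a::cstar_algebra))"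
  by (induction I rule: infinite_finite_induct) (auto simp: star_add)

section \<open>Complex subspaces, spans and their closures\<close>

definition csubspace :: "'a::cstar_algebra set \<Rightarrow> bool" where
  "csubspace W \<longleftrightarrow> 0 \<in> W \<and> (\<forall>x\<in>W. \<forall>y\<in>W. x + y \<in> W) \<and> (\<forall>c. \<forall>x\<in>W. c *\<^sub>C x \<in> W)"

lemma csubspaceD:
  assumes "csubspace W"
  shows "0 \<in> W" "x \<in> W \<Longrightarrow> y \<in> W \<Longrightarrow> x + y \<in> W" "x \<in> W \<Longrightarrow> c *\<^sub>C x \<in> W"
    "x \<in> W \<Longrightarrow> y \<in> W \<Longrightarrow> x - y \<in> W"
proof -
  show *: "0 \<in> W" "x \<in> W \<Longrightarrow> y \<in> W \<Longrightarrow> x + y \<in> W" "\<And>x. x \<in> W \<Longrightarrow> c *\<^sub>C x \<in> W" for x y c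
    using assms by (auto simp: csubspace_def)
  show "x \<in> W \<Longrightarrow> y \<in> W \<Longrightarrow> x - y \<in> W"
    using *(2)[of x "- y"] *(3)[of y "-1"] by (simp add: scaleC_minus_one)
qed

lemma csubspace_sum:
  assumes "csubspace W" "\<And>i. i \<in> I \<Longrightarrow> f i \<in> W"
  shows "(\<Sum>i\<in>I. f i) \<in> W"
  using assms(2) by (induction I rule: infinite_finite_induct) (auto simp: csubspaceD[OF assms(1)])

lemma cspan_superset: "X \<subseteq> cspan X"
proof
  fix x assume "x \<in> X"
  then show "x \<in> cspan X"
    unfolding cspan_def by (intro CollectI exI[of _ "\<lambda>_. 1"] exI[of _ "{x}"]) simp
qed

lemma cspan_common:
  assumes "x \<in> cspan X" "y \<in> cspan X"
  shows "\<exists>F r s. finite F \<and> F \<subseteq> X \<and> x = (\<Sum>v\<in>F. r v *\<^sub>C v) \<and> y = (\<Sum>v\<in>F. s v *\<^sub>C v)"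
proof -
  obtain r F s G where x: "x = (\<Sum>v\<in>F. r v *\<^sub>C v)" "finite F" "F \<subseteq> X"
    and y: "y = (\<Sum>v\<in>G. s v *\<^sub>C v)" "finite G" "G \<subseteq> X" using assms unfolding cspan_def by blast
  show ?thesis
  proof (intro exI conjI)
    show "finite (F \<union> G)" "F \<union> G \<subseteq> X" using x(2,3) y(2,3) by auto
    show "x = (\<Sum>v\<in>F \<union> G. (if v \<in> F then r v else 0) *\<^sub>C v)"
      unfolding x(1) using x(2) y(2) by (intro sum.mono_neutral_cong_left) auto
    show "y = (\<Sum>v\<in>F \<union> G. (if v \<in> G then s v else 0) *\<^sub>C v)"
      unfolding y(1) using x(2) y(2) by (intro sum.mono_neutral_cong_left) auto
  qed
qed

lemma csubspace_cspan: "csubspace (cspan X)"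
  unfolding csubspace_def
proof (intro conjI ballI allI)
  show "0 \<in> cspan X" unfolding cspan_def by (intro CollectI exI[of _ "\<lambda>_. 0"] exI[of _ "{}"]) simp
  fix x y assume "x \<in> cspan X" "y \<in> cspan X"
  from cspan_common[OF this] obtain r s F where F: "finite F" "F \<subseteq> X"
    and xy: "x = (\<Sum>v\<in>F. r v *\<^sub>C v)" "y = (\<Sum>v\<in>F. s v *\<^sub>C v)" by (elim exE conjE)
  have "x + y = (\<Sum>v\<in>F. (r v + s v) *\<^sub>C v)" by (simp add: xy scaleC_add_left sum.distrib)
  then show "x + y \<in> cspan X"
    unfolding cspan_def using F by (intro CollectI exI[of _ "\<lambda>v. r v + s v"] exI[of _ F]) simp
next
  fix c x assume "x \<in> cspan X"
  then obtain r F where x: "x = (\<Sum>v\<in>F. r v *\<^sub>C v)" "finite F" "F \<subseteq> X" unfolding cspan_def by blast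
  then have "c *\<^sub>C x = (\<Sum>v\<in>F. (c * r v) *\<^sub>C v)" by (simp add: scaleC_sum_right scaleC_scaleC)
  then show "c *\<^sub>C x \<in> cspan X" unfolding cspan_def using x(2,3) by (intro CollectI exI[of _ "\<lambda>v. c * r v"] exI[of _ F]) simp
qed

lemma cspan_minimal: "csubspace W \<Longrightarrow> X \<subseteq> W \<Longrightarrow> cspan X \<subseteq> W"
  unfolding cspan_def by (auto intro!: csubspace_sum csubspaceD(3))

lemma csubspace_closure:
  assumes "csubspace W"
  shows "csubspace (closure W)"
  unfolding csubspace_def
proof (intro conjI ballI allI)
  show "0 \<in> closure W" using csubspaceD(1)[OF assms] closure_subset by blast
  fix x y assume "x \<in> closure W" "y \<in> closure W"
  then obtain u v where "\<And>n. u n \<in> W" "u \<longlonglongrightarrow> x" "\<And>n. v n \<in> W" "v \<longlonglongrightarrow> y"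
    unfolding closure_sequential by blast
  then show "x + y \<in> closure W"
    unfolding closure_sequential
    by (intro exI[of _ "\<lambda>n. u n + v n"]) (auto intro: tendsto_add csubspaceD[OF assms])
next
  fix c x assume "x \<in> closure W"
  then obtain u where "\<And>n. u n \<in> W" "u \<longlonglongrightarrow> x" unfolding closure_sequential by blast
  then show "c *\<^sub>C x \<in> closure W"
    unfolding closure_sequential
    by (intro exI[of _ "\<lambda>n. c *\<^sub>C u n"])
       (auto intro: csubspaceD[OF assms] bounded_linear.tendsto[OF bounded_linear_scaleC])
qed

lemma csubspace_closed_cspan: "csubspace (closure (cspan X))"
  by (rule csubspace_closure[OF csubspace_cspan])

lemma closed_cspan_superset: "X \<subseteq> closure (cspan X)"
  using cspan_superset closure_subset by blast

lemma closed_cspan_minimal: "csubspace W \<Longrightarrow> closed W \<Longrightarrow> X \<subseteq> W \<Longrightarrow> closure (cspan X) \<subseteq> W"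
  by (intro closure_minimal cspan_minimal)

lemma closed_cspan_mult_left:
  assumes "\<And>x. x \<in> X \<Longrightarrow> a * x \<in> W" "csubspace W" "closed W" "y \<in> closure (cspan X)"
  shows "a * y \<in> W"
proof -
  have "closure (cspan X) \<subseteq> {y. a * y \<in> W}"
  proof (rule closed_cspan_minimal)
    show "csubspace {y. a * y \<in> W}"
      using csubspaceD[OF assms(2)] by (auto simp: csubspace_def distrib_left mult_scaleC_right)
    have "isCont ((*) a) x" for x :: 'a by simp
    then show "closed {y. a * y \<in> W}"
      using continuous_closed_vimage[OF assms(3), of "(*) a"] by (simp add: vimage_def)
  qed (use assms(1) in auto)
  then show ?thesis using assms(4) by blast
qed

lemma closed_cspan_mult_right:
  assumes "\<And>x. x \<in> X \<Longrightarrow> x * a \<in> W" "csubspace W" "closed W" "y \<in> closure (cspan X)"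
  shows "y * a \<in> W"
proof -
  have "closure (cspan X) \<subseteq> {y. y * a \<in> W}"
  proof (rule closed_cspan_minimal)
    show "csubspace {y. y * a \<in> W}"
      using csubspaceD[OF assms(2)] by (auto simp: csubspace_def distrib_right mult_scaleC_left)
    have "isCont (\<lambda>x. x * a) x" for x :: 'a by simp
    then show "closed {y. y * a \<in> W}"
      using continuous_closed_vimage[OF assms(3), of "\<lambda>x. x * a"] by (simp add: vimage_def)
  qed (use assms(1) in auto)
  then show ?thesis using assms(4) by blast
qed

lemma closed_cspan_mult:
  assumes "\<And>x y. x \<in> X \<Longrightarrow> y \<in> Y \<Longrightarrow> x * y \<in> W" "csubspace W" "closed W"
    "x \<in> closure (cspan X)" "y \<in> closure (cspan Y)"
  shows "x * y \<in> W"
proof (rule closed_cspan_mult_right[OF _ assms(2,3,4)])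
  fix v assume "v \<in> X"
  then show "v * y \<in> W" by (intro closed_cspan_mult_left[OF _ assms(2,3,5)] assms(1))
qed

lemma closed_cspan_star:
  assumes "\<And>x. x \<in> X \<Longrightarrow> star x \<in> W" "csubspace W" "closed W" "y \<in> closure (cspan X)"
  shows "star y \<in> W"
proof -
  have "closure (cspan X) \<subseteq> {y. star y \<in> W}"
  proof (rule closed_cspan_minimal)
    have "star y \<in> W \<Longrightarrow> star (c *\<^sub>C y) \<in> W" for c y
      using csubspaceD(3)[OF assms(2)] by (simp add: star_scaleC)
    then show "csubspace {y. star y \<in> W}"
      using csubspaceD[OF assms(2)] by (auto simp: csubspace_def star_add)
    have "isCont star x" for x :: 'a
      by (rule linear_continuous_at[OF bounded_linear_star])
    then show "closed {y. star y \<in> W}"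
      using continuous_closed_vimage[OF assms(3), of star] by (simp add: vimage_def)
  qed (use assms(1) in auto)
  then show ?thesis using assms(4) by blast
qed

lemma cstar_subalgebra_closed_cspan:
  assumes "\<And>x y. x \<in> X \<Longrightarrow> y \<in> X \<Longrightarrow> x * y \<in> X" "\<And>x. x \<in> X \<Longrightarrow> star x \<in> X"
  shows "cstar_subalgebra (closure (cspan X))"
  unfolding cstar_subalgebra_def
proof (intro conjI ballI allI)
  note cl = csubspace_closed_cspan[of X] closed_closure[of "cspan X"] closed_cspan_superset[of X]
  show "x * y \<in> closure (cspan X)" if "x \<in> closure (cspan X)" "y \<in> closure (cspan X)" for x y
    using that by (rule closed_cspan_mult[rotated 3]) (use assms cl in auto)
  show "star x \<in> closure (cspan X)" if "x \<in> closure (cspan X)" for x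
    using that by (rule closed_cspan_star[rotated 3]) (use assms cl in auto)
qed (use csubspaceD[OF csubspace_closed_cspan[of X]] in auto)

lemma cstar_subalgebraD:
  assumes "cstar_subalgebra A"
  shows "csubspace A" "closed A" "x \<in> A \<Longrightarrow> y \<in> A \<Longrightarrow> x * y \<in> A" "x \<in> A \<Longrightarrow> star x \<in> A"
  using assms by (auto simp: cstar_subalgebra_def csubspace_def)

section \<open>Linear maps on subspaces: continuity, uniqueness, density\<close>

lemma clinear_onD:
  assumes "clinear_on A \<phi>"
  shows "x \<in> A \<Longrightarrow> y \<in> A \<Longrightarrow> \<phi> (x + y) = \<phi> x + \<phi> y" "x \<in> A \<Longrightarrow> \<phi> (c *\<^sub>C x) = c *\<^sub>C \<phi> x"
  using assms by (auto simp: clinear_on_def)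

lemma clinear_on_diff:
  assumes "clinear_on A \<phi>" "csubspace A" "x \<in> A" "y \<in> A"
  shows "\<phi> (x - y) = \<phi> x - \<phi> y"
proof -
  have "\<phi> (x + (-1) *\<^sub>C y) = \<phi> x + (-1) *\<^sub>C \<phi> y"
    using assms by (simp add: clinear_onD csubspaceD del: scaleC_one)
  then show ?thesis by (simp add: scaleC_minus_one)
qed

lemma clinear_on_zero: "clinear_on A \<phi> \<Longrightarrow> csubspace A \<Longrightarrow> \<phi> 0 = 0"
  using clinear_on_diff[of A \<phi> 0 0] csubspaceD(1) by auto

lemma clinear_on_sum:
  assumes "clinear_on A \<phi>" "csubspace A" "\<And>i. i \<in> I \<Longrightarrow> f i \<in> A"
  shows "\<phi> (\<Sum>i\<in>I. f i) = (\<Sum>i\<in>I. \<phi> (f i))"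
  using assms(3)
  by (induction I rule: infinite_finite_induct)
     (auto simp: clinear_onD[OF assms(1)] clinear_on_zero[OF assms(1,2)] csubspace_sum[OF assms(2)])

lemma clinear_on_bounded_imp_continuous:
  assumes "clinear_on A \<phi>" "csubspace A" "\<And>x. x \<in> A \<Longrightarrow> norm (\<phi> x) \<le> C * norm x"
  shows "continuous_on A \<phi>"
proof -
  have "dist (\<phi> x) (\<phi> y) \<le> \<bar>C\<bar> * dist x y" if "x \<in> A" "y \<in> A" for x y
  proof -
    have "norm (\<phi> (x - y)) \<le> C * norm (x - y)" using assms(3) csubspaceD(4)[OF assms(2)] that by blast
    also have "\<dots> \<le> \<bar>C\<bar> * norm (x - y)" by (intro mult_right_mono) auto
    finally show ?thesis using that by (simp add: dist_norm clinear_on_diff[OF assms(1,2)])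
  qed
  then have "\<bar>C\<bar>-lipschitz_on A \<phi>" by (intro lipschitz_onI) auto
  then show ?thesis by (rule lipschitz_on_continuous_on)
qed

lemma clinear_on_continuous_imp_bounded:
  assumes "clinear_on A \<phi>" "csubspace A" "continuous_on A \<phi>"
  shows "\<exists>C. \<forall>x\<in>A. norm (\<phi> x) \<le> C * norm x"
proof -
  have 0: "0 \<in> A" "\<phi> 0 = 0" using csubspaceD(1)[OF assms(2)] clinear_on_zero[OF assms(1,2)] by auto
  from assms(3) 0 obtain d where d: "d > 0" "\<And>x. x \<in> A \<Longrightarrow> norm x < d \<Longrightarrow> norm (\<phi> x) < 1"
    unfolding continuous_on_iff by (metis dist_0_norm dist_commute zero_less_one)
  have "norm (\<phi> x) \<le> (2 / d) * norm x" if x: "x \<in> A" for x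
  proof (cases "x = 0")
    case False
    define c where "c = complex_of_real (d / (2 * norm x))"
    have c: "cmod c = d / (2 * norm x)" using d(1) unfolding c_def by (subst norm_of_real) simp
    have "norm (c *\<^sub>C x) < d" using False d(1) by (simp add: c)
    then have "norm (\<phi> (c *\<^sub>C x)) < 1" using d(2) csubspaceD(3)[OF assms(2) x] by blast
    then have "cmod c * norm (\<phi> x) < 1" using clinear_onD(2)[OF assms(1) x] by simp
    then show ?thesis using False d(1) by (simp add: c field_simps)
  qed (use 0 in simp)
  then show ?thesis by blast
qed

lemma clinear_on_eqI:
  assumes "clinear_on A \<phi>" "clinear_on A \<psi>" "continuous_on A \<phi>" "continuous_on A \<psi>"
    and "A = closure (cspan X)" "\<And>x. x \<in> X \<Longrightarrow> \<phi> x = \<psi> x" "x \<in> A"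
  shows "\<phi> x = \<psi> x"
proof -
  have A: "csubspace A" "X \<subseteq> A" using assms(5) csubspace_closed_cspan closed_cspan_superset by auto
  have sub: "csubspace {x\<in>A. \<phi> x = \<psi> x}"
    using A(1) assms(1,2) clinear_on_zero[OF assms(1) A(1)] clinear_on_zero[OF assms(2) A(1)]
    by (auto simp: csubspace_def clinear_on_def)
  have "cspan X \<subseteq> {x\<in>A. \<phi> x = \<psi> x}" using A(2) assms(6) by (intro cspan_minimal[OF sub]) auto
  then have "(\<lambda>x. \<phi> x - \<psi> x) ` cspan X \<subseteq> {0}" by auto
  then have "(\<lambda>x. \<phi> x - \<psi> x) ` closure (cspan X) \<subseteq> {0}"
    using assms(3,4,5) by (intro image_closure_subset) (auto intro!: continuous_on_diff)
  then show ?thesis using assms(5,7) by auto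
qed

lemma clinear_on_closed_cspan_subset:
  assumes "clinear_on A \<phi>" "continuous_on A \<phi>" "A = closure (cspan X)"
    and "csubspace W" "closed W" "\<And>x. x \<in> X \<Longrightarrow> \<phi> x \<in> W"
  shows "\<phi> ` A \<subseteq> W"
proof -
  have A: "csubspace A" "X \<subseteq> A" using assms(3) csubspace_closed_cspan closed_cspan_superset by auto
  have sub: "csubspace {x\<in>A. \<phi> x \<in> W}"
    using A(1) assms(1,4) clinear_on_zero[OF assms(1) A(1)]
    by (auto simp: csubspace_def clinear_on_def)
  have "cspan X \<subseteq> {x\<in>A. \<phi> x \<in> W}" using A(2) assms(6) by (intro cspan_minimal[OF sub]) auto
  then show ?thesis using image_closure_subset[of "cspan X" \<phi> W] assms(2,3,5) by auto
qed

text \<open>Meant for \<open>\<Delta>\<close>, whose defining formula yields linearity only on the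
  span of the monomials.\<close>

lemma clinear_on_dense:
  assumes "csubspace D" "clinear_on D \<phi>" "continuous_on (closure D) \<phi>"
  shows "clinear_on (closure D) \<phi>"
proof -
  have lim: "(\<lambda>n. \<phi> (u n)) \<longlonglongrightarrow> \<phi> x" if "\<And>n. u n \<in> D" "u \<longlonglongrightarrow> x" for u x
  proof (rule continuous_on_tendsto_compose[OF assms(3) that(2)])
    show "x \<in> closure D" using that by (auto simp: closure_sequential)
    show "\<forall>\<^sub>F n in sequentially. u n \<in> closure D" using that(1) closure_subset[of D] by (simp add: subset_iff)
  qed
  show ?thesis unfolding clinear_on_def
  proof (intro conjI ballI allI)
    fix x y assume "x \<in> closure D" "y \<in> closure D"
    then obtain u v where u: "\<And>n. u n \<in> D" "u \<longlonglongrightarrow> x" and v: "\<And>n. v n \<in> D" "v \<longlonglongrightarrow> y"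
      unfolding closure_sequential by blast
    have "(\<lambda>n. \<phi> (u n + v n)) \<longlonglongrightarrow> \<phi> (x + y)"
      by (intro lim tendsto_add u v csubspaceD(2)[OF assms(1)])
    moreover have "(\<lambda>n. \<phi> (u n) + \<phi> (v n)) \<longlonglongrightarrow> \<phi> x + \<phi> y" by (intro lim tendsto_add u v)
    ultimately show "\<phi> (x + y) = \<phi> x + \<phi> y"
      using clinear_onD(1)[OF assms(2) u(1) v(1)] by (simp add: LIMSEQ_unique)
  next
    fix c x assume "x \<in> closure D"
    then obtain u where u: "\<And>n. u n \<in> D" "u \<longlonglongrightarrow> x" unfolding closure_sequential by blast
    have "(\<lambda>n. \<phi> (c *\<^sub>C u n)) \<longlonglongrightarrow> \<phi> (c *\<^sub>C x)"
      by (intro lim bounded_linear.tendsto[OF bounded_linear_scaleC] u csubspaceD(3)[OF assms(1)])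
    moreover have "(\<lambda>n. c *\<^sub>C \<phi> (u n)) \<longlonglongrightarrow> c *\<^sub>C \<phi> x"
      by (intro bounded_linear.tendsto[OF bounded_linear_scaleC] lim u)
    ultimately show "\<phi> (c *\<^sub>C x) = c *\<^sub>C \<phi> x"
      using clinear_onD(2)[OF assms(2) u(1)] by (simp add: LIMSEQ_unique)
  qed
qed

section \<open>*-homomorphisms checked on generators\<close>

lemma star_homD:
  assumes "star_hom A \<phi>"
  shows "clinear_on A \<phi>" "x \<in> A \<Longrightarrow> y \<in> A \<Longrightarrow> \<phi> (x * y) = \<phi> x * \<phi> y" "x \<in> A \<Longrightarrow> \<phi> (star x) = star (\<phi> x)"
  using assms by (auto simp: star_hom_def)

text \<open>Multiplicativity spreads from the generators one variable at a time: with the other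
  factor fixed, both sides are linear and continuous.\<close>

lemma star_homI:
  assumes lin: "clinear_on A \<phi>" and con: "continuous_on A \<phi>" and A: "A = closure (cspan X)"
    and X_mult: "\<And>x y. x \<in> X \<Longrightarrow> y \<in> X \<Longrightarrow> x * y \<in> X" and X_star: "\<And>x. x \<in> X \<Longrightarrow> star x \<in> X"
    and mult: "\<And>x y. x \<in> X \<Longrightarrow> y \<in> X \<Longrightarrow> \<phi> (x * y) = \<phi> x * \<phi> y"
    and star: "\<And>x. x \<in> X \<Longrightarrow> \<phi> (star x) = star (\<phi> x)"
  shows "star_hom A \<phi>"
proof -
  have alg: "cstar_subalgebra A" unfolding A using X_mult X_star by (rule cstar_subalgebra_closed_cspan)
  note algD = cstar_subalgebraD[OF alg]
  have XA: "X \<subseteq> A" unfolding A by (rule closed_cspan_superset)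
  have left: "\<phi> (x * y) = \<phi> x * \<phi> y" if "x \<in> A" "y \<in> X" for x y
  proof (rule clinear_on_eqI[where \<phi> = "\<lambda>x. \<phi> (x * y)" and \<psi> = "\<lambda>x. \<phi> x * \<phi> y", OF _ _ _ _ A _ that(1)])
    show "clinear_on A (\<lambda>x. \<phi> (x * y))" "clinear_on A (\<lambda>x. \<phi> x * \<phi> y)"
      using that(2) XA lin algD(3) by (auto simp: clinear_on_def distrib_right mult_scaleC_left subset_iff)
    show "continuous_on A (\<lambda>x. \<phi> (x * y))"
      by (rule continuous_on_compose2[OF con]) (use that(2) XA algD in \<open>auto intro!: continuous_intros\<close>)
    show "continuous_on A (\<lambda>x. \<phi> x * \<phi> y)" by (intro continuous_intros con)
  qed (use mult that(2) in blast)
  have "\<phi> (x * y) = \<phi> x * \<phi> y" if "x \<in> A" "y \<in> A" for x y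
  proof (rule clinear_on_eqI[where \<phi> = "\<lambda>y. \<phi> (x * y)" and \<psi> = "\<lambda>y. \<phi> x * \<phi> y", OF _ _ _ _ A _ that(2)])
    show "clinear_on A (\<lambda>y. \<phi> (x * y))" "clinear_on A (\<lambda>y. \<phi> x * \<phi> y)"
      using that(1) lin algD(3) by (auto simp: clinear_on_def distrib_left mult_scaleC_right subset_iff)
    show "continuous_on A (\<lambda>y. \<phi> (x * y))"
      by (rule continuous_on_compose2[OF con]) (use that(1) algD in \<open>auto intro!: continuous_intros\<close>)
    show "continuous_on A (\<lambda>y. \<phi> x * \<phi> y)" by (intro continuous_intros con)
  qed (use left that(1) in blast)
  moreover have "\<phi> (star x) = star (\<phi> x)" if "x \<in> A" for x
  proof -
    \<comment> \<open>\<open>star\<close> is conjugate-linear. Applying it on both sides of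
      \<open>\<phi>\<close> restores linearity, as \<open>clinear_on_eqI\<close> requires.\<close>
    have "star (\<phi> (star x)) = \<phi> x"
    proof (rule clinear_on_eqI[where \<phi> = "\<lambda>x. star (\<phi> (star x))" and \<psi> = \<phi>, OF _ lin _ con A _ that])
      show "clinear_on A (\<lambda>x. star (\<phi> (star x)))"
        using lin algD(4) by (auto simp: clinear_on_def star_add star_scaleC)
      show "continuous_on A (\<lambda>x. star (\<phi> (star x)))"
        by (intro bounded_linear.continuous_on[OF bounded_linear_star] continuous_on_compose2[OF con])
           (use algD(4) in \<open>auto intro: linear_continuous_on bounded_linear_star\<close>)
    qed (simp add: star star_star)
    then show ?thesis by (metis star_star)
  qed
  ultimately show ?thesis using lin by (simp add: star_hom_def)
qed

text \<open>
  The extension is obtained from the closure of the graph of \<open>\<Sum>c\<^sub>j g\<^sub>j \<mapsto> \<Sum>c\<^sub>j h\<^sub>j\<close>, on which the norm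
  bound persists; well-definedness is the case of a vanishing first component.
\<close>

lemma bounded_extension:
  fixes g :: "'i \<Rightarrow> 'a::cstar_algebra" and h :: "'i \<Rightarrow> 'b::cstar_algebra"
  assumes bound: "\<And>J c. finite J \<Longrightarrow> J \<subseteq> I \<Longrightarrow>
    norm (\<Sum>j\<in>J. c j *\<^sub>C h j) \<le> C * norm (\<Sum>j\<in>J. c j *\<^sub>C g j)"
  obtains \<phi> where "clinear_on (closure (cspan (g ` I))) \<phi>"
    "\<And>x. x \<in> closure (cspan (g ` I)) \<Longrightarrow> norm (\<phi> x) \<le> C * norm x" "\<And>i. i \<in> I \<Longrightarrow> \<phi> (g i) = h i"
proof -
  define W where "W = {(\<Sum>j\<in>J. c j *\<^sub>C g j, \<Sum>j\<in>J. c j *\<^sub>C h j) | J c. finite J \<and> J \<subseteq> I}"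
  have W_add: "(x + x', y + y') \<in> W" if "(x, y) \<in> W" "(x', y') \<in> W" for x x' y y'
  proof -
    from that(1) obtain J c where J: "finite J" "J \<subseteq> I"
      and xy: "x = (\<Sum>j\<in>J. c j *\<^sub>C g j)" "y = (\<Sum>j\<in>J. c j *\<^sub>C h j)"
      unfolding W_def by auto
    from that(2) obtain J' c' where J': "finite J'" "J' \<subseteq> I"
      and xy': "x' = (\<Sum>j\<in>J'. c' j *\<^sub>C g j)" "y' = (\<Sum>j\<in>J'. c' j *\<^sub>C h j)"
      unfolding W_def by auto
    define d where "d = (\<lambda>j. (if j \<in> J then c j else 0) + (if j \<in> J' then c' j else 0))"
    have sum: "(\<Sum>j\<in>J. c j *\<^sub>C f j) + (\<Sum>j\<in>J'. c' j *\<^sub>C f j) = (\<Sum>j\<in>J \<union> J'. d j *\<^sub>C f j)"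
      for f :: "'i \<Rightarrow> 'c::cstar_algebra"
    proof -
      have "(\<Sum>j\<in>J. c j *\<^sub>C f j) = (\<Sum>j\<in>J \<union> J'. (if j \<in> J then c j else 0) *\<^sub>C f j)"
        using J J' by (intro sum.mono_neutral_cong_left) auto
      moreover have "(\<Sum>j\<in>J'. c' j *\<^sub>C f j) = (\<Sum>j\<in>J \<union> J'. (if j \<in> J' then c' j else 0) *\<^sub>C f j)"
        using J J' by (intro sum.mono_neutral_cong_left) auto
      ultimately show ?thesis by (simp add: d_def scaleC_add_left sum.distrib)
    qed
    show ?thesis unfolding W_def xy xy' sum using J J'
      by (intro CollectI exI[of _ "J \<union> J'"] exI[of _ d]) simp
  qed
  have W_scale: "(a *\<^sub>C x, a *\<^sub>C y) \<in> W" if "(x, y) \<in> W" for a x y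
  proof -
    from that obtain J c where J: "finite J" "J \<subseteq> I"
      and xy: "x = (\<Sum>j\<in>J. c j *\<^sub>C g j)" "y = (\<Sum>j\<in>J. c j *\<^sub>C h j)"
      unfolding W_def by auto
    show ?thesis unfolding W_def xy scaleC_sum_right scaleC_scaleC using J
      by (intro CollectI exI[of _ J] exI[of _ "\<lambda>j. a * c j"]) simp
  qed
  have W_bound: "norm y \<le> C * norm x" if "(x, y) \<in> W" for x y
    using that bound unfolding W_def by auto
  have W_gen: "(g i, h i) \<in> W" if "i \<in> I" for i
    unfolding W_def using that by (intro CollectI exI[of _ "{i}"] exI[of _ "\<lambda>_. 1"]) simp
  have W_dom: "\<exists>y. (x, y) \<in> W" if "x \<in> cspan (g ` I)" for x
  proof -
    have "csubspace {x. \<exists>y. (x, y) \<in> W}"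
      unfolding csubspace_def
    proof (intro conjI ballI allI)
      have "(0, 0) \<in> W" unfolding W_def by (intro CollectI exI[of _ "{}"] exI[of _ "\<lambda>_. 0"]) simp
      then show "0 \<in> {x. \<exists>y. (x, y) \<in> W}" by blast
    qed (use W_add W_scale in blast)+
    then have "cspan (g ` I) \<subseteq> {x. \<exists>y. (x, y) \<in> W}" by (rule cspan_minimal) (use W_gen in blast)
    then show ?thesis using that by blast
  qed
  define R where "R x y \<longleftrightarrow> (\<exists>u v. (\<forall>n. (u n, v n) \<in> W) \<and> u \<longlonglongrightarrow> x \<and> v \<longlonglongrightarrow> y)" for x y
  have R_bound: "norm y \<le> C * norm x" if "R x y" for x y
  proof -
    from that obtain u v where uv: "\<And>n. (u n, v n) \<in> W" "u \<longlonglongrightarrow> x" "v \<longlonglongrightarrow> y" unfolding R_def by blast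
    show ?thesis
      by (rule LIMSEQ_le[OF tendsto_norm[OF uv(3)] tendsto_mult_left[OF tendsto_norm[OF uv(2)]]])
         (use W_bound uv(1) in blast)
  qed
  have R_add: "R (x + x') (y + y')" if "R x y" "R x' y'" for x x' y y'
  proof -
    from that obtain u v u' v' where
      "\<And>n. (u n, v n) \<in> W" "u \<longlonglongrightarrow> x" "v \<longlonglongrightarrow> y" "\<And>n. (u' n, v' n) \<in> W" "u' \<longlonglongrightarrow> x'" "v' \<longlonglongrightarrow> y'"
      unfolding R_def by blast
    then show ?thesis unfolding R_def
      by (intro exI[of _ "\<lambda>n. u n + u' n"] exI[of _ "\<lambda>n. v n + v' n"]) (auto intro: tendsto_add W_add)
  qed
  have R_scale: "R (a *\<^sub>C x) (a *\<^sub>C y)" if "R x y" for a x y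
  proof -
    from that obtain u v where "\<And>n. (u n, v n) \<in> W" "u \<longlonglongrightarrow> x" "v \<longlonglongrightarrow> y" unfolding R_def by blast
    then show ?thesis unfolding R_def
      by (intro exI[of _ "\<lambda>n. a *\<^sub>C u n"] exI[of _ "\<lambda>n. a *\<^sub>C v n"])
         (auto intro: bounded_linear.tendsto[OF bounded_linear_scaleC] W_scale)
  qed
  have R_unique: "y = y'" if "R x y" "R x y'" for x y y'
  proof -
    have "R (x + (-1) *\<^sub>C x) (y + (-1) *\<^sub>C y')" using R_add[OF that(1) R_scale[OF that(2)]] .
    then show ?thesis using R_bound by (fastforce simp: scaleC_minus_one)
  qed
  have R_total: "\<exists>y. R x y" if "x \<in> closure (cspan (g ` I))" for x
  proof -
    from that obtain u where u: "\<And>n. u n \<in> cspan (g ` I)" "u \<longlonglongrightarrow> x" unfolding closure_sequential by blast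
    have "\<forall>n. \<exists>y. (u n, y) \<in> W" using u(1) W_dom by blast
    then obtain v where v: "\<And>n. (u n, v n) \<in> W" by metis
    have le: "norm (v m - v n) \<le> C * norm (u m - u n)" for m n
      using W_bound[OF W_add[OF v[of m] W_scale[OF v[of n], of "-1"]]] by (simp add: scaleC_minus_one)
    have "Cauchy v"
    proof (rule CauchyI)
      fix e :: real assume "e > 0"
      \<comment> \<open>\<open>C\<close> may be zero or negative, so a positive number replaces it
        as the divisor.\<close>
      then have "e / (\<bar>C\<bar> + 1) > 0" by (simp add: add_nonneg_pos)
      then obtain M where M: "\<And>m n. m \<ge> M \<Longrightarrow> n \<ge> M \<Longrightarrow> norm (u m - u n) < e / (\<bar>C\<bar> + 1)"
        using CauchyD[OF LIMSEQ_imp_Cauchy[OF u(2)]] by metis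
      have "norm (v m - v n) < e" if "m \<ge> M" "n \<ge> M" for m n
      proof -
        have "norm (v m - v n) \<le> C * norm (u m - u n)" by (rule le)
        also have "\<dots> \<le> (\<bar>C\<bar> + 1) * norm (u m - u n)" by (intro mult_right_mono) auto
        also have "\<dots> < e"
        proof -
          have "\<bar>C\<bar> + 1 > 0" by simp
          then show ?thesis using M[OF that] by (simp only: pos_less_divide_eq mult.commute)
        qed
        finally show ?thesis .
      qed
      then show "\<exists>M. \<forall>m\<ge>M. \<forall>n\<ge>M. norm (v m - v n) < e" by blast
    qed
    then obtain y where "v \<longlonglongrightarrow> y" using Cauchy_convergent_iff convergent_def by blast
    then show ?thesis unfolding R_def using u(2) v by blast
  qed
  define \<phi> where "\<phi> x = (SOME y. R x y)" for x
  have \<phi>: "R x (\<phi> x)" if "x \<in> closure (cspan (g ` I))" for x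
    unfolding \<phi>_def using R_total[OF that] by (rule someI_ex)
  note cl = csubspaceD[OF csubspace_closed_cspan[of "g ` I"]]
  show thesis
  proof (rule that)
    show "clinear_on (closure (cspan (g ` I))) \<phi>"
      unfolding clinear_on_def using R_unique \<phi> R_add R_scale cl by meson
    show "norm (\<phi> x) \<le> C * norm x" if "x \<in> closure (cspan (g ` I))" for x
      using R_bound \<phi> that by blast
    fix i assume i: "i \<in> I"
    have "R (g i) (h i)" unfolding R_def using W_gen[OF i] by (metis tendsto_const)
    then show "\<phi> (g i) = h i" using \<phi> closed_cspan_superset[of "g ` I"] R_unique i by blast
  qed
qed

section \<open>Automatic contractivity from the C*-identity\<close>

text \<open>\<open>star z * z\<close> and its iterated squares are self-adjoint, so the C*-identity
  squares the norm in each round. The starting element already has norm \<open>(norm z)^2\<close>,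
  hence the exponent \<open>2 ^ Suc k\<close>.\<close>

lemma norm_iterated_square:
  fixes z :: "'a::cstar_algebra"
  shows "norm (((\<lambda>w. w * w) ^^ k) (star z * z)) = norm z ^ 2 ^ Suc k"
proof (induction k)
  case (Suc k)
  define p where "p = ((\<lambda>w. w * w) ^^ k) (star z * z)"
  have "star (((\<lambda>w. w * w) ^^ k) (star z * z)) = ((\<lambda>w. w * w) ^^ k) (star z * z)"
    by (induction k) (simp_all add: star_mult star_star)
  then have "norm (p * p) = (norm p)\<^sup>2" using norm_star_mult[of p] by (simp add: p_def)
  also have "\<dots> = norm z ^ 2 ^ Suc (Suc k)"
    unfolding p_def Suc by (simp only: power_mult[symmetric] power_Suc mult.commute)
  finally show ?case by (simp add: p_def)
qed (simp add: norm_star_mult)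

text \<open>
  The C*-identity improves any bound to the constant 1: for \<open>x = star a * a\<close> the norm of the
  \<open>2\<^sup>k\<close>-th power of \<open>x\<close> is the \<open>2\<^sup>k\<close>-th power of the norm, so that the \<open>2\<^sup>k\<close>-th root of \<open>C\<close> suffices.
\<close>

lemma star_relation_contractive:
  fixes R :: "('a::cstar_algebra \<times> 'b::cstar_algebra) set"
  assumes mult: "\<And>x y x' y'. (x, y) \<in> R \<Longrightarrow> (x', y') \<in> R \<Longrightarrow> (x * x', y * y') \<in> R"
    and star: "\<And>x y. (x, y) \<in> R \<Longrightarrow> (star x, star y) \<in> R"
    and bound: "\<And>x y. (x, y) \<in> R \<Longrightarrow> norm y \<le> C * norm x" and xy: "(x, y) \<in> R"
  shows "norm y \<le> norm x"
proof (cases "x = 0")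
  case False
  define P where "P = (\<lambda>k. (((\<lambda>w. w * w) ^^ k) (star x * x), ((\<lambda>w. w * w) ^^ k) (star y * y)))"
  have "P k \<in> R" for k
    by (induction k) (auto simp: P_def intro: mult star xy)
  then have "norm y ^ 2 ^ Suc k \<le> C * norm x ^ 2 ^ Suc k" for k
    using bound[of "fst (P k)" "snd (P k)"] by (simp add: P_def norm_iterated_square)
  then have le: "(norm y / norm x) ^ 2 ^ Suc k \<le> C" for k
    using False by (simp add: power_divide field_simps)
  show ?thesis
  proof (rule ccontr)
    assume "\<not> norm y \<le> norm x"
    then have "norm y / norm x > 1" using False by simp
    then obtain n where n: "C < (norm y / norm x) ^ n" using real_arch_pow by blast
    have "n \<le> 2 ^ Suc n" using less_exp[of "Suc n"] by linarith
    then have "(norm y / norm x) ^ n \<le> (norm y / norm x) ^ 2 ^ Suc n"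
      by (rule power_increasing) (use \<open>norm y / norm x > 1\<close> in linarith)
    with n le[of n] show False by linarith
  qed
qed (use bound[OF xy] in simp)

section \<open>Tensor products of operators\<close>

lemma norm_ell2_mono: "(\<And>x. cmod (app f x) \<le> cmod (app g x)) \<Longrightarrow> norm f \<le> norm g"
  by (rule norm_ell2_le) (auto intro: order_trans[OF sum_mono ell2_sum_le] power_mono)

lemma norm_ket [simp]: "norm (ket x) = 1"
  using cinner_self[of "ket x"] by (simp add: cinner_ket app_ket power2_eq_1_iff del: of_real_power)
    (metis norm_ge_zero of_real_eq_1_iff power2_eq_1_iff neg_0_le_iff_le not_one_le_zero)

lemma op_mat_eqI: "(\<And>x y. app (S \<triangleright> ket y) x = app (T \<triangleright> ket y) x) \<Longrightarrow> S = T"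
  by (intro op_ket_eqI ell2_eqI)

lemma app_star_ket: "app (star T \<triangleright> ket y) x = cnj (app (T \<triangleright> ket x) y)"
  by (metis app_adjoint_vec cinner_commute cinner_ket op_apply_star)

lemma op_sum_apply: "(\<Sum>i\<in>I. T i) \<triangleright> f = (\<Sum>i\<in>I. T i \<triangleright> f)"
  by (induction I rule: infinite_finite_induct) auto

lemma norm_op_le_finite:
  fixes T :: "'a op"
  assumes "0 \<le> B"
    and "\<And>F c. finite F \<Longrightarrow>
      norm (T \<triangleright> (\<Sum>x\<in>F. cscale (c x) (ket x))) \<le> B * norm (\<Sum>x\<in>F. cscale (c x) (ket x))"
  shows "norm T \<le> B"
proof (rule norm_op_le[OF assms(1)])
  fix f :: "'a ell2"
  define g where "g F = (\<Sum>x\<in>F. cscale (app f x) (ket x))" for F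
  have g: "(g \<longlongrightarrow> f) (finite_subsets_at_top UNIV)"
    using has_sum_ket[of f] unfolding has_sum_def g_def .
  have "((\<lambda>F. norm (T \<triangleright> g F)) \<longlongrightarrow> norm (T \<triangleright> f)) (finite_subsets_at_top UNIV)"
    by (intro tendsto_norm bounded_linear.tendsto[OF bounded_linear_op_apply] g)
  moreover have "((\<lambda>F. B * norm (g F)) \<longlongrightarrow> B * norm f) (finite_subsets_at_top UNIV)"
    by (intro tendsto_mult_left tendsto_norm g)
  ultimately show "norm (T \<triangleright> f) \<le> B * norm f"
    by (intro tendsto_le[OF finite_subsets_at_top_neq_bot]) (auto simp: g_def assms(2) eventually_finite_subsets_at_top)
qed

section \<open>Elementary tensors and their norms\<close>

lemma tensor_vec_simps:
  "tensor_vec (f + f') g = tensor_vec f g + tensor_vec f' g"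
  "tensor_vec f (g + g') = tensor_vec f g + tensor_vec f g'"
  "tensor_vec (cscale c f) g = cscale c (tensor_vec f g)"
  "tensor_vec f (cscale c g) = cscale c (tensor_vec f g)"
  "tensor_vec 0 g = 0" "tensor_vec f 0 = 0"
  by (rule ell2_eqI; clarsimp simp: algebra_simps)+

lemma tensor_vec_sum_left: "tensor_vec (\<Sum>i\<in>I. f i) g = (\<Sum>i\<in>I. tensor_vec (f i) g)"
  by (induction I rule: infinite_finite_induct) (auto simp: tensor_vec_simps)

lemma tensor_vec_sum_right: "tensor_vec f (\<Sum>i\<in>I. g i) = (\<Sum>i\<in>I. tensor_vec f (g i))"
  by (induction I rule: infinite_finite_induct) (auto simp: tensor_vec_simps)

lemma norm_tensor_vec_le: "norm (tensor_vec f g) \<le> norm f * norm g"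
proof (rule norm_ell2_le)
  fix F :: "('a \<times> 'b) set" assume F: "finite F"
  have "(\<Sum>p\<in>F. (cmod (app (tensor_vec f g) p))\<^sup>2)
      \<le> (\<Sum>p\<in>fst ` F \<times> snd ` F. (cmod (app (tensor_vec f g) p))\<^sup>2)"
    using F by (intro sum_mono2) (auto intro: rev_image_eqI)
  also have "\<dots> = (\<Sum>(x, y)\<in>fst ` F \<times> snd ` F. (cmod (app f x))\<^sup>2 * (cmod (app g y))\<^sup>2)"
    by (intro sum.cong) (auto simp: norm_mult power_mult_distrib)
  also have "\<dots> = (\<Sum>x\<in>fst ` F. (cmod (app f x))\<^sup>2) * (\<Sum>y\<in>snd ` F. (cmod (app g y))\<^sup>2)"
    by (simp add: sum_product sum.cartesian_product)
  also have "\<dots> \<le> (norm f)\<^sup>2 * (norm g)\<^sup>2"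
    using F by (intro mult_mono ell2_sum_le sum_nonneg) auto
  finally show "(\<Sum>p\<in>F. (cmod (app (tensor_vec f g) p))\<^sup>2) \<le> (norm f * norm g)\<^sup>2"
    by (simp add: power_mult_distrib)
qed simp

lemma op_tensor_ketI:
  "(\<And>x y. S \<triangleright> tensor_vec (ket x) (ket y) = T \<triangleright> tensor_vec (ket x) (ket y)) \<Longrightarrow> S = T"
  by (rule op_ket_eqI) (metis prod.collapse tensor_vec_ket)

lemma op_tensor_simps:
  "(S + S') \<otimes> T = S \<otimes> T + S' \<otimes> T" "S \<otimes> (T + T') = S \<otimes> T + S \<otimes> T'"
  "(c *\<^sub>C S) \<otimes> T = c *\<^sub>C (S \<otimes> T)" "S \<otimes> (c *\<^sub>C T) = c *\<^sub>C (S \<otimes> T)"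
  "(S - S') \<otimes> T = S \<otimes> T - S' \<otimes> T" "S \<otimes> (T - T') = S \<otimes> T - S \<otimes> T'"
proof -
  show a: "(S + S') \<otimes> T = S \<otimes> T + S' \<otimes> T" "S \<otimes> (T + T') = S \<otimes> T + S \<otimes> T'" for S S' T T'
    by (rule op_tensor_ketI; simp add: op_tensor tensor_vec_simps)+
  show "(c *\<^sub>C S) \<otimes> T = c *\<^sub>C (S \<otimes> T)" "S \<otimes> (c *\<^sub>C T) = c *\<^sub>C (S \<otimes> T)"
    by (rule op_tensor_ketI; simp add: op_tensor tensor_vec_simps)+
  show "(S - S') \<otimes> T = S \<otimes> T - S' \<otimes> T" using a(1)[of "S - S'" S' T] by simp
  show "S \<otimes> (T - T') = S \<otimes> T - S \<otimes> T'" using a(2)[of S "T - T'" T'] by simp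
qed

lemma op_tensor_mult: "(S \<otimes> T) * (S' \<otimes> T') = (S * S') \<otimes> (T * T')"
  by (rule op_tensor_ketI) (simp add: op_tensor)

lemma op_tensor_star: "star (S \<otimes> T) = star S \<otimes> star T"
proof (rule op_mat_eqI)
  fix p q :: "'a \<times> 'b"
  obtain x y x' y' where [simp]: "p = (x, y)" "q = (x', y')" by (cases p, cases q)
  have "app (star (S \<otimes> T) \<triangleright> ket q) p = cnj (app ((S \<otimes> T) \<triangleright> tensor_vec (ket x) (ket y)) (x', y'))"
    by (simp add: app_star_ket tensor_vec_ket)
  also have "\<dots> = app ((star S \<otimes> star T) \<triangleright> tensor_vec (ket x') (ket y')) (x, y)"
    by (simp add: op_tensor app_star_ket)
  finally show "app (star (S \<otimes> T) \<triangleright> ket q) p = app ((star S \<otimes> star T) \<triangleright> ket q) p"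
    by (simp add: tensor_vec_ket)
qed

lemma norm_slice_le:
  assumes "\<And>x. app g x = app h (x, s)"
  shows "norm g \<le> norm h"
proof (rule norm_ell2_le)
  fix F :: "'a set" assume F: "finite F"
  have "(\<Sum>x\<in>F. (cmod (app g x))\<^sup>2) = (\<Sum>p\<in>(\<lambda>x. (x, s)) ` F. (cmod (app h p))\<^sup>2)"
    using assms by (subst sum.reindex) (auto simp: inj_on_def)
  also have "\<dots> \<le> (norm h)\<^sup>2" using F by (intro ell2_sum_le) auto
  finally show "(\<Sum>x\<in>F. (cmod (app g x))\<^sup>2) \<le> (norm h)\<^sup>2" .
qed simp

lemma norm_amp_right_le: "norm (amp_right T :: ('i \<times> 'x) op) \<le> norm T"
proof (rule norm_op_le)
  fix f :: "('i \<times> 'x) ell2"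
  show "norm (amp_right T \<triangleright> f) \<le> norm T * norm f"
  proof (rule norm_ell2_le)
    fix F :: "('i \<times> 'x) set" assume F: "finite F"
    have "(\<Sum>p\<in>F. (cmod (app (amp_right T \<triangleright> f) p))\<^sup>2)
        \<le> (\<Sum>p\<in>fst ` F \<times> snd ` F. (cmod (app (amp_right T \<triangleright> f) p))\<^sup>2)"
      using F by (intro sum_mono2) (auto intro: rev_image_eqI)
    also have "\<dots> = (\<Sum>i\<in>fst ` F. \<Sum>x\<in>snd ` F. (cmod (app (T \<triangleright> slice_vec f i) x))\<^sup>2)"
      unfolding sum.cartesian_product by (intro sum.cong) (auto simp: app_amp_right)
    also have "\<dots> \<le> (\<Sum>i\<in>fst ` F. (norm T)\<^sup>2 * (norm (slice_vec f i))\<^sup>2)"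
    proof (rule sum_mono)
      fix i
      have "(\<Sum>x\<in>snd ` F. (cmod (app (T \<triangleright> slice_vec f i) x))\<^sup>2) \<le> (norm (T \<triangleright> slice_vec f i))\<^sup>2"
        using F by (intro ell2_sum_le) auto
      also have "\<dots> \<le> (norm T * norm (slice_vec f i))\<^sup>2" by (intro power_mono norm_op_apply_le) auto
      finally show "(\<Sum>x\<in>snd ` F. (cmod (app (T \<triangleright> slice_vec f i) x))\<^sup>2) \<le> (norm T)\<^sup>2 * (norm (slice_vec f i))\<^sup>2"
        by (simp add: power_mult_distrib)
    qed
    also have "\<dots> \<le> (norm T)\<^sup>2 * (norm f)\<^sup>2"
      unfolding sum_distrib_left [symmetric] using F by (intro mult_left_mono sum_norm_slice_le) auto
    finally show "(\<Sum>p\<in>F. (cmod (app (amp_right T \<triangleright> f) p))\<^sup>2) \<le> (norm T * norm f)\<^sup>2"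
      by (simp add: power_mult_distrib)
  qed simp
qed simp

lemma swap_vec_swap_vec: "swap_vec (swap_vec f) = f"
  by (rule ell2_eqI) (clarsimp simp: app_swap_vec)

lemma norm_swap_vec [simp]: "norm (swap_vec f) = norm f"
proof -
  have le: "norm (swap_vec g) \<le> norm g" for g :: "('u \<times> 'v) ell2"
    unfolding swap_vec_def by (rule norm_reindex_vec_le) simp
  show ?thesis using le[of f] le[of "swap_vec f"] by (simp add: swap_vec_swap_vec)
qed

lemma swap_vec_tensor_vec: "swap_vec (tensor_vec f g) = tensor_vec g f"
  by (rule ell2_eqI) (clarsimp simp: app_swap_vec)

lemma swap_vec_simps:
  "swap_vec (f + g) = swap_vec f + swap_vec g" "swap_vec (cscale c f) = cscale c (swap_vec f)" "swap_vec 0 = 0"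
  by (rule ell2_eqI; clarsimp simp: app_swap_vec)+

lemma swap_vec_sum: "swap_vec (\<Sum>i\<in>I. f i) = (\<Sum>i\<in>I. swap_vec (f i))"
  by (induction I rule: infinite_finite_induct) (auto simp: swap_vec_simps)

lemma op_tensor_swap: "(S \<otimes> T) \<triangleright> f = swap_vec ((T \<otimes> S) \<triangleright> swap_vec f)"
proof (rule bounded_linear_ket_eqI[where h = "op_apply (S \<otimes> T)" and k = "\<lambda>f. swap_vec ((T \<otimes> S) \<triangleright> swap_vec f)"])
  have bl: "bounded_linear (swap_vec :: ('u \<times> 'v) ell2 \<Rightarrow> _)"
    unfolding swap_vec_def by (rule bounded_linear_reindex_vec) simp
  show "bounded_linear (\<lambda>f. swap_vec ((T \<otimes> S) \<triangleright> swap_vec f))"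
    by (rule bounded_linear_compose[OF bl], rule bounded_linear_compose[OF bounded_linear_op_apply bl])
  fix c and p :: "'a \<times> 'b"
  show "(S \<otimes> T) \<triangleright> cscale c (ket p) = swap_vec ((T \<otimes> S) \<triangleright> swap_vec (cscale c (ket p)))"
    by (cases p) (simp add: swap_vec_simps swap_vec_tensor_vec op_tensor flip: tensor_vec_ket)
qed (rule bounded_linear_op_apply)

text \<open>Transfers estimates from the first tensor factor to the second. The two sums are
  conjugate under the unitary \<open>swap_vec\<close>.\<close>

lemma norm_tensor_sum_swap:
  "norm (\<Sum>j\<in>J. S j \<otimes> T j) = norm (\<Sum>j\<in>J. T j \<otimes> S j)"
proof -
  have le: "norm (\<Sum>j\<in>J. U j \<otimes> V j) \<le> norm (\<Sum>j\<in>J. V j \<otimes> U j)" for U :: "_ \<Rightarrow> 'u op" and V :: "_ \<Rightarrow> 'v op"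
  proof (rule norm_op_le)
    fix f
    have "(\<Sum>j\<in>J. U j \<otimes> V j) \<triangleright> f = swap_vec ((\<Sum>j\<in>J. V j \<otimes> U j) \<triangleright> swap_vec f)"
      by (simp add: op_sum_apply swap_vec_sum op_tensor_swap[of "U _"])
    then show "norm ((\<Sum>j\<in>J. U j \<otimes> V j) \<triangleright> f) \<le> norm (\<Sum>j\<in>J. V j \<otimes> U j) * norm f"
      using norm_op_apply_le[of "\<Sum>j\<in>J. V j \<otimes> U j" "swap_vec f"] by simp
  qed simp
  show ?thesis by (rule antisym; rule le)
qed

text \<open>\<open>S \<otimes> T\<close> is \<open>amp_right T\<close> followed by the
  swap-conjugate of \<open>amp_right S\<close>, and an amplification does not increase the norm,
  because the squared norms of the slices of a vector add up.\<close>

lemma norm_op_tensor_le: "norm (S \<otimes> T) \<le> norm S * norm T"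
proof -
  have amp: "amp_right V \<triangleright> tensor_vec f g = tensor_vec f (V \<triangleright> g)" for V :: "'v op" and f :: "'u ell2" and g
  proof (rule ell2_eqI, clarify)
    fix i x
    have "slice_vec (tensor_vec f g) i = cscale (app f i) g"
      by (rule ell2_eqI) (simp add: app_slice_vec)
    then show "app (amp_right V \<triangleright> tensor_vec f g) (i, x) = app (tensor_vec f (V \<triangleright> g)) (i, x)"
      by (simp add: app_amp_right)
  qed
  have eq: "(S \<otimes> T) \<triangleright> f = swap_vec (amp_right S \<triangleright> swap_vec (amp_right T \<triangleright> f))" for f
  proof (rule bounded_linear_ket_eqI[where h = "op_apply (S \<otimes> T)"
        and k = "\<lambda>f. swap_vec (amp_right S \<triangleright> swap_vec (amp_right T \<triangleright> f))"])
    have bl: "bounded_linear (swap_vec :: ('u \<times> 'v) ell2 \<Rightarrow> _)"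
      unfolding swap_vec_def by (rule bounded_linear_reindex_vec) simp
    show "bounded_linear (\<lambda>f. swap_vec (amp_right S \<triangleright> swap_vec (amp_right T \<triangleright> f)))"
      by (intro bounded_linear_compose[OF bl] bounded_linear_compose[OF bounded_linear_op_apply]
          bounded_linear_op_apply)
    fix c and p :: "'a \<times> 'b"
    show "(S \<otimes> T) \<triangleright> cscale c (ket p) = swap_vec (amp_right S \<triangleright> swap_vec (amp_right T \<triangleright> cscale c (ket p)))"
      by (cases p) (simp add: swap_vec_simps swap_vec_tensor_vec op_tensor amp flip: tensor_vec_ket)
  qed (rule bounded_linear_op_apply)
  show ?thesis
  proof (rule norm_op_le)
    fix f
    have "norm ((S \<otimes> T) \<triangleright> f) \<le> norm (amp_right S :: ('b \<times> 'a) op) * (norm (amp_right T :: ('a \<times> 'b) op) * norm f)"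
      unfolding eq norm_swap_vec
      by (rule order_trans[OF norm_op_apply_le]) (intro mult_left_mono, simp_all add: norm_op_apply_le)
    also have "\<dots> \<le> norm S * (norm T * norm f)"
      by (intro mult_mono norm_amp_right_le) auto
    finally show "norm ((S \<otimes> T) \<triangleright> f) \<le> norm S * norm T * norm f" by (simp add: mult.assoc)
  qed simp
qed

lemma bounded_bilinear_op_tensor: "bounded_bilinear op_tensor"
proof
  show "\<exists>K. \<forall>(S :: 'a op) (T :: 'b op). norm (S \<otimes> T) \<le> norm S * norm T * K"
    using norm_op_tensor_le by (intro exI[of _ 1]) auto
qed (simp_all add: op_tensor_simps flip: scaleC_of_real)

lemmas continuous_on_op_tensor = bounded_bilinear.continuous_on[OF bounded_bilinear_op_tensor]

section \<open>Finite compressions and matrices over an operator algebra\<close>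

definition id_op :: "'x op" where "id_op = make_op (\<lambda>f. f)"

lemma id_op_apply [simp]: "id_op \<triangleright> f = f"
  unfolding id_op_def by (rule make_op) auto

lemma norm_id_op_le: "norm id_op \<le> 1"
  by (rule norm_op_le) auto

lemma star_id_op [simp]: "star id_op = id_op"
  by (rule op_mat_eqI) (auto simp: app_star_ket app_ket)

definition unit_op :: "'x \<Rightarrow> 'x \<Rightarrow> 'x op" where
  "unit_op s t = make_op (\<lambda>f. cscale (app f t) (ket s))"

lemma unit_op_apply: "unit_op s t \<triangleright> f = cscale (app f t) (ket s)"
  unfolding unit_op_def
  by (rule make_op, rule bounded_linear_intro[where K = 1])
     (auto simp: cscale_simps norm_cscale norm_app_le simp flip: cscale_simps(7))

lemma norm_unit_op_le: "norm (unit_op s t) \<le> 1"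
  by (rule norm_op_le) (auto simp: unit_op_apply norm_cscale norm_app_le)

lemma star_unit_op: "star (unit_op s t) = unit_op t s"
  by (rule op_mat_eqI) (auto simp: app_star_ket unit_op_apply app_ket)

definition fin_proj :: "'x set \<Rightarrow> 'x op" where
  "fin_proj F = (\<Sum>s\<in>F. unit_op s s)"

lemma fin_proj_apply: "fin_proj F \<triangleright> f = (\<Sum>s\<in>F. cscale (app f s) (ket s))"
  by (simp add: fin_proj_def op_sum_apply unit_op_apply)

lemma app_fin_proj: "finite F \<Longrightarrow> app (fin_proj F \<triangleright> f) x = (if x \<in> F then app f x else 0)"
  by (simp add: fin_proj_apply app_sum app_ket if_distrib sum.delta cong: if_cong)

lemma norm_fin_proj_le: "finite F \<Longrightarrow> norm (fin_proj F) \<le> 1"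
  by (rule norm_op_le) (auto intro: norm_ell2_mono simp: app_fin_proj)

lemma star_fin_proj: "star (fin_proj F) = fin_proj F"
  by (simp add: fin_proj_def star_sum star_unit_op)

lemma fin_proj_ket: "finite F \<Longrightarrow> fin_proj F \<triangleright> ket x = (if x \<in> F then ket x else 0)"
  by (rule ell2_eqI) (auto simp: app_fin_proj app_ket)

lemma id_tensor_fin_proj_ket:
  "finite F \<Longrightarrow> (id_op \<otimes> fin_proj F) \<triangleright> ket p = (if snd p \<in> F then ket p else 0)"
  by (cases p) (auto simp: op_tensor fin_proj_ket tensor_vec_simps simp flip: tensor_vec_ket)

lemma app_id_tensor_fin_proj:
  assumes "finite F"
  shows "app ((id_op \<otimes> fin_proj F) \<triangleright> g) p = (if snd p \<in> F then app g p else 0)"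
proof -
  have "app ((id_op \<otimes> fin_proj F) \<triangleright> g) p = cinner (star (id_op \<otimes> fin_proj F) \<triangleright> ket p) g"
    by (simp add: cinner_star cinner_ket)
  also have "\<dots> = (if snd p \<in> F then app g p else 0)"
    using cinner_simps(3)[of 0 0 g]
    by (simp add: op_tensor_star star_fin_proj id_tensor_fin_proj_ket[OF assms] cinner_ket cscale_simps)
  finally show ?thesis .
qed

lemma norm_id_tensor_fin_proj_le:
  assumes "finite F"
  shows "norm (id_op \<otimes> fin_proj F :: ('x \<times> 'y) op) \<le> 1"
proof -
  have "norm (id_op :: 'x op) * norm (fin_proj F :: 'y op) \<le> 1 * 1"
    by (intro mult_mono norm_id_op_le norm_fin_proj_le assms) auto
  then show ?thesis using norm_op_tensor_le[of "id_op :: 'x op" "fin_proj F :: 'y op"] by simp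
qed

text \<open>A finitely supported vector and the finitely many coordinates at which its image is
  tested have second components in one finite set. On these data \<open>T\<close> agrees with its
  compression.\<close>

lemma norm_le_compressions:
  fixes T :: "('x \<times> 'y) op"
  assumes "\<And>F. finite F \<Longrightarrow> norm ((id_op \<otimes> fin_proj F) * T * (id_op \<otimes> fin_proj F)) \<le> B"
  shows "norm T \<le> B"
proof (rule norm_op_le_finite)
  show B: "0 \<le> B" using assms[of "{}"] norm_ge_zero order_trans by blast
  fix E :: "('x \<times> 'y) set" and c assume E: "finite E"
  define f where "f = (\<Sum>x\<in>E. cscale (c x) (ket x))"
  show "norm (T \<triangleright> f) \<le> B * norm f"
  proof (rule norm_ell2_le)
    fix H :: "('x \<times> 'y) set" assume H: "finite H"
    define F where "F = snd ` (E \<union> H)"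
    define Q where "Q = (id_op \<otimes> fin_proj F :: ('x \<times> 'y) op)"
    have F: "finite F" using E H by (simp add: F_def)
    have F_sub: "snd p \<in> F" if "p \<in> E \<or> p \<in> H" for p using that by (auto simp: F_def)
    have f: "Q \<triangleright> f = f"
      unfolding f_def op_apply_sum Q_def
      by (intro sum.cong refl) (simp add: id_tensor_fin_proj_ket[OF F] F_sub)
    have "(\<Sum>x\<in>H. (cmod (app (T \<triangleright> f) x))\<^sup>2) = (\<Sum>x\<in>H. (cmod (app (Q \<triangleright> T \<triangleright> f) x))\<^sup>2)"
      by (intro sum.cong refl) (simp add: Q_def app_id_tensor_fin_proj[OF F] F_sub)
    also have "\<dots> \<le> (norm (Q \<triangleright> T \<triangleright> f))\<^sup>2" by (rule ell2_sum_le[OF H])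
    also have "Q \<triangleright> T \<triangleright> f = (Q * T * Q) \<triangleright> f" by (simp add: f)
    also have "(norm ((Q * T * Q) \<triangleright> f))\<^sup>2 \<le> (B * norm f)\<^sup>2"
      using norm_op_apply_le[of "Q * T * Q" f] assms[OF F]
      by (intro power_mono order_trans[OF norm_op_apply_le] mult_right_mono) (auto simp: Q_def)
    finally show "(\<Sum>x\<in>H. (cmod (app (T \<triangleright> f) x))\<^sup>2) \<le> (B * norm f)\<^sup>2" .
  qed (use B in simp)
qed

text \<open>A matrix indexed by \<open>F\<close> with operators as entries, realised in the corner
  of the tensor product that belongs to the basis vectors \<open>F\<close> of the second
  factor.\<close>

definition block_op :: "'y set \<Rightarrow> ('y \<Rightarrow> 'y \<Rightarrow> 'x op) \<Rightarrow> ('x \<times> 'y) op" where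
  "block_op F m = (\<Sum>s\<in>F. \<Sum>t\<in>F. m s t \<otimes> unit_op s t)"

lemma block_op_apply:
  assumes "finite F"
  shows "block_op F m \<triangleright> tensor_vec f (ket t)
    = (if t \<in> F then \<Sum>s\<in>F. tensor_vec (m s t \<triangleright> f) (ket s) else 0)"
proof -
  have "block_op F m \<triangleright> tensor_vec f (ket t)
      = (\<Sum>s\<in>F. \<Sum>u\<in>F. if t = u then tensor_vec (m s u \<triangleright> f) (ket s) else 0)"
    unfolding block_op_def op_sum_apply op_tensor unit_op_apply
    by (intro sum.cong) (auto simp: app_ket tensor_vec_simps cscale_simps)
  then show ?thesis using assms by (auto simp: sum.delta)
qed

lemma block_op_mult:
  assumes "finite F"
  shows "block_op F m * block_op F n = block_op F (\<lambda>s t. \<Sum>r\<in>F. m s r * n r t)"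
proof (rule op_tensor_ketI)
  fix x y
  show "(block_op F m * block_op F n) \<triangleright> tensor_vec (ket x) (ket y)
      = block_op F (\<lambda>s t. \<Sum>r\<in>F. m s r * n r t) \<triangleright> tensor_vec (ket x) (ket y)"
    by (simp add: block_op_apply[OF assms] op_apply_sum op_sum_apply tensor_vec_sum_left)
       (auto intro: sum.swap)
qed

lemma block_op_star: "star (block_op F m) = block_op F (\<lambda>s t. star (m t s))"
  unfolding block_op_def star_sum op_tensor_star star_unit_op by (rule sum.swap)

lemma norm_block_op_le:
  assumes "finite F"
  shows "norm (block_op F m) \<le> (\<Sum>s\<in>F. \<Sum>t\<in>F. norm (m s t))"
proof -
  have "norm (m s t \<otimes> unit_op s t) \<le> norm (m s t)" for s t
    using norm_op_tensor_le[of "m s t" "unit_op s t"] norm_unit_op_le[of s t]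
    by (meson mult_left_le norm_ge_zero order_trans)
  then show ?thesis unfolding block_op_def by (intro sum_norm_le)
qed

lemma norm_block_op_ge:
  assumes "finite F" "s \<in> F" "t \<in> F"
  shows "norm (m s t) \<le> norm (block_op F m)"
proof (rule norm_op_le)
  fix f
  have "app (block_op F m \<triangleright> tensor_vec f (ket t)) (x, s) = app (m s t \<triangleright> f) x" for x
    using assms by (simp add: block_op_apply app_sum app_ket if_distrib sum.delta cong: if_cong)
  then have "norm (m s t \<triangleright> f) \<le> norm (block_op F m \<triangleright> tensor_vec f (ket t))"
    by (intro norm_slice_le[of _ _ s]) simp
  also have "\<dots> \<le> norm (block_op F m) * norm (tensor_vec f (ket t))" by (rule norm_op_apply_le)
  also have "\<dots> \<le> norm (block_op F m) * norm f"
    using norm_tensor_vec_le[of f "ket t"] by (intro mult_left_mono) auto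
  finally show "norm (m s t \<triangleright> f) \<le> norm (block_op F m) * norm f" .
qed simp

text \<open>Of the \<open>b j\<close> only the matrix coefficients between basis vectors in
  \<open>F\<close> survive, so the entries of the compression are linear combinations of the
  \<open>a j\<close>.\<close>

lemma compression_eq_block_op:
  assumes "finite F"
  shows "(id_op \<otimes> fin_proj F) * (\<Sum>j\<in>J. a j \<otimes> b j) * (id_op \<otimes> fin_proj F)
    = block_op F (\<lambda>s t. \<Sum>j\<in>J. app (b j \<triangleright> ket t) s *\<^sub>C a j)"
proof (rule op_tensor_ketI)
  fix x t
  show "((id_op \<otimes> fin_proj F) * (\<Sum>j\<in>J. a j \<otimes> b j) * (id_op \<otimes> fin_proj F)) \<triangleright> tensor_vec (ket x) (ket t)
    = block_op F (\<lambda>s t. \<Sum>j\<in>J. app (b j \<triangleright> ket t) s *\<^sub>C a j) \<triangleright> tensor_vec (ket x) (ket t)"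
  proof (cases "t \<in> F")
    case True
    have Q: "(id_op \<otimes> fin_proj F) \<triangleright> tensor_vec (ket x) (ket t) = tensor_vec (ket x) (ket t)"
      using True assms by (simp add: op_tensor fin_proj_ket)
    have "((id_op \<otimes> fin_proj F) * (\<Sum>j\<in>J. a j \<otimes> b j) * (id_op \<otimes> fin_proj F)) \<triangleright> tensor_vec (ket x) (ket t)
      = (\<Sum>j\<in>J. \<Sum>s\<in>F. cscale (app (b j \<triangleright> ket t) s) (tensor_vec (a j \<triangleright> ket x) (ket s)))"
      by (simp only: op_apply_simps Q)
         (simp add: op_tensor op_sum_apply op_apply_sum fin_proj_apply tensor_vec_sum_right tensor_vec_simps)
    also have "\<dots> = (\<Sum>s\<in>F. \<Sum>j\<in>J. cscale (app (b j \<triangleright> ket t) s) (tensor_vec (a j \<triangleright> ket x) (ket s)))"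
      by (rule sum.swap)
    finally show ?thesis
      using True assms
      by (simp add: block_op_apply op_sum_apply tensor_vec_sum_left tensor_vec_simps)
  qed (use assms in \<open>simp add: op_tensor fin_proj_ket tensor_vec_simps block_op_apply\<close>)
qed


text \<open>
  Compressing the second tensor factor to the span of finitely many basis vectors reduces the estimate to
  matrices over \<open>A\<close>; there the entrywise maps are multiplicative and crudely bounded, hence contractive by
  \<open>star_relation_contractive\<close>.
\<close>

lemma tensor_sum_contractive_left:
  fixes \<rho> :: "'a::cstar_algebra \<Rightarrow> 'x op" and \<phi> :: "'a \<Rightarrow> 'u op" and b :: "'i \<Rightarrow> 'y op"
  assumes A: "cstar_subalgebra A" and \<rho>: "star_hom A \<rho>" and \<phi>: "star_hom A \<phi>"
    and bound: "\<And>a. a \<in> A \<Longrightarrow> norm (\<phi> a) \<le> C * norm (\<rho> a)" and a: "\<And>j. j \<in> J \<Longrightarrow> a j \<in> A"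
  shows "norm (\<Sum>j\<in>J. \<phi> (a j) \<otimes> b j) \<le> norm (\<Sum>j\<in>J. \<rho> (a j) \<otimes> b j)"
proof (rule norm_le_compressions)
  fix F :: "'y set" assume F: "finite F"
  note algD = cstar_subalgebraD[OF A]
  define Q where "Q = fin_proj F"
  define m where "m s t = (\<Sum>j\<in>J. app (b j \<triangleright> ket t) s *\<^sub>C a j)" for s t
  have m: "m s t \<in> A" for s t
    unfolding m_def by (intro csubspace_sum csubspaceD(3) algD(1) a)
  have block: "(id_op \<otimes> Q) * (\<Sum>j\<in>J. \<psi> (a j) \<otimes> b j) * (id_op \<otimes> Q) = block_op F (\<lambda>s t. \<psi> (m s t))"
    if \<psi>: "star_hom A \<psi>" for \<psi> :: "'a \<Rightarrow> 'v op"
  proof -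
    have "\<psi> (m s t) = (\<Sum>j\<in>J. app (b j \<triangleright> ket t) s *\<^sub>C \<psi> (a j))" for s t
      unfolding m_def
      by (simp add: clinear_on_sum[OF star_homD(1)[OF \<psi>] algD(1)] a csubspaceD(3)[OF algD(1)]
          clinear_onD(2)[OF star_homD(1)[OF \<psi>]])
    then show ?thesis unfolding Q_def compression_eq_block_op[OF F] by simp
  qed
  \<comment> \<open>A relation instead of a map: it pairs the two images of one matrix
    \<open>n\<close>, and nothing has to be said beforehand about the first image determining the
    second.\<close>
  define R where "R = {(block_op F (\<lambda>s t. \<rho> (n s t)), block_op F (\<lambda>s t. \<phi> (n s t))) | n. \<forall>s t. n s t \<in> A}"
  have R: "(block_op F (\<lambda>s t. \<rho> (n s t)), block_op F (\<lambda>s t. \<phi> (n s t))) \<in> R" if "\<And>s t. n s t \<in> A" for n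
    unfolding R_def using that by blast
  have "norm (block_op F (\<lambda>s t. \<phi> (m s t))) \<le> norm (block_op F (\<lambda>s t. \<rho> (m s t)))"
  proof (rule star_relation_contractive[OF _ _ _ R[OF m]])
    fix x y assume "(x, y) \<in> R"
    then obtain n where n: "\<And>s t. n s t \<in> A"
      and x: "x = block_op F (\<lambda>s t. \<rho> (n s t))" and y: "y = block_op F (\<lambda>s t. \<phi> (n s t))"
      unfolding R_def by auto
    have "(star x, star y) = (block_op F (\<lambda>s t. \<rho> (star (n t s))), block_op F (\<lambda>s t. \<phi> (star (n t s))))"
      using n by (simp add: x y block_op_star star_homD(3)[OF \<rho>] star_homD(3)[OF \<phi>])
    also have "\<dots> \<in> R" by (rule R) (use n algD(4) in blast)
    finally show "(star x, star y) \<in> R" .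
    have "norm y \<le> (\<Sum>s\<in>F. \<Sum>t\<in>F. norm (\<phi> (n s t)))" unfolding y by (rule norm_block_op_le[OF F])
    also have "\<dots> \<le> (\<Sum>s\<in>F. \<Sum>t\<in>F. \<bar>C\<bar> * norm x)"
    proof (intro sum_mono)
      fix s t assume "s \<in> F" "t \<in> F"
      have "norm (\<phi> (n s t)) \<le> C * norm (\<rho> (n s t))" using bound n by blast
      also have "\<dots> \<le> \<bar>C\<bar> * norm x"
        unfolding x using norm_block_op_ge[OF F \<open>s \<in> F\<close> \<open>t \<in> F\<close>, of "\<lambda>s t. \<rho> (n s t)"]
        by (intro mult_mono) auto
      finally show "norm (\<phi> (n s t)) \<le> \<bar>C\<bar> * norm x" .
    qed
    finally show "norm y \<le> (real (card F) * (real (card F) * \<bar>C\<bar>)) * norm x" by (simp add: mult.assoc)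
    fix x' y' assume "(x', y') \<in> R"
    then obtain n' where n': "\<And>s t. n' s t \<in> A"
      and x': "x' = block_op F (\<lambda>s t. \<rho> (n' s t))" and y': "y' = block_op F (\<lambda>s t. \<phi> (n' s t))"
      unfolding R_def by auto
    define p where "p s t = (\<Sum>r\<in>F. n s r * n' r t)" for s t
    have hom: "(\<Sum>r\<in>F. \<psi> (n s r) * \<psi> (n' r t)) = \<psi> (p s t)" if \<psi>: "star_hom A \<psi>"
      for s t and \<psi> :: "'a \<Rightarrow> 'v op"
    proof -
      have "\<psi> (p s t) = (\<Sum>r\<in>F. \<psi> (n s r * n' r t))"
        unfolding p_def by (rule clinear_on_sum[OF star_homD(1)[OF \<psi>] algD(1)]) (intro algD(3) n n')
      then show ?thesis by (simp add: star_homD(2)[OF \<psi>] n n')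
    qed
    have "(x * x', y * y') = (block_op F (\<lambda>s t. \<rho> (p s t)), block_op F (\<lambda>s t. \<phi> (p s t)))"
      by (simp add: x y x' y' block_op_mult[OF F] hom[OF \<rho>] hom[OF \<phi>])
    also have "\<dots> \<in> R" by (rule R) (unfold p_def, intro csubspace_sum algD n n')
    finally show "(x * x', y * y') \<in> R" .
  qed
  also have "\<dots> = norm ((id_op \<otimes> Q) * (\<Sum>j\<in>J. \<rho> (a j) \<otimes> b j) * (id_op \<otimes> Q))"
    by (simp only: block[OF \<rho>])
  also have "\<dots> \<le> 1 * norm (\<Sum>j\<in>J. \<rho> (a j) \<otimes> b j) * 1"
    unfolding Q_def by (intro order_trans[OF norm_mult_ineq] mult_mono norm_id_tensor_fin_proj_le F) auto
  finally show "norm ((id_op \<otimes> fin_proj F) * (\<Sum>j\<in>J. \<phi> (a j) \<otimes> b j) * (id_op \<otimes> fin_proj F))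
      \<le> norm (\<Sum>j\<in>J. \<rho> (a j) \<otimes> b j)"
    by (simp add: block[OF \<phi>] flip: Q_def)
qed

section \<open>Existence of the tensor product of two *-homomorphisms\<close>

text \<open>One factor is exchanged at a time, by way of the mixed sum of the
  \<open>\<rho> (a j) \<otimes> \<psi> (b j)\<close>.\<close>

lemma tensor_sum_contractive:
  assumes "cstar_subalgebra A" "star_hom A \<rho>" "star_hom A \<phi>" "\<And>a. a \<in> A \<Longrightarrow> norm (\<phi> a) \<le> C * norm (\<rho> a)"
    and "cstar_subalgebra B" "star_hom B \<sigma>" "star_hom B \<psi>" "\<And>b. b \<in> B \<Longrightarrow> norm (\<psi> b) \<le> D * norm (\<sigma> b)"
    and "\<And>j. j \<in> J \<Longrightarrow> a j \<in> A" "\<And>j. j \<in> J \<Longrightarrow> b j \<in> B"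
  shows "norm (\<Sum>j\<in>J. \<phi> (a j) \<otimes> \<psi> (b j)) \<le> norm (\<Sum>j\<in>J. \<rho> (a j) \<otimes> \<sigma> (b j))"
proof -
  have "norm (\<Sum>j\<in>J. \<phi> (a j) \<otimes> \<psi> (b j)) \<le> norm (\<Sum>j\<in>J. \<rho> (a j) \<otimes> \<psi> (b j))"
    by (rule tensor_sum_contractive_left[OF assms(1-4,9)])
  also have "\<dots> \<le> norm (\<Sum>j\<in>J. \<rho> (a j) \<otimes> \<sigma> (b j))"
  proof -
    have "norm (\<Sum>j\<in>J. \<psi> (b j) \<otimes> \<rho> (a j)) \<le> norm (\<Sum>j\<in>J. \<sigma> (b j) \<otimes> \<rho> (a j))"
      by (rule tensor_sum_contractive_left[OF assms(5-8,10)])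
    moreover have "norm (\<Sum>j\<in>J. \<rho> (a j) \<otimes> \<psi> (b j)) = norm (\<Sum>j\<in>J. \<psi> (b j) \<otimes> \<rho> (a j))"
      "norm (\<Sum>j\<in>J. \<rho> (a j) \<otimes> \<sigma> (b j)) = norm (\<Sum>j\<in>J. \<sigma> (b j) \<otimes> \<rho> (a j))"
      by (rule norm_tensor_sum_swap)+
    ultimately show ?thesis by (simp only:)
  qed
  finally show ?thesis .
qed

lemma tensor_map_exists:
  fixes A :: "'a::cstar_algebra set" and B :: "'b::cstar_algebra set"
  assumes "cstar_subalgebra A" "star_hom A \<rho>" "star_hom A \<phi>" "\<And>a. a \<in> A \<Longrightarrow> norm (\<phi> a) \<le> C * norm (\<rho> a)"
    and "cstar_subalgebra B" "star_hom B \<sigma>" "star_hom B \<psi>" "\<And>b. b \<in> B \<Longrightarrow> norm (\<psi> b) \<le> D * norm (\<sigma> b)"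
  shows "\<exists>\<Theta>. tensor_map A \<rho> \<phi> B \<sigma> \<psi> \<Theta>"
proof -
  have "norm (\<Sum>j\<in>J. c j *\<^sub>C (\<phi> (fst j) \<otimes> \<psi> (snd j))) \<le> 1 * norm (\<Sum>j\<in>J. c j *\<^sub>C (\<rho> (fst j) \<otimes> \<sigma> (snd j)))"
    if "finite J" and J: "J \<subseteq> A \<times> B" for J c
  proof -
    \<comment> \<open>Absorbing the coefficients into the first factor brings the sum into the form
      treated by \<open>tensor_sum_contractive\<close>; the estimate is then the hypothesis of
      \<open>bounded_extension\<close>, with the pairs in \<open>A \<times> B\<close> as
      indices.\<close>
    have eq: "(\<Sum>j\<in>J. c j *\<^sub>C (\<alpha> (fst j) \<otimes> \<beta> (snd j))) = (\<Sum>j\<in>J. \<alpha> (c j *\<^sub>C fst j) \<otimes> \<beta> (snd j))"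
      if "star_hom A \<alpha>" for \<alpha> :: "'a \<Rightarrow> 'v op" and \<beta> :: "'b \<Rightarrow> 'w op"
      using J clinear_onD(2)[OF star_homD(1)[OF that]]
      by (intro sum.cong) (auto simp: op_tensor_simps)
    show ?thesis
      unfolding eq[OF assms(2)] eq[OF assms(3)] mult_1
      by (rule tensor_sum_contractive[OF assms])
         (use J csubspaceD(3)[OF cstar_subalgebraD(1)[OF assms(1)]] in auto)
  qed
  from bounded_extension[of "A \<times> B", OF this] obtain \<Theta> where
    \<Theta>: "clinear_on (closure (cspan ((\<lambda>p. \<rho> (fst p) \<otimes> \<sigma> (snd p)) ` (A \<times> B)))) \<Theta>"
      "\<And>x. x \<in> closure (cspan ((\<lambda>p. \<rho> (fst p) \<otimes> \<sigma> (snd p)) ` (A \<times> B))) \<Longrightarrow> norm (\<Theta> x) \<le> 1 * norm x"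
      "\<And>p. p \<in> A \<times> B \<Longrightarrow> \<Theta> (\<rho> (fst p) \<otimes> \<sigma> (snd p)) = \<phi> (fst p) \<otimes> \<psi> (snd p)"
    by blast
  have "(\<lambda>p. \<rho> (fst p) \<otimes> \<sigma> (snd p)) ` (A \<times> B) = {S \<otimes> T | S T. S \<in> \<rho> ` A \<and> T \<in> \<sigma> ` B}"
    by force
  then have "closure (cspan ((\<lambda>p. \<rho> (fst p) \<otimes> \<sigma> (snd p)) ` (A \<times> B))) = min_tensor (\<rho> ` A) (\<sigma> ` B)"
    by (simp add: min_tensor_def)
  then have "tensor_map A \<rho> \<phi> B \<sigma> \<psi> \<Theta>"
    unfolding tensor_map_def using \<Theta> clinear_on_bounded_imp_continuous[OF \<Theta>(1) csubspace_closed_cspan \<Theta>(2)]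
    by auto
  then show ?thesis by blast
qed

section \<open>Comultiplications determined by group-like generators\<close>

lemma min_tensor_mem: "S \<in> A \<Longrightarrow> T \<in> B \<Longrightarrow> S \<otimes> T \<in> min_tensor A B"
  unfolding min_tensor_def by (rule subsetD[OF closed_cspan_superset]) auto

lemma csubspace_min_tensor: "csubspace (min_tensor A B)"
  unfolding min_tensor_def by (rule csubspace_closed_cspan)

lemma closed_min_tensor: "closed (min_tensor A B)"
  unfolding min_tensor_def by simp

lemma assoc_vec_simps:
  "assoc_vec (f + g) = assoc_vec f + assoc_vec g" "assoc_vec (cscale c f) = cscale c (assoc_vec f)"
  "assoc_vec 0 = 0"
  by (rule ell2_eqI; clarsimp simp: app_assoc_vec)+

lemma bounded_linear_assoc_vec: "bounded_linear (assoc_vec :: (('x \<times> 'y) \<times> 'z) ell2 \<Rightarrow> _)"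
proof -
  define h where "h = (\<lambda>(x :: 'x, y :: 'y, z :: 'z). ((x, y), z))"
  have inj: "inj_on h {x. True}" by (auto simp: inj_on_def h_def)
  have "assoc_vec f = reindex_vec (\<lambda>_. True) h f" for f
    by (rule ell2_eqI) (clarsimp simp: app_assoc_vec app_reindex_vec[OF inj], simp add: h_def)
  then have "assoc_vec = reindex_vec (\<lambda>_. True) h" by (rule ext)
  then show ?thesis using bounded_linear_reindex_vec[OF inj] by (simp only:)
qed

lemma assoc_vec_op_tensor: "assoc_vec (((S \<otimes> T) \<otimes> U) \<triangleright> f) = (S \<otimes> T \<otimes> U) \<triangleright> assoc_vec f"
proof (rule bounded_linear_ket_eqI[where h = "\<lambda>f. assoc_vec (((S \<otimes> T) \<otimes> U) \<triangleright> f)"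
      and k = "\<lambda>f. (S \<otimes> T \<otimes> U) \<triangleright> assoc_vec f"])
  have tens: "assoc_vec (tensor_vec (tensor_vec u v) w) = tensor_vec u (tensor_vec v w)"
    for u :: "'a ell2" and v :: "'b ell2" and w :: "'c ell2"
    by (rule ell2_eqI) (clarsimp simp: app_assoc_vec)
  fix c and p :: "('a \<times> 'b) \<times> 'c"
  obtain x y z where p: "ket p = tensor_vec (tensor_vec (ket x) (ket y)) (ket z)"
    by (metis prod.collapse tensor_vec_ket)
  show "assoc_vec (((S \<otimes> T) \<otimes> U) \<triangleright> cscale c (ket p)) = (S \<otimes> T \<otimes> U) \<triangleright> assoc_vec (cscale c (ket p))"
    by (simp add: p assoc_vec_simps tens op_tensor)
qed (rule bounded_linear_compose[OF bounded_linear_assoc_vec bounded_linear_op_apply]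
    bounded_linear_compose[OF bounded_linear_op_apply bounded_linear_assoc_vec])+

lemma bounded_linear_op_apply_left: "bounded_linear (\<lambda>T. T \<triangleright> f)"
  by (rule bounded_linear_intro[where K = "norm f"]) (auto simp: norm_op_apply_le)

text \<open>On a generator both iterated comultiplications give the threefold tensor power of
  \<open>\<rho> x\<close>, up to rebracketing; density does the rest.\<close>

lemma coassociative_grouplike:
  assumes A: "cstar_subalgebra A" "A = closure (cspan X)" and \<rho>: "star_hom A \<rho>" and \<Delta>: "star_hom A \<Delta>"
    and bound: "\<And>a. a \<in> A \<Longrightarrow> norm (\<Delta> a) \<le> C * norm (\<rho> a)" and cont: "continuous_on A \<Delta>"
    and range: "\<Delta> ` A \<subseteq> min_tensor (\<rho> ` A) (\<rho> ` A)"
    and grouplike: "\<And>x. x \<in> X \<Longrightarrow> \<Delta> x = \<rho> x \<otimes> \<rho> x"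
  shows "coassociative A \<rho> \<Delta>"
proof -
  have refl: "norm (\<rho> a) \<le> 1 * norm (\<rho> a)" for a by simp
  obtain \<Theta>\<^sub>1 where \<Theta>\<^sub>1: "tensor_map A \<rho> \<Delta> A \<rho> \<rho> \<Theta>\<^sub>1"
    using tensor_map_exists[OF A(1) \<rho> \<Delta> bound A(1) \<rho> \<rho> refl] by blast
  obtain \<Theta>\<^sub>2 where \<Theta>\<^sub>2: "tensor_map A \<rho> \<rho> A \<rho> \<Delta> \<Theta>\<^sub>2"
    using tensor_map_exists[OF A(1) \<rho> \<rho> refl A(1) \<rho> \<Delta> bound] by blast
  have XA: "X \<subseteq> A" using A(2) closed_cspan_superset by auto
  have "assoc_vec (\<Theta>\<^sub>1 (\<Delta> a) \<triangleright> f) = \<Theta>\<^sub>2 (\<Delta> a) \<triangleright> assoc_vec f" if a: "a \<in> A" for a f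
  proof -
    \<comment> \<open>The two sides are operators on different spaces, so they are compared on a
      fixed vector \<open>f\<close>. As \<open>E\<close> takes its values in \<open>ell2\<close>,
      which is not a C*-algebra, the argument of \<open>clinear_on_eqI\<close> is repeated by
      hand.\<close>
    define E where "E a = assoc_vec (\<Theta>\<^sub>1 (\<Delta> a) \<triangleright> f) - \<Theta>\<^sub>2 (\<Delta> a) \<triangleright> assoc_vec f" for a
    have lin: "clinear_on A (\<lambda>a. \<Theta> (\<Delta> a))" and con: "continuous_on A (\<lambda>a. \<Theta> (\<Delta> a))"
      if "clinear_on (min_tensor (\<rho> ` A) (\<rho> ` A)) \<Theta>" "continuous_on (min_tensor (\<rho> ` A) (\<rho> ` A)) \<Theta>"
      for \<Theta> :: "_ \<Rightarrow> 'v op"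
    proof -
      show "clinear_on A (\<lambda>a. \<Theta> (\<Delta> a))"
        using that(1) star_homD(1)[OF \<Delta>] range by (auto simp: clinear_on_def image_subset_iff)
      show "continuous_on A (\<lambda>a. \<Theta> (\<Delta> a))"
        by (rule continuous_on_compose2[OF that(2) cont range])
    qed
    have l1: "clinear_on A (\<lambda>a. \<Theta>\<^sub>1 (\<Delta> a))" and l2: "clinear_on A (\<lambda>a. \<Theta>\<^sub>2 (\<Delta> a))"
      and c1: "continuous_on A (\<lambda>a. \<Theta>\<^sub>1 (\<Delta> a))" and c2: "continuous_on A (\<lambda>a. \<Theta>\<^sub>2 (\<Delta> a))"
      using \<Theta>\<^sub>1 \<Theta>\<^sub>2 by (auto simp: tensor_map_def intro!: lin con)
    have E_con: "continuous_on A E"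
      unfolding E_def
      by (intro continuous_on_diff bounded_linear.continuous_on[OF bounded_linear_assoc_vec]
          bounded_linear.continuous_on[OF bounded_linear_op_apply_left] c1 c2)
    have "csubspace {a\<in>A. E a = 0}"
      using csubspaceD[OF cstar_subalgebraD(1)[OF A(1)]] clinear_onD[OF l1] clinear_onD[OF l2]
        clinear_on_zero[OF l1] clinear_on_zero[OF l2] cstar_subalgebraD(1)[OF A(1)]
      by (auto simp: csubspace_def E_def assoc_vec_simps)
    moreover have "X \<subseteq> {a\<in>A. E a = 0}"
    proof
      fix x assume x: "x \<in> X"
      then have "x \<in> A" using XA by blast
      then have "\<Theta>\<^sub>1 (\<Delta> x) = (\<rho> x \<otimes> \<rho> x) \<otimes> \<rho> x" "\<Theta>\<^sub>2 (\<Delta> x) = \<rho> x \<otimes> \<rho> x \<otimes> \<rho> x"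
        using \<Theta>\<^sub>1 \<Theta>\<^sub>2 grouplike[OF x] by (auto simp: tensor_map_def)
      then show "x \<in> {a\<in>A. E a = 0}" using \<open>x \<in> A\<close> by (simp add: E_def assoc_vec_op_tensor)
    qed
    ultimately have "cspan X \<subseteq> {a\<in>A. E a = 0}" by (rule cspan_minimal)
    then have "E ` closure (cspan X) \<subseteq> {0}"
      using E_con A(2) by (intro image_closure_subset) auto
    then show ?thesis using a A(2) by (auto simp: E_def)
  qed
  then show ?thesis unfolding coassociative_def using \<Theta>\<^sub>1 \<Theta>\<^sub>2 by blast
qed

lemma compact_quantum_semigroup_grouplike:
  assumes A: "cstar_subalgebra A" "A = closure (cspan X)" and \<rho>: "faithful_rep A \<rho>" and \<Delta>: "star_hom A \<Delta>"
    and bound: "\<And>a. a \<in> A \<Longrightarrow> norm (\<Delta> a) \<le> C * norm (\<rho> a)" and cont: "continuous_on A \<Delta>"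
    and grouplike: "\<And>x. x \<in> X \<Longrightarrow> \<Delta> x = \<rho> x \<otimes> \<rho> x"
    and unit: "is_unit A u" "u \<in> X"
  shows "compact_quantum_semigroup A \<rho> \<Delta>"
proof -
  have XA: "X \<subseteq> A" using A(2) closed_cspan_superset by auto
  have hom: "star_hom A \<rho>" using \<rho> by (simp add: faithful_rep_def)
  have "\<Delta> ` A \<subseteq> min_tensor (\<rho> ` A) (\<rho> ` A)"
    by (rule clinear_on_closed_cspan_subset[OF star_homD(1)[OF \<Delta>] cont A(2) csubspace_min_tensor closed_min_tensor])
       (use XA grouplike in \<open>auto intro: min_tensor_mem\<close>)
  then show ?thesis
    unfolding compact_quantum_semigroup_def
    using A(1) \<rho> \<Delta> unit grouplike[OF unit(2)]
      coassociative_grouplike[OF A hom \<Delta> bound cont _ grouplike] by blast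
qed

text \<open>The estimate of \<open>\<rho>' \<circ> \<pi>\<close> by \<open>\<rho>\<close> provides
  \<open>\<pi> \<otimes> \<pi>\<close> on the spatial tensor product; the intertwining relation then
  holds because it holds on generators.\<close>

lemma compact_quantum_subsemigroup_grouplike:
  fixes A' :: "'b::cstar_algebra set" and A :: "'a::cstar_algebra set"
  assumes cqs: "compact_quantum_semigroup A' \<rho>' \<Delta>'" "compact_quantum_semigroup A \<rho> \<Delta>"
    and A: "A = closure (cspan X)" and \<Delta>: "continuous_on A \<Delta>" and \<Delta>': "continuous_on A (\<lambda>a. \<Delta>' (\<pi> a))"
    and \<pi>: "star_hom A \<pi>" "\<pi> ` A = A'" and bound: "\<And>a. a \<in> A \<Longrightarrow> norm (\<rho>' (\<pi> a)) \<le> C * norm (\<rho> a)"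
    and grouplike: "\<And>x. x \<in> X \<Longrightarrow> \<Delta> x = \<rho> x \<otimes> \<rho> x"
      "\<And>x. x \<in> X \<Longrightarrow> \<Delta>' (\<pi> x) = \<rho>' (\<pi> x) \<otimes> \<rho>' (\<pi> x)"
  shows "compact_quantum_subsemigroup A' \<rho>' \<Delta>' A \<rho> \<Delta>"
proof -
  have alg: "cstar_subalgebra A" and \<rho>: "star_hom A \<rho>" and hom: "star_hom A \<Delta>"
    and range: "\<Delta> ` A \<subseteq> min_tensor (\<rho> ` A) (\<rho> ` A)" and \<rho>': "star_hom A' \<rho>'" and hom': "star_hom A' \<Delta>'"
    using cqs by (auto simp: compact_quantum_semigroup_def faithful_rep_def)
  have XA: "X \<subseteq> A" using A closed_cspan_superset by auto
  have comp: "star_hom A (\<phi> \<circ> \<pi>)" if "star_hom A' \<phi>" for \<phi> :: "'b \<Rightarrow> 'v op"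
    using that \<pi> by (auto simp: star_hom_def clinear_on_def)
  have bound': "norm ((\<rho>' \<circ> \<pi>) a) \<le> C * norm (\<rho> a)" if "a \<in> A" for a using bound[OF that] by simp
  obtain \<Theta> where \<Theta>: "tensor_map A \<rho> (\<rho>' \<circ> \<pi>) A \<rho> (\<rho>' \<circ> \<pi>) \<Theta>"
    using tensor_map_exists[OF alg \<rho> comp[OF \<rho>'] bound' alg \<rho> comp[OF \<rho>'] bound'] by blast
  have "\<Delta>' (\<pi> a) = \<Theta> (\<Delta> a)" if "a \<in> A" for a
  proof (rule clinear_on_eqI[where \<phi> = "\<lambda>a. \<Delta>' (\<pi> a)" and \<psi> = "\<lambda>a. \<Theta> (\<Delta> a)", OF _ _ \<Delta>' _ A _ that])
    show "clinear_on A (\<lambda>a. \<Delta>' (\<pi> a))" using star_homD(1)[OF comp[OF hom']] by (simp add: o_def)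
    show "clinear_on A (\<lambda>a. \<Theta> (\<Delta> a))"
      using \<Theta> star_homD(1)[OF hom] range by (auto simp: tensor_map_def clinear_on_def image_subset_iff)
    show "continuous_on A (\<lambda>a. \<Theta> (\<Delta> a))"
      using \<Theta> by (intro continuous_on_compose2[OF _ \<Delta> range]) (simp add: tensor_map_def)
    show "\<Delta>' (\<pi> x) = \<Theta> (\<Delta> x)" if "x \<in> X" for x
      using \<Theta> that XA grouplike[OF that] by (auto simp: tensor_map_def)
  qed
  then show ?thesis
    unfolding compact_quantum_subsemigroup_def using cqs \<pi> \<Theta> by blast
qed

section \<open>Characters of torsion-free abelian groups\<close>

text \<open>Written as a constant sum to match the form in which torsion-freeness is
  assumed.\<close>

definition nmult :: "nat \<Rightarrow> 'a::ab_group_add \<Rightarrow> 'a" where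
  "nmult n x = (\<Sum>i<n. x)"

lemma nmult_simps [simp]: "nmult 0 x = 0" "nmult (Suc n) x = nmult n x + x"
  by (simp_all add: nmult_def)

lemma nmult_add: "nmult (m + n) x = nmult m x + nmult n x"
  by (induction n) (simp_all add: algebra_simps)

lemma nmult_distrib: "nmult n (x + y) = nmult n x + nmult n y" "nmult n (x - y) = nmult n x - nmult n y"
  by (induction n) (simp_all add: algebra_simps)

lemma nmult_nmult: "nmult m (nmult n x) = nmult (m * n) x"
  by (induction m) (simp_all add: nmult_add algebra_simps)

definition zmult :: "int \<Rightarrow> 'a::ab_group_add \<Rightarrow> 'a" where
  "zmult k x = nmult (nat k) x - nmult (nat (- k)) x"

text \<open>Frees the laws of integer multiples from sign cases: an integer may be written as any
  difference of naturals.\<close>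

lemma zmult_diff_nat: "zmult (int m - int n) x = nmult m x - nmult n x"
proof (cases "n \<le> m")
  case True
  then have "nmult m x = nmult (m - n) x + nmult n x" by (simp flip: nmult_add)
  with True show ?thesis by (simp add: zmult_def nat_diff_distrib)
next
  case False
  then have "nmult n x = nmult (n - m) x + nmult m x" by (simp flip: nmult_add)
  with False show ?thesis by (simp add: zmult_def nat_diff_distrib)
qed

lemma zmult_add: "zmult (k + l) x = zmult k x + zmult l x"
proof -
  obtain m n p q where kl: "k = int m - int n" "l = int p - int q" by (metis int_diff_cases)
  have "k + l = int (m + p) - int (n + q)" by (simp add: kl)
  then have "zmult (k + l) x = nmult (m + p) x - nmult (n + q) x" by (simp only: zmult_diff_nat)
  also have "\<dots> = zmult k x + zmult l x" unfolding kl zmult_diff_nat by (simp add: nmult_add)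
  finally show ?thesis .
qed

lemma zmult_mult: "zmult k (zmult l x) = zmult (k * l) x"
proof -
  obtain m n p q where kl: "k = int m - int n" "l = int p - int q" by (metis int_diff_cases)
  have "k * l = int (m * p + n * q) - int (m * q + n * p)"
    by (simp add: kl algebra_simps)
  then have "zmult (k * l) x = nmult (m * p + n * q) x - nmult (m * q + n * p) x"
    by (simp only: zmult_diff_nat)
  also have "\<dots> = zmult k (zmult l x)"
    unfolding kl zmult_diff_nat by (simp add: nmult_distrib nmult_nmult nmult_add)
  finally show ?thesis ..
qed

lemma zmult_simps [simp]: "zmult 0 x = 0" "zmult 1 x = x" "zmult (-1) x = - x"
  by (simp_all add: zmult_def nmult_def)

lemma zmult_diff: "zmult (k - l) x = zmult k x - zmult l x"
  using zmult_add[of "k - l" l x] by simp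

lemma zmult_Pair: "zmult k (a, b) = (zmult k a, zmult k b)"
proof -
  have "nmult n (a, b) = (nmult n a, nmult n b)" for n by (induction n) (simp_all add: zero_prod_def)
  then show ?thesis by (simp add: zmult_def)
qed

lemma zmult_real: "zmult k (r :: real) = of_int k * r"
proof -
  have "nmult n r = of_nat n * r" for n by (simp add: nmult_def)
  then show ?thesis by (cases "0 \<le> k") (simp_all add: zmult_def)
qed

section \<open>Extension of additive functionals\<close>

definition add_subgroup :: "'a::ab_group_add set \<Rightarrow> bool" where
  "add_subgroup H \<longleftrightarrow> 0 \<in> H \<and> (\<forall>x\<in>H. \<forall>y\<in>H. x - y \<in> H)"

lemma add_subgroupD:
  assumes "add_subgroup H"
  shows "0 \<in> H" "x \<in> H \<Longrightarrow> y \<in> H \<Longrightarrow> x - y \<in> H" "x \<in> H \<Longrightarrow> - x \<in> H"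
    "x \<in> H \<Longrightarrow> y \<in> H \<Longrightarrow> x + y \<in> H" "x \<in> H \<Longrightarrow> zmult k x \<in> H"
proof -
  show 0: "0 \<in> H" and diff: "\<And>x y. x \<in> H \<Longrightarrow> y \<in> H \<Longrightarrow> x - y \<in> H"
    using assms by (auto simp: add_subgroup_def)
  show minus: "- x \<in> H" if "x \<in> H" for x using diff[OF 0 that] by simp
  show add: "x + y \<in> H" if "x \<in> H" "y \<in> H" for x y using diff[OF that(1) minus[OF that(2)]] by simp
  assume x: "x \<in> H"
  have "nmult n x \<in> H" for n by (induction n) (auto simp: 0 x add)
  then show "zmult k x \<in> H" by (auto simp: zmult_def intro: diff)
qed

text \<open>
  Zorn's lemma is applied to the graphs of additive maps from subgroups to \<open>\<real>\<close>, that is, to the subgroups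
  of \<open>\<Gamma> \<times> \<real>\<close> in which the first component determines the second. Such a map extends to a further
  element \<open>x\<close>, since the only possible constraint \<open>k x \<in> H\<close> can be solved by division by \<open>k\<close>.
\<close>

lemma add_subgroup_graph_extend:
  fixes M :: "('g::ab_group_add \<times> real) set"
  assumes M: "add_subgroup M" and fn: "\<And>r. (0, r) \<in> M \<Longrightarrow> r = 0"
  obtains t where "add_subgroup {p + zmult k (x, t) | p k. p \<in> M}"
    "\<And>r. (0, r) \<in> {p + zmult k (x, t) | p k. p \<in> M} \<Longrightarrow> r = 0"
proof -
  have fun_eq: "r = s" if "(a, r) \<in> M" "(a, s) \<in> M" for a r s
    using fn[of "r - s"] add_subgroupD(2)[OF M that] by simp
  obtain t where t: "\<And>k s. (zmult k x, s) \<in> M \<Longrightarrow> of_int k * t = s"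
  proof (cases "\<exists>k s. k \<noteq> 0 \<and> (zmult k x, s) \<in> M")
    case True
    then obtain k0 t0 where k0: "k0 \<noteq> 0" "(zmult k0 x, t0) \<in> M" by blast
    have "of_int k * (t0 / of_int k0) = s" if s: "(zmult k x, s) \<in> M" for k s
    proof -
      \<comment> \<open>Two constraints are compared at the common multiple \<open>k * k0\<close>,
        where the graph admits only one value.\<close>
      have "(zmult (k * k0) x, of_int k * t0) \<in> M"
        using add_subgroupD(5)[OF M k0(2), of k] by (simp add: zmult_Pair zmult_mult zmult_real)
      moreover have "(zmult (k * k0) x, of_int k0 * s) \<in> M"
        using add_subgroupD(5)[OF M s, of k0] by (simp add: zmult_Pair zmult_mult zmult_real mult.commute)
      ultimately have "of_int k * t0 = of_int k0 * s" by (rule fun_eq)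
      then show ?thesis using k0(1) by (simp add: field_simps)
    qed
    then show ?thesis by (rule that)
  next
    case False
    \<comment> \<open>No nonzero multiple of \<open>x\<close> lies in the domain, so the value at
      \<open>x\<close> is unconstrained and 0 is an arbitrary choice.\<close>
    then have "of_int k * 0 = s" if "(zmult k x, s) \<in> M" for k s
      using that fn by (cases "k = 0") auto
    then show ?thesis by (rule that)
  qed
  show thesis
  proof (rule that[of t])
    show "add_subgroup {p + zmult k (x, t) | p k. p \<in> M}"
      unfolding add_subgroup_def
    proof (intro conjI ballI)
      show "0 \<in> {p + zmult k (x, t) | p k. p \<in> M}"
        using add_subgroupD(1)[OF M] by (intro CollectI exI[of _ 0]) simp
      fix y z assume "y \<in> {p + zmult k (x, t) | p k. p \<in> M}" "z \<in> {p + zmult k (x, t) | p k. p \<in> M}"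
      then obtain p k q l where y: "y = p + zmult k (x, t)" "p \<in> M" and z: "z = q + zmult l (x, t)" "q \<in> M"
        by auto
      have "y - z = (p - q) + zmult (k - l) (x, t)" by (simp add: y z zmult_diff)
      then show "y - z \<in> {p + zmult k (x, t) | p k. p \<in> M}" using add_subgroupD(2)[OF M y(2) z(2)] by blast
    qed
    fix r assume "(0, r) \<in> {p + zmult k (x, t) | p k. p \<in> M}"
    then obtain p k where p: "p \<in> M" "(0, r) = p + zmult k (x, t)" by auto
    obtain h s where hs: "p = (h, s)" by (cases p)
    have "h = - zmult k x" and r: "r = s + of_int k * t"
      using p(2) by (simp_all add: hs zmult_Pair zmult_real eq_neg_iff_add_eq_0)
    then have "(zmult k x, - s) \<in> M" using add_subgroupD(3)[OF M p(1)] by (simp add: hs)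
    from t[OF this] show "r = 0" by (simp add: r)
  qed
qed

lemma additive_functional_exists:
  fixes e :: "'g::ab_group_add"
  assumes free: "\<And>k. zmult k e = 0 \<Longrightarrow> k = 0"
  shows "\<exists>\<phi> :: 'g \<Rightarrow> real. (\<forall>a b. \<phi> (a + b) = \<phi> a + \<phi> b) \<and> \<phi> e = 1"
proof -
  define \<A> :: "('g \<times> real) set set" where
    "\<A> = {M. add_subgroup M \<and> (\<forall>r. (0, r) \<in> M \<longrightarrow> r = 0) \<and> (e, 1) \<in> M}"
  have "\<exists>M\<in>\<A>. \<forall>X\<in>\<A>. M \<subseteq> X \<longrightarrow> X = M"
  proof (rule subset_Zorn_nonempty)
    \<comment> \<open>The graph of the functional on the multiples of \<open>e\<close>; freeness of
      \<open>e\<close> makes it single-valued.\<close>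
    define M0 where "M0 = range (\<lambda>k. zmult k (e, 1 :: real))"
    have M0: "zmult k (e, 1) \<in> M0" for k by (simp add: M0_def)
    have "add_subgroup M0"
      unfolding add_subgroup_def
    proof (intro conjI ballI)
      show "0 \<in> M0" using M0[of 0] by simp
      fix x y assume "x \<in> M0" "y \<in> M0"
      then obtain k l where "x = zmult k (e, 1)" "y = zmult l (e, 1)" by (auto simp: M0_def)
      then show "x - y \<in> M0" using M0[of "k - l"] by (simp add: zmult_diff)
    qed
    moreover have "r = 0" if "(0, r) \<in> M0" for r
      using that free by (auto simp: M0_def zmult_Pair zmult_real)
    moreover have "(e, 1) \<in> M0" using M0[of 1] by simp
    ultimately have "M0 \<in> \<A>" by (simp add: \<A>_def)
    then show "\<A> \<noteq> {}" by blast
    fix \<C> assume \<C>: "\<C> \<noteq> {}" "subset.chain \<A> \<C>"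
    then have sub: "\<C> \<subseteq> \<A>" and tot: "\<And>X Y. X \<in> \<C> \<Longrightarrow> Y \<in> \<C> \<Longrightarrow> X \<subseteq> Y \<or> Y \<subseteq> X"
      by (auto simp: subset.chain_def)
    have "x - y \<in> \<Union>\<C>" if "x \<in> \<Union>\<C>" "y \<in> \<Union>\<C>" for x y
    proof -
      from that obtain X Y where XY: "X \<in> \<C>" "x \<in> X" "Y \<in> \<C>" "y \<in> Y" by blast
      then obtain Z where "Z \<in> \<C>" "x \<in> Z" "y \<in> Z" using tot[OF XY(1,3)] by blast
      moreover have "add_subgroup Z" using sub \<open>Z \<in> \<C>\<close> by (auto simp: \<A>_def)
      ultimately show ?thesis using add_subgroupD(2)[of Z x y] by blast
    qed
    moreover have "0 \<in> \<Union>\<C>" "(e, 1) \<in> \<Union>\<C>"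
      using \<C>(1) sub add_subgroupD(1) by (fastforce simp: \<A>_def)+
    moreover have "r = 0" if "(0, r) \<in> \<Union>\<C>" for r using that sub by (auto simp: \<A>_def)
    ultimately show "\<Union>\<C> \<in> \<A>" by (auto simp: \<A>_def add_subgroup_def)
  qed
  then obtain M where M: "M \<in> \<A>" and max: "\<And>X. X \<in> \<A> \<Longrightarrow> M \<subseteq> X \<Longrightarrow> X = M" by blast
  have sg: "add_subgroup M" and fn: "\<And>r. (0, r) \<in> M \<Longrightarrow> r = 0" and e: "(e, 1) \<in> M"
    using M by (auto simp: \<A>_def)
  have fun_eq: "r = s" if "(a, r) \<in> M" "(a, s) \<in> M" for a r s
    using fn[of "r - s"] add_subgroupD(2)[OF sg that] by simp
  have total: "\<exists>r. (x, r) \<in> M" for x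
  proof -
    from add_subgroup_graph_extend[OF sg fn, of x] obtain t where
      t: "add_subgroup {p + zmult k (x, t) | p k. p \<in> M}"
        "\<And>r. (0, r) \<in> {p + zmult k (x, t) | p k. p \<in> M} \<Longrightarrow> r = 0" by blast
    have sub: "M \<subseteq> {p + zmult k (x, t) | p k. p \<in> M}"
    proof
      fix p assume "p \<in> M"
      then show "p \<in> {p + zmult k (x, t) | p k. p \<in> M}" by (intro CollectI exI[of _ p] exI[of _ 0]) simp
    qed
    with t e have "{p + zmult k (x, t) | p k. p \<in> M} \<in> \<A>" unfolding \<A>_def by blast
    then have "{p + zmult k (x, t) | p k. p \<in> M} = M" using max sub by blast
    moreover have "(x, t) \<in> {p + zmult k (x, t) | p k. p \<in> M}"
      using add_subgroupD(1)[OF sg] by (intro CollectI exI[of _ 0] exI[of _ 1]) simp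
    ultimately show ?thesis by blast
  qed
  then obtain \<phi> where \<phi>: "\<And>x. (x, \<phi> x) \<in> M" by metis
  show ?thesis
  proof (intro exI conjI allI)
    show "\<phi> (a + b) = \<phi> a + \<phi> b" for a b
      using fun_eq[OF \<phi>[of "a + b"]] add_subgroupD(4)[OF sg \<phi>[of a] \<phi>[of b]] by simp
    show "\<phi> e = 1" using fun_eq[OF \<phi> e] .
  qed
qed

section \<open>Characters with prescribed values and Parseval's identity\<close>

lemma dual_apply_simps:
  "cmod (dual_apply \<xi> a) = 1" "dual_apply \<xi> (a + b) = dual_apply \<xi> a * dual_apply \<xi> b"
  "dual_apply \<xi> 0 = 1" "dual_apply \<xi> (- a) = cnj (dual_apply \<xi> a)"
  "dual_apply \<xi> (b - a) = cnj (dual_apply \<xi> a) * dual_apply \<xi> b"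
proof -
  show n: "cmod (dual_apply \<xi> a) = 1" and m: "dual_apply \<xi> (a + b) = dual_apply \<xi> a * dual_apply \<xi> b" for a b
    using dual_apply[of \<xi>] by auto
  have "dual_apply \<xi> 0 * dual_apply \<xi> 0 = dual_apply \<xi> 0" using m[of 0 0] by simp
  then show z: "dual_apply \<xi> 0 = 1" using n[of 0] by (metis mult_cancel_right1 norm_zero zero_neq_one)
  show mi: "dual_apply \<xi> (- a) = cnj (dual_apply \<xi> a)" for a
  proof -
    have "dual_apply \<xi> a * dual_apply \<xi> (- a) = 1" using m[of a "- a"] z by simp
    moreover have "cnj (dual_apply \<xi> a) * dual_apply \<xi> a = 1"
      using n[of a] complex_norm_square[of "dual_apply \<xi> a"] by (simp add: mult.commute)
    ultimately show ?thesis by (metis mult.assoc mult_1 mult_1_right)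
  qed
  show "dual_apply \<xi> (b - a) = cnj (dual_apply \<xi> a) * dual_apply \<xi> b"
    using m[of "- a" b] mi[of a] by simp
qed

lemma dual_apply_times: "dual_apply (\<xi> * \<psi>) a = dual_apply \<xi> a * dual_apply \<psi> a"
  by (simp add: times_dual.rep_eq)

lemma dual_apply_prod: "dual_apply (\<Prod>i\<in>I. \<xi> i) a = (\<Prod>i\<in>I. dual_apply (\<xi> i) a)"
  by (induction I rule: infinite_finite_induct) (auto simp: dual_apply_times one_dual.rep_eq)

text \<open>An additive functional with value 1 at \<open>e\<close> is wrapped around the circle at
  half speed. The exact value -1, and not merely a value other than 1, lets a factor
  \<open>1 + \<psi>\<close> vanish later.\<close>

lemma dual_separates:
  fixes e :: "'g::ab_group_add"
  assumes torsion_free: "\<And>(a :: 'g) n. 0 < n \<Longrightarrow> nmult n a = 0 \<Longrightarrow> a = 0" and e: "e \<noteq> 0"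
  shows "\<exists>\<xi>. dual_apply \<xi> e = -1"
proof -
  have free: "k = 0" if k: "zmult k e = 0" for k
  proof (cases "k \<ge> 0")
    case True
    then show ?thesis using k torsion_free[of "nat k" e] e by (cases "k = 0") (auto simp: zmult_def)
  next
    case False
    then show ?thesis using k torsion_free[of "nat (- k)" e] e by (auto simp: zmult_def)
  qed
  have "\<exists>\<phi> :: 'g \<Rightarrow> real. (\<forall>a b. \<phi> (a + b) = \<phi> a + \<phi> b) \<and> \<phi> e = 1"
    by (rule additive_functional_exists) (rule free)
  then obtain \<phi> :: "'g \<Rightarrow> real" where \<phi>: "\<And>a b. \<phi> (a + b) = \<phi> a + \<phi> b" "\<phi> e = 1" by auto
  have "dual_apply (Abs_dual (\<lambda>a. cis (pi * \<phi> a))) = (\<lambda>a. cis (pi * \<phi> a))"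
    by (rule Abs_dual_inverse) (simp add: \<phi>(1) cis_mult distrib_left)
  then have "dual_apply (Abs_dual (\<lambda>a. cis (pi * \<phi> a))) e = -1" by (simp add: \<phi>(2))
  then show ?thesis by blast
qed

text \<open>
  With \<open>\<psi>\<^sub>e(e) = -1\<close>, the characters \<open>\<Prod>e\<in>B. \<psi>\<^sub>e\<close> for \<open>B \<subseteq> E\<close> add up to \<open>\<Prod>e\<in>E. (1 + \<psi>\<^sub>e)\<close>, which vanishes
  on \<open>E\<close>. Their average replaces the Haar measure of the dual group.
\<close>

lemma orthogonal_characters:
  fixes E :: "'g::ab_group_add set"
  assumes torsion_free: "\<And>(a :: 'g) n. 0 < n \<Longrightarrow> nmult n a = 0 \<Longrightarrow> a = 0"
    and E: "finite E" "0 \<notin> E"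
  shows "\<exists>(I :: 'g set set) (\<xi> :: 'g set \<Rightarrow> 'g dual). finite I \<and> I \<noteq> {} \<and>
    (\<forall>e\<in>E. (\<Sum>i\<in>I. dual_apply (\<xi> i) e) = 0)"
proof -
  have "\<exists>\<xi> :: 'g dual. e \<noteq> 0 \<longrightarrow> dual_apply \<xi> e = -1" for e
  proof (cases "e = 0")
    case False
    have "\<exists>\<xi> :: 'g dual. dual_apply \<xi> e = -1" using torsion_free False by (rule dual_separates)
    then show ?thesis by blast
  qed simp
  then obtain \<psi> :: "'g \<Rightarrow> 'g dual" where \<psi>: "\<And>e. e \<noteq> 0 \<Longrightarrow> dual_apply (\<psi> e) e = -1" by metis
  show ?thesis
  proof (intro exI[of _ "Pow E"] exI[of _ "\<lambda>B. \<Prod>e\<in>B. \<psi> e"] conjI ballI)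
    fix e assume e: "e \<in> E"
    have "(\<Sum>B\<in>Pow E. dual_apply (\<Prod>e\<in>B. \<psi> e) e) = (\<Prod>d\<in>E. dual_apply (\<psi> d) e + 1)"
      unfolding prod_add[OF E(1)] dual_apply_prod by simp
    also have "\<dots> = 0" 
    proof (rule prod_zero[OF E(1)])
      have "e \<noteq> 0" using e E(2) by blast
      then show "\<exists>d\<in>E. dual_apply (\<psi> d) e + 1 = 0" using \<psi>[of e] e by (intro bexI[of _ e]) simp_all
    qed
    finally show "(\<Sum>B\<in>Pow E. dual_apply (\<Prod>e\<in>B. \<psi> e) e) = 0" .
  qed (use E in auto)
qed

lemma cinner_sum_right: "cinner f (\<Sum>i\<in>I. g i) = (\<Sum>i\<in>I. cinner f (g i))"
  by (rule linear_sum[OF bounded_linear.linear[OF bounded_linear_cinner(1)]])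

text \<open>Expanding the squares leaves the character sums at \<open>g l - g k\<close>. They are
  \<open>card I\<close> times the inner products of the kets, as every character is 1 at a zero
  difference. The function \<open>g\<close> may take equal values, so the double sums produced by
  applying translations fit in without collecting terms.\<close>

lemma parseval_characters:
  fixes \<xi> :: "'i \<Rightarrow> 'g::ab_group_add dual"
  assumes "finite K"
    and orth: "\<And>k l. k \<in> K \<Longrightarrow> l \<in> K \<Longrightarrow> g k \<noteq> g l \<Longrightarrow> (\<Sum>i\<in>I. dual_apply (\<xi> i) (g l - g k)) = 0"
  shows "of_nat (card I) * (norm (\<Sum>k\<in>K. cscale (w k) (ket (g k))))\<^sup>2
    = (\<Sum>i\<in>I. (cmod (\<Sum>k\<in>K. w k * dual_apply (\<xi> i) (g k)))\<^sup>2)"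
proof -
  have "complex_of_real (\<Sum>i\<in>I. (cmod (\<Sum>k\<in>K. w k * dual_apply (\<xi> i) (g k)))\<^sup>2)
      = (\<Sum>i\<in>I. cnj (\<Sum>k\<in>K. w k * dual_apply (\<xi> i) (g k)) * (\<Sum>k\<in>K. w k * dual_apply (\<xi> i) (g k)))"
    unfolding of_real_sum by (simp only: complex_norm_square mult.commute)
  also have "\<dots> = (\<Sum>i\<in>I. \<Sum>k\<in>K. \<Sum>l\<in>K. cnj (w k) * w l * dual_apply (\<xi> i) (g l - g k))"
    unfolding cnj_sum sum_product by (intro sum.cong refl) (simp add: dual_apply_simps(5) mult_ac)
  also have "\<dots> = (\<Sum>k\<in>K. \<Sum>l\<in>K. \<Sum>i\<in>I. cnj (w k) * w l * dual_apply (\<xi> i) (g l - g k))"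
    by (subst sum.swap, intro sum.cong refl, rule sum.swap)
  also have "\<dots> = (\<Sum>k\<in>K. \<Sum>l\<in>K. cnj (w k) * w l * (\<Sum>i\<in>I. dual_apply (\<xi> i) (g l - g k)))"
    by (simp only: sum_distrib_left)
  also have "\<dots> = (\<Sum>k\<in>K. \<Sum>l\<in>K. cnj (w k) * w l * (of_nat (card I) * cinner (ket (g k)) (ket (g l))))"
    using orth by (intro sum.cong refl) (auto simp: cinner_ket app_ket dual_apply_simps(3))
  also have "\<dots> = of_nat (card I) * cinner (\<Sum>k\<in>K. cscale (w k) (ket (g k))) (\<Sum>k\<in>K. cscale (w k) (ket (g k)))"
    by (simp add: cinner_sum_left cinner_sum_right cinner_simps sum_distrib_left algebra_simps)
       (rule sum.swap)
  also have "\<dots> = complex_of_real (of_nat (card I) * (norm (\<Sum>k\<in>K. cscale (w k) (ket (g k))))\<^sup>2)"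
    by (simp add: cinner_self)
  finally show ?thesis by (simp only: of_real_eq_iff)
qed

section \<open>The group C*-algebra and the supremum norm\<close>

lemma translation_sum_ket:
  "(\<Sum>j\<in>J. c j *\<^sub>C shift UNIV (v j)) \<triangleright> (\<Sum>x\<in>F. cscale (d x) (ket x))
    = (\<Sum>p\<in>J \<times> F. cscale (c (fst p) * d (snd p)) (ket (v (fst p) + snd p)))"
proof -
  have cs: "cscale a (\<Sum>i\<in>I. f i) = (\<Sum>i\<in>I. cscale a (f i))" for a I and f :: "'i \<Rightarrow> 'z ell2"
    by (induction I rule: infinite_finite_induct) (auto simp: cscale_simps)
  have "(\<Sum>j\<in>J. c j *\<^sub>C shift UNIV (v j)) \<triangleright> (\<Sum>x\<in>F. cscale (d x) (ket x))
      = (\<Sum>j\<in>J. \<Sum>x\<in>F. cscale (c j * d x) (ket (v j + x)))"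
    unfolding op_sum_apply op_apply_sum op_apply_scaleC cs op_apply_cscale
    by (simp add: shift_ket cscale_simps mult.commute) (rule sum.swap)
  then show ?thesis by (simp add: sum.cartesian_product case_prod_unfold)
qed

text \<open>At each of finitely many suitable characters, a sum of translations acts as
  multiplication by its symbol, which is at most \<open>B\<close> in modulus. Parseval's identity
  for the vector and for its image carries this over to \<open>ell2\<close>.\<close>

lemma norm_translation_sum_le:
  fixes v :: "'i \<Rightarrow> 'g::ab_group_add"
  assumes torsion_free: "\<And>(a :: 'g) n. 0 < n \<Longrightarrow> nmult n a = 0 \<Longrightarrow> a = 0"
    and J: "finite J" and le: "\<And>\<xi>. cmod (\<Sum>j\<in>J. c j * dual_apply \<xi> (v j)) \<le> B"
  shows "norm (\<Sum>j\<in>J. c j *\<^sub>C shift UNIV (v j)) \<le> B"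
proof (rule norm_op_le_finite)
  show B: "0 \<le> B" using le[of 1] norm_ge_zero order_trans by blast
  fix F :: "'g set" and d assume F: "finite F"
  define f where "f = (\<Sum>x\<in>F. cscale (d x) (ket x))"
  define g where "g p = v (fst p) + snd p" for p :: "'i \<times> 'g"
  \<comment> \<open>The differences for the image vector and those for \<open>f\<close> together, so
    that one family of characters serves both applications of Parseval's identity.\<close>
  define E where "E = ((\<lambda>(p, q). g q - g p) ` ((J \<times> F) \<times> (J \<times> F)) \<union> (\<lambda>(x, y). y - x) ` (F \<times> F)) - {0}"
  have E: "finite E" "0 \<notin> E" using J F by (auto simp: E_def)
  obtain I :: "'g set set" and \<xi> :: "'g set \<Rightarrow> 'g dual"
    where I: "finite I" "I \<noteq> {}" and \<xi>: "\<And>e. e \<in> E \<Longrightarrow> (\<Sum>i\<in>I. dual_apply (\<xi> i) e) = 0"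
  proof -
    have "\<exists>(I :: 'g set set) (\<xi> :: 'g set \<Rightarrow> 'g dual). finite I \<and> I \<noteq> {} \<and>
        (\<forall>e\<in>E. (\<Sum>i\<in>I. dual_apply (\<xi> i) e) = 0)"
      using torsion_free E by (rule orthogonal_characters)
    then show ?thesis using that by auto
  qed
  have cI: "0 < real (card I)" using I by (simp add: card_gt_0_iff)
  have "real (card I) * (norm ((\<Sum>j\<in>J. c j *\<^sub>C shift UNIV (v j)) \<triangleright> f))\<^sup>2
      = (\<Sum>i\<in>I. (cmod (\<Sum>p\<in>J \<times> F. (c (fst p) * d (snd p)) * dual_apply (\<xi> i) (g p)))\<^sup>2)"
    unfolding f_def translation_sum_ket g_def[symmetric]
  proof (rule parseval_characters)
    fix p q assume "p \<in> J \<times> F" "q \<in> J \<times> F" "g p \<noteq> g q"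
    then have "g q - g p \<in> E" by (auto simp: E_def image_iff)
    then show "(\<Sum>i\<in>I. dual_apply (\<xi> i) (g q - g p)) = 0" by (rule \<xi>)
  qed (use J F in auto)
  also have "\<dots> = (\<Sum>i\<in>I. (cmod (\<Sum>j\<in>J. c j * dual_apply (\<xi> i) (v j)))\<^sup>2 * (cmod (\<Sum>x\<in>F. d x * dual_apply (\<xi> i) x))\<^sup>2)"
  proof (intro sum.cong refl)
    fix i
    have "(\<Sum>p\<in>J \<times> F. (c (fst p) * d (snd p)) * dual_apply (\<xi> i) (g p))
        = (\<Sum>j\<in>J. c j * dual_apply (\<xi> i) (v j)) * (\<Sum>x\<in>F. d x * dual_apply (\<xi> i) x)"
      unfolding sum_product sum.cartesian_product
      by (intro sum.cong refl) (auto simp: g_def dual_apply_simps(2))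
    then show "(cmod (\<Sum>p\<in>J \<times> F. (c (fst p) * d (snd p)) * dual_apply (\<xi> i) (g p)))\<^sup>2
        = (cmod (\<Sum>j\<in>J. c j * dual_apply (\<xi> i) (v j)))\<^sup>2 * (cmod (\<Sum>x\<in>F. d x * dual_apply (\<xi> i) x))\<^sup>2"
      by (simp only: norm_mult power_mult_distrib)
  qed
  also have "\<dots> \<le> (\<Sum>i\<in>I. B\<^sup>2 * (cmod (\<Sum>x\<in>F. d x * dual_apply (\<xi> i) x))\<^sup>2)"
    by (intro sum_mono mult_right_mono power_mono le) auto
  also have "\<dots> = B\<^sup>2 * (real (card I) * (norm f)\<^sup>2)"
    unfolding sum_distrib_left[symmetric] f_def
  proof (subst parseval_characters)
    fix x y assume "x \<in> F" "y \<in> F" "x \<noteq> y"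
    then have "y - x \<in> E" by (auto simp: E_def image_iff)
    then show "(\<Sum>i\<in>I. dual_apply (\<xi> i) (y - x)) = 0" by (rule \<xi>)
  qed (use F in auto)
  finally have "real (card I) * (norm ((\<Sum>j\<in>J. c j *\<^sub>C shift UNIV (v j)) \<triangleright> f))\<^sup>2
      \<le> real (card I) * (B * norm f)\<^sup>2" by (simp add: power_mult_distrib algebra_simps)
  then have "(norm ((\<Sum>j\<in>J. c j *\<^sub>C shift UNIV (v j)) \<triangleright> f))\<^sup>2 \<le> (B * norm f)\<^sup>2"
    using cI by (simp only: mult_le_cancel_left_pos)
  then show "norm ((\<Sum>j\<in>J. c j *\<^sub>C shift UNIV (v j)) \<triangleright> f) \<le> B * norm f"
    by (rule power2_le_imp_le) (use B in simp)
qed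

lemma le_if_power_le_polynomial:
  fixes r s :: real
  assumes "0 \<le> r" "0 \<le> s" and le: "\<And>n. r ^ n \<le> (real n + 1) ^ k * s ^ n"
  shows "r \<le> s"
proof (rule ccontr)
  assume "\<not> r \<le> s"
  then have rs: "s < r" by simp
  show False
  proof (cases "s = 0")
    case True
    then show False using le[of 1] rs by simp
  next
    case False
    then have s: "0 < s" using assms(2) by simp
    \<comment> \<open>The root reduces polynomial growth to \<open>x ^ n \<le> n + 1\<close> with
      \<open>x > 1\<close>. Its order is \<open>Suc k\<close>, which is positive even for
      \<open>k = 0\<close>.\<close>
    define x where "x = root (Suc k) (r / s)"
    have rs1: "1 < r / s" using rs s by simp
    then have x: "1 < x" "x ^ Suc k = r / s"
      by (simp_all add: x_def real_root_pow_pos del: power_Suc)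
    have "x ^ n \<le> real n + 1" for n
    proof -
      have "(x ^ n) ^ Suc k = (r / s) ^ n" by (metis x(2) power_commutes power_mult mult.commute)
      also have "\<dots> \<le> (real n + 1) ^ k" using le[of n] s by (simp add: power_divide field_simps)
      also have "\<dots> \<le> (real n + 1) ^ Suc k" by (rule power_increasing) auto
      finally show ?thesis by (rule power_le_imp_le_base) simp
    qed
    then have bound: "1 \<le> real (Suc n) * (1 / x) ^ n" for n
      using x(1) by (simp add: power_divide field_simps)
    have "(\<lambda>n. real n * (1 / x) ^ n) \<longlonglongrightarrow> 0"
      using powser_times_n_limit_0[of "1 / x"] x(1) by simp
    moreover have "(\<lambda>n. (1 / x) ^ n) \<longlonglongrightarrow> 0" using x(1) by (intro LIMSEQ_power_zero) simp
    ultimately have "(\<lambda>n. real n * (1 / x) ^ n + (1 / x) ^ n) \<longlonglongrightarrow> 0 + 0" by (rule tendsto_add)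
    then have "(\<lambda>n. real (Suc n) * (1 / x) ^ n) \<longlonglongrightarrow> 0" by (simp add: algebra_simps)
    then have "1 \<le> (0 :: real)" by (rule LIMSEQ_le_const) (use bound in blast)
    then show False by simp
  qed
qed

text \<open>
  Because the group is abelian, the \<open>n\<close>-th power of \<open>T = \<Sum>c\<^sub>j U\<^sub>v\<^sub>j\<close> applied to \<open>ket 0\<close> has at most
  \<open>(n+1)\<^sup>|\<^sup>J\<^sup>|\<close> nonzero entries; each of them is bounded by \<open>\<parallel>T\<parallel>\<^sup>n\<close>.
\<close>

lemma norm_character_sum_le:
  fixes v :: "'i \<Rightarrow> 'g::ab_group_add"
  assumes J: "finite J"
  shows "cmod (\<Sum>j\<in>J. c j * dual_apply \<xi> (v j)) \<le> norm (\<Sum>j\<in>J. c j *\<^sub>C shift UNIV (v j))"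
proof (rule le_if_power_le_polynomial[where k = "card J"])
  define T where "T = (\<Sum>j\<in>J. c j *\<^sub>C shift UNIV (v j))"
  define z where "z = (\<Sum>j\<in>J. c j * dual_apply \<xi> (v j))"
  \<comment> \<open>Each multiplicity is bounded by \<open>n\<close> separately, although it is
    their total that equals \<open>n\<close>: such a box is trivial to count.\<close>
  define B where "B n = (\<lambda>m. \<Sum>j\<in>J. nmult (m j) (v j)) ` (PiE J (\<lambda>_. {..n}))" for n :: nat
  have fin: "finite (B n)" for n unfolding B_def using J by (intro finite_imageI finite_PiE) auto
  have card: "card (B n) \<le> (n + 1) ^ card J" for n
  proof -
    have "card (B n) \<le> card (PiE J (\<lambda>_. {..n}))"
      unfolding B_def using J by (intro card_image_le finite_PiE) auto
    then show ?thesis using J by (simp add: card_PiE)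
  qed
  have step: "v j + g \<in> B (Suc n)" if "j \<in> J" "g \<in> B n" for j g n
  proof -
    from that(2) obtain m where m: "m \<in> PiE J (\<lambda>_. {..n})" "g = (\<Sum>i\<in>J. nmult (m i) (v i))"
      by (auto simp: B_def)
    define m' where "m' = m(j := Suc (m j))"
    have "(\<Sum>i\<in>J. nmult (m' i) (v i)) = nmult (m' j) (v j) + (\<Sum>i\<in>J - {j}. nmult (m' i) (v i))"
      using J that(1) by (simp add: sum.remove)
    also have "(\<Sum>i\<in>J - {j}. nmult (m' i) (v i)) = (\<Sum>i\<in>J - {j}. nmult (m i) (v i))"
      by (intro sum.cong) (auto simp: m'_def)
    also have "nmult (m' j) (v j) + \<dots> = v j + g"
      unfolding m(2) using J that(1) by (simp add: sum.remove[of J j] m'_def)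
    finally have "v j + g = (\<Sum>i\<in>J. nmult (m' i) (v i))" ..
    moreover have "m' \<in> PiE J (\<lambda>_. {..Suc n})"
      using m(1) that(1) by (auto simp: m'_def PiE_iff extensional_def le_Suc_eq)
    ultimately show ?thesis unfolding B_def by blast
  qed
  \<comment> \<open>A character is square summable only on a finite group, so pairing with
    \<open>\<xi>\<close> is not an inner product. It is carried along as a finite sum over
    \<open>B n\<close>, in which applying \<open>T\<close> multiplies by \<open>z\<close>.\<close>
  have main: "\<exists>\<mu>. (op_apply T ^^ n) (ket 0) = (\<Sum>g\<in>B n. cscale (\<mu> g) (ket g))
      \<and> (\<Sum>g\<in>B n. \<mu> g * dual_apply \<xi> g) = z ^ n" for n
  proof (induction n)
    case 0
    have "B 0 = {0}"
    proof -
      have "B 0 \<subseteq> {0}" by (auto simp: B_def PiE_iff)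
      moreover have "(\<Sum>j\<in>J. nmult ((\<lambda>j\<in>J. 0) j) (v j)) \<in> B 0" unfolding B_def by (rule imageI) auto
      then have "0 \<in> B 0" by simp
      ultimately show ?thesis by blast
    qed
    then show ?case by (intro exI[of _ "\<lambda>_. 1"]) (simp add: cscale_simps dual_apply_simps)
  next
    case (Suc n)
    then obtain \<mu> where \<mu>: "(op_apply T ^^ n) (ket 0) = (\<Sum>g\<in>B n. cscale (\<mu> g) (ket g))"
      "(\<Sum>g\<in>B n. \<mu> g * dual_apply \<xi> g) = z ^ n" by blast
    define h where "h p = v (fst p) + snd p" for p :: "'i \<times> 'g"
    define \<nu> where "\<nu> g = (\<Sum>p\<in>{p\<in>J \<times> B n. h p = g}. c (fst p) * \<mu> (snd p))" for g
    have h: "h ` (J \<times> B n) \<subseteq> B (Suc n)" by (auto simp: h_def step)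
    have finJB: "finite (J \<times> B n)" using J fin by simp
    have cs: "cscale (\<Sum>i\<in>I. a i) u = (\<Sum>i\<in>I. cscale (a i) u)" for a :: "'z \<Rightarrow> complex" and I and u :: "'g ell2"
      by (induction I rule: infinite_finite_induct) (auto simp: cscale_simps)
    have "(op_apply T ^^ Suc n) (ket 0) = T \<triangleright> (\<Sum>g\<in>B n. cscale (\<mu> g) (ket g))"
      by (simp add: \<mu>(1))
    also have "\<dots> = (\<Sum>p\<in>J \<times> B n. cscale (c (fst p) * \<mu> (snd p)) (ket (h p)))"
      unfolding T_def translation_sum_ket h_def ..
    also have "\<dots> = (\<Sum>g\<in>B (Suc n). \<Sum>p\<in>{p\<in>J \<times> B n. h p = g}. cscale (c (fst p) * \<mu> (snd p)) (ket (h p)))"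
      by (rule sum.group[OF finJB fin h, symmetric])
    also have "\<dots> = (\<Sum>g\<in>B (Suc n). cscale (\<nu> g) (ket g))"
      unfolding \<nu>_def cs by (intro sum.cong refl) auto
    finally have 1: "(op_apply T ^^ Suc n) (ket 0) = (\<Sum>g\<in>B (Suc n). cscale (\<nu> g) (ket g))" .
    have "(\<Sum>g\<in>B (Suc n). \<nu> g * dual_apply \<xi> g)
        = (\<Sum>g\<in>B (Suc n). \<Sum>p\<in>{p\<in>J \<times> B n. h p = g}. c (fst p) * \<mu> (snd p) * dual_apply \<xi> (h p))"
      unfolding \<nu>_def sum_distrib_right by (intro sum.cong refl) auto
    also have "\<dots> = (\<Sum>p\<in>J \<times> B n. c (fst p) * \<mu> (snd p) * dual_apply \<xi> (h p))"
      by (rule sum.group[OF finJB fin h])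
    also have "\<dots> = (\<Sum>j\<in>J. c j * dual_apply \<xi> (v j)) * (\<Sum>g\<in>B n. \<mu> g * dual_apply \<xi> g)"
      unfolding sum_product sum.cartesian_product
      by (intro sum.cong refl) (auto simp: h_def dual_apply_simps(2))
    also have "\<dots> = z ^ Suc n" by (simp add: \<mu>(2) z_def)
    finally show ?case using 1 by blast
  qed
  fix n
  obtain \<mu> where \<mu>: "(op_apply T ^^ n) (ket 0) = (\<Sum>g\<in>B n. cscale (\<mu> g) (ket g))"
    "(\<Sum>g\<in>B n. \<mu> g * dual_apply \<xi> g) = z ^ n" using main by blast
  have pow: "norm ((op_apply T ^^ n) (ket 0)) \<le> norm T ^ n"
  proof (induction n)
    case (Suc n)
    have "norm ((op_apply T ^^ Suc n) (ket 0)) \<le> norm T * norm ((op_apply T ^^ n) (ket 0))"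
      by (simp add: norm_op_apply_le)
    also have "\<dots> \<le> norm T * norm T ^ n" by (intro mult_left_mono Suc) simp
    finally show ?case by simp
  qed simp
  have "cmod (\<mu> g) \<le> norm T ^ n" if "g \<in> B n" for g
  proof -
    have "\<mu> g = app ((op_apply T ^^ n) (ket 0)) g"
      using that fin by (simp add: \<mu>(1) app_sum app_ket if_distrib sum.delta cong: if_cong)
    then show ?thesis using norm_app_le order_trans pow by metis
  qed
  then have "cmod (\<Sum>g\<in>B n. \<mu> g * dual_apply \<xi> g) \<le> (\<Sum>g\<in>B n. norm T ^ n)"
    by (intro sum_norm_le) (simp add: norm_mult dual_apply_simps)
  also have "\<dots> \<le> (real n + 1) ^ card J * norm T ^ n"
  proof -
    have "real (card (B n)) \<le> real ((n + 1) ^ card J)" using card[of n] by (simp only: of_nat_le_iff)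
    also have "\<dots> = (real n + 1) ^ card J" by (simp only: of_nat_power of_nat_add of_nat_1)
    finally show ?thesis unfolding sum_constant by (rule mult_right_mono) simp
  qed
  finally show "cmod z ^ n \<le> (real n + 1) ^ card J * norm T ^ n" by (simp add: \<mu>(2) norm_power)
qed auto

section \<open>The compact quantum group \<open>C(G)\<close>\<close>

text \<open>Stone-Weierstrass, which gives the density of the characters, is stated for Hausdorff
  spaces.\<close>

instance dual :: (ab_group_add) t2_space
proof
  fix x y :: "'a dual" assume "x \<noteq> y"
  then obtain a where "dual_apply x a \<noteq> dual_apply y a"
    by (metis dual_apply_inject ext)
  from hausdorff[OF this] obtain U V
    where UV: "open U" "open V" "dual_apply x a \<in> U" "dual_apply y a \<in> V" "U \<inter> V = {}" by blast
  have "open ((\<lambda>\<phi> :: 'a dual. dual_apply \<phi> a) -` W)" if "open W" for W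
    using continuous_on_dual_apply[of UNIV a] that by (simp add: continuous_on_open_vimage)
  then show "\<exists>U V. open U \<and> open V \<and> x \<in> U \<and> y \<in> V \<and> U \<inter> V = {}"
    using UV by (intro exI[of _ "(\<lambda>\<phi>. dual_apply \<phi> a) -` U"] exI[of _ "(\<lambda>\<phi>. dual_apply \<phi> a) -` V"]) auto
qed

definition character :: "'g \<Rightarrow> 'g::ab_group_add dual cfun" where
  "character a = make_cfun (\<lambda>\<phi>. dual_apply \<phi> a)"

lemma cfun_apply_character [simp]: "cfun_apply (character a) \<phi> = dual_apply \<phi> a"
  unfolding character_def by (simp add: cfun_apply_make_compact compact_dual continuous_on_dual_apply)

lemma character_mult: "character a * character b = character (a + b)"
  by (rule cfun_eqI) (simp add: dual_apply_simps)

lemma character_star: "star (character a) = character (- a)"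
  by (rule cfun_eqI) (simp add: dual_apply_simps)

lemma cfun_apply_sum: "cfun_apply (\<Sum>i\<in>I. f i) x = (\<Sum>i\<in>I. cfun_apply (f i) x)"
  by (induction I rule: infinite_finite_induct) auto

lemma cstar_subalgebra_characters: "cstar_subalgebra (closure (cspan (range character)))"
  by (rule cstar_subalgebra_closed_cspan) (auto simp: character_mult character_star)

lemma cfun_apply_make_dual:
  "continuous_on UNIV f \<Longrightarrow> cfun_apply (make_cfun f) x = f x" for f :: "'g::ab_group_add dual \<Rightarrow> complex"
  by (simp add: cfun_apply_make_compact compact_dual)

text \<open>The real Stone-Weierstrass theorem is applied to the real functions whose
  complexification lies in the closed span. They separate points because the characters do and their
  real and imaginary parts are among them.\<close>

lemma characters_dense: "closure (cspan (range character)) = (UNIV :: 'g::ab_group_add dual cfun set)"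
proof -
  define P where "P = closure (cspan (range (character :: 'g \<Rightarrow> _)))"
  have alg: "cstar_subalgebra P" unfolding P_def by (rule cstar_subalgebra_characters)
  note P = cstar_subalgebraD[OF alg] csubspaceD[OF cstar_subalgebraD(1)[OF alg]]
  have char: "character a \<in> P" for a unfolding P_def by (rule subsetD[OF closed_cspan_superset]) simp
  define cr where "cr f = make_cfun (\<lambda>x. complex_of_real (f x))" for f :: "'g dual \<Rightarrow> real"
  have cr: "cfun_apply (cr f) x = of_real (f x)" if "continuous_on UNIV f" for f x
    unfolding cr_def using that by (intro cfun_apply_make_dual continuous_on_of_real)
  define R where "R = {f. continuous_on UNIV f \<and> cr f \<in> P}"
  have real_part: "(\<lambda>\<phi>. Re (c * dual_apply \<phi> a)) \<in> R" for c a
  proof -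
    have con: "continuous_on UNIV (\<lambda>\<phi>. Re (c * dual_apply \<phi> a))"
      by (intro continuous_intros continuous_on_dual_apply)
    have "cr (\<lambda>\<phi>. Re (c * dual_apply \<phi> a)) = (1/2) *\<^sub>C (c *\<^sub>C character a + cnj c *\<^sub>C character (- a))"
    proof (rule cfun_eqI)
      fix \<phi>
      have "cfun_apply ((1/2) *\<^sub>C (c *\<^sub>C character a + cnj c *\<^sub>C character (- a))) \<phi>
          = (c * dual_apply \<phi> a + cnj (c * dual_apply \<phi> a)) / 2"
        by (simp add: dual_apply_simps(4))
      also have "\<dots> = of_real (Re (c * dual_apply \<phi> a))" unfolding complex_add_cnj by simp
      finally show "cfun_apply (cr (\<lambda>\<phi>. Re (c * dual_apply \<phi> a))) \<phi>
          = cfun_apply ((1/2) *\<^sub>C (c *\<^sub>C character a + cnj c *\<^sub>C character (- a))) \<phi>"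
        unfolding cr[OF con] by (rule sym)
    qed
    also have "\<dots> \<in> P" by (intro P(5-8) char)
    finally show ?thesis using con by (simp add: R_def)
  qed
  interpret function_ring_on R UNIV
  proof
    show "compact (UNIV :: 'g dual set)" by (rule compact_dual)
    show "f \<in> R \<Longrightarrow> continuous_on UNIV f" for f by (simp add: R_def)
    show "(\<lambda>x. f x + g x) \<in> R" if "f \<in> R" "g \<in> R" for f g
    proof -
      have con: "continuous_on UNIV f" "continuous_on UNIV g" using that by (auto simp: R_def)
      then have con': "continuous_on UNIV (\<lambda>x. f x + g x)" by (rule continuous_on_add)
      have "cr (\<lambda>x. f x + g x) = cr f + cr g" by (rule cfun_eqI) (simp add: cr con con')
      then show ?thesis using that con' P(6) by (simp add: R_def)
    qed
    show "(\<lambda>x. f x * g x) \<in> R" if "f \<in> R" "g \<in> R" for f g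
    proof -
      have con: "continuous_on UNIV f" "continuous_on UNIV g" using that by (auto simp: R_def)
      then have con': "continuous_on UNIV (\<lambda>x. f x * g x)" by (rule continuous_on_mult)
      have "cr (\<lambda>x. f x * g x) = cr f * cr g" by (rule cfun_eqI) (simp add: cr con con')
      then show ?thesis using that con' P(3) by (simp add: R_def)
    qed
    show "(\<lambda>_. c) \<in> R" for c using real_part[of "of_real c" 0] by (simp add: dual_apply_simps)
    fix x y :: "'g dual" assume "x \<noteq> y"
    then obtain a where a: "dual_apply x a \<noteq> dual_apply y a" by (metis dual_apply_inject ext)
    \<comment> \<open>\<open>Re (- \<i> * z)\<close> is the imaginary part of \<open>z\<close>, so
      both cases are instances of \<open>real_part\<close>.\<close>
    then consider "Re (1 * dual_apply x a) \<noteq> Re (1 * dual_apply y a)"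
      | "Re (- \<i> * dual_apply x a) \<noteq> Re (- \<i> * dual_apply y a)"
      by (auto simp: complex_eq_iff)
    then show "\<exists>f\<in>R. f x \<noteq> f y"
    proof cases
      case 1
      then show ?thesis by (intro bexI[OF _ real_part[of 1 a]])
    next
      case 2
      then show ?thesis by (intro bexI[OF _ real_part[of "- \<i>" a]])
    qed
  qed
  have real: "cr f \<in> P" if f: "continuous_on UNIV f" for f
  proof -
    have "cr f \<in> closure P"
      unfolding closure_approachable
    proof (intro allI impI)
      fix e :: real assume "e > 0"
      then obtain g where g: "g \<in> R" "\<And>x. \<bar>f x - g x\<bar> < e / 2"
        using Stone_Weierstrass_basic[OF f, of "e / 2"] by auto
      have "norm (cr g - cr f) \<le> e / 2"
      proof (rule norm_cfun_le)
        fix x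
        have "continuous_on UNIV g" using g(1) by (simp add: R_def)
        then have "cfun_apply (cr g - cr f) x = of_real (g x - f x)" by (simp add: cr f)
        then show "cmod (cfun_apply (cr g - cr f) x) \<le> e / 2"
          using g(2)[of x] by (simp only: norm_of_real)
      qed
      then show "\<exists>y\<in>P. dist y (cr f) < e"
        using g(1) \<open>e > 0\<close> by (intro bexI[of _ "cr g"]) (auto simp: dist_norm R_def)
    qed
    then show ?thesis using P(2) by simp
  qed
  have "f \<in> P" for f
  proof -
    have con: "continuous_on UNIV (\<lambda>x. Re (cfun_apply f x))" "continuous_on UNIV (\<lambda>x. Im (cfun_apply f x))"
      by (simp_all add: continuous_on_Re continuous_on_Im continuous_on_cfun_apply)
    have "f = cr (\<lambda>x. Re (cfun_apply f x)) + \<i> *\<^sub>C cr (\<lambda>x. Im (cfun_apply f x))"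
      by (rule cfun_eqI) (simp add: cr con complex_eq_iff)
    also have "\<dots> \<in> P" by (intro P(6,7) real con)
    finally show ?thesis .
  qed
  then show ?thesis unfolding P_def by blast
qed

section \<open>Multiplication operators and the comultiplication of \<open>C(G)\<close>\<close>

lemma mult_op_simps:
  "mult_op (f + g) = mult_op f + mult_op g" "mult_op (c *\<^sub>C f) = c *\<^sub>C mult_op f"
  "mult_op (f * g) = mult_op f * mult_op g" "mult_op (star f) = star (mult_op f)"
proof -
  show "mult_op (f + g) = mult_op f + mult_op g" "mult_op (c *\<^sub>C f) = c *\<^sub>C mult_op f"
    "mult_op (f * g) = mult_op f * mult_op g"
    by (intro op_eqI ell2_eqI; simp add: app_mult_op algebra_simps)+
  show "mult_op (star f) = star (mult_op f)"
    by (rule op_mat_eqI) (simp add: app_star_ket app_mult_op app_ket)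
qed

lemma star_hom_mult_op: "star_hom A mult_op"
  by (simp add: star_hom_def clinear_on_def mult_op_simps)

lemma norm_mult_op [simp]: "norm (mult_op f) = norm f"
proof (rule antisym)
  show "norm (mult_op f) \<le> norm f"
  proof (rule norm_op_le)
    fix v
    have "norm (mult_op f \<triangleright> v) \<le> norm (cscale (of_real (norm f)) v)"
      by (rule norm_ell2_mono) (auto simp: app_mult_op norm_mult intro!: mult_right_mono norm_cfun_apply_le)
    then show "norm (mult_op f \<triangleright> v) \<le> norm f * norm v" by (simp add: norm_cscale)
  qed simp
  show "norm f \<le> norm (mult_op f)"
  proof (rule norm_cfun_le)
    fix x
    have "cmod (cfun_apply f x) = cmod (app (mult_op f \<triangleright> ket x) x)" by (simp add: app_mult_op app_ket)
    also have "\<dots> \<le> norm (mult_op f \<triangleright> ket x)" by (rule norm_app_le)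
    also have "\<dots> \<le> norm (mult_op f)" using norm_op_apply_le[of "mult_op f" "ket x"] by simp
    finally show "cmod (cfun_apply f x) \<le> norm (mult_op f)" .
  qed
qed

lemma mult_op_diff: "mult_op (f - g) = mult_op f - mult_op g"
  by (intro op_eqI ell2_eqI) (simp add: app_mult_op algebra_simps)

lemma faithful_rep_mult_op: "faithful_rep A mult_op"
  unfolding faithful_rep_def
proof
  show "inj_on mult_op A"
  proof (rule inj_onI)
    fix f g :: "'a cfun" assume "mult_op f = mult_op g"
    then have "norm (f - g) = 0" by (simp add: mult_op_diff flip: norm_mult_op)
    then show "f = g" by simp
  qed
qed (rule star_hom_mult_op)

lemma app_dual_comult: "app (dual_comult f \<triangleright> v) (\<alpha>, \<beta>) = cfun_apply f (\<alpha> * \<beta>) * app v (\<alpha>, \<beta>)"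
  unfolding dual_comult_def app_mult_op cfun_apply_dual_comult ..

lemma star_hom_dual_comult: "star_hom A dual_comult"
proof -
  have "dual_comult (f + g) = dual_comult f + dual_comult g" "dual_comult (c *\<^sub>C f) = c *\<^sub>C dual_comult f"
    "dual_comult (f * g) = dual_comult f * dual_comult g" for f g :: "'a dual cfun" and c
    by (intro op_eqI ell2_eqI; clarsimp simp: app_dual_comult algebra_simps)+
  moreover have "dual_comult (star f) = star (dual_comult f)" for f :: "'a dual cfun"
    by (rule op_mat_eqI) (clarsimp simp: app_star_ket app_dual_comult app_ket)
  ultimately show ?thesis by (simp add: star_hom_def clinear_on_def)
qed

lemma norm_dual_comult_le: "norm (dual_comult f) \<le> norm f"
  unfolding dual_comult_def norm_mult_op
  by (rule norm_cfun_le) (clarsimp simp: cfun_apply_dual_comult norm_cfun_apply_le)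

lemma continuous_on_dual_comult: "continuous_on A dual_comult"
  using clinear_on_bounded_imp_continuous[OF star_homD(1)[OF star_hom_dual_comult[of UNIV]], where C = 1]
  by (auto simp: csubspace_def norm_dual_comult_le intro: continuous_on_subset)

text \<open>Evaluation at \<open>a\<close> is multiplicative on the dual group, which makes
  characters group-like.\<close>

lemma dual_comult_character: "dual_comult (character a) = mult_op (character a) \<otimes> mult_op (character a)"
proof (rule op_tensor_ketI)
  fix x y :: "'a dual"
  have "dual_comult (character a) \<triangleright> tensor_vec (ket x) (ket y)
      = tensor_vec (mult_op (character a) \<triangleright> ket x) (mult_op (character a) \<triangleright> ket y)"
    by (rule ell2_eqI) (clarsimp simp: app_dual_comult app_mult_op dual_apply_times)
  then show "dual_comult (character a) \<triangleright> tensor_vec (ket x) (ket y)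
      = (mult_op (character a) \<otimes> mult_op (character a)) \<triangleright> tensor_vec (ket x) (ket y)"
    by (simp only: op_tensor)
qed

lemma is_unit_character: "is_unit UNIV (character 0)"
  unfolding is_unit_def by (auto intro!: cfun_eqI simp: dual_apply_simps)

lemma cstar_subalgebra_UNIV: "cstar_subalgebra UNIV"
  by (simp add: cstar_subalgebra_def)

lemma compact_quantum_semigroup_dual:
  "compact_quantum_semigroup (UNIV :: 'g::ab_group_add dual cfun set) mult_op dual_comult"
proof (rule compact_quantum_semigroup_grouplike)
  show "UNIV = closure (cspan (range (character :: 'g \<Rightarrow> _)))" by (rule characters_dense[symmetric])
  show "norm (dual_comult a) \<le> 1 * norm (mult_op a)" for a :: "'g dual cfun"
    by (simp add: norm_dual_comult_le)
  show "is_unit UNIV (character (0 :: 'g))" by (rule is_unit_character)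
qed (auto simp: dual_comult_character cstar_subalgebra_UNIV faithful_rep_mult_op star_hom_dual_comult
  continuous_on_dual_comult)

text \<open>Allows membership in a closed subspace to be tested on elementary tensors of generators,
  by fixing one factor at a time.\<close>

lemma min_tensor_generated:
  assumes "A \<subseteq> closure (cspan X)" "B \<subseteq> closure (cspan Y)" "csubspace W" "closed W"
    and "\<And>x y. x \<in> X \<Longrightarrow> y \<in> Y \<Longrightarrow> x \<otimes> y \<in> W"
  shows "min_tensor A B \<subseteq> W"
  unfolding min_tensor_def
proof (rule closed_cspan_minimal[OF assms(3,4)], clarify)
  have con: "continuous_on UNIV (\<lambda>S. S \<otimes> T)" "continuous_on UNIV (\<lambda>T. S \<otimes> T)" for S :: "'a op" and T :: "'b op"
    by (intro continuous_on_op_tensor continuous_on_id continuous_on_const)+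
  have left: "S \<otimes> y \<in> W" if "S \<in> A" "y \<in> Y" for S y
  proof -
    have "(\<lambda>S. S \<otimes> y) ` closure (cspan X) \<subseteq> W"
      by (rule clinear_on_closed_cspan_subset[OF _ continuous_on_subset[OF con(1)] refl assms(3,4)])
         (use that assms(5) in \<open>auto simp: clinear_on_def op_tensor_simps\<close>)
    then show ?thesis using that(1) assms(1) by blast
  qed
  fix S T assume "S \<in> A" "T \<in> B"
  have "(\<lambda>T. S \<otimes> T) ` closure (cspan Y) \<subseteq> W"
    by (rule clinear_on_closed_cspan_subset[OF _ continuous_on_subset[OF con(2)] refl assms(3,4)])
       (use left \<open>S \<in> A\<close> in \<open>auto simp: clinear_on_def op_tensor_simps\<close>)
  then show "S \<otimes> T \<in> W" using \<open>T \<in> B\<close> assms(2) by blast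
qed

lemma min_tensor_mult:
  assumes "\<And>a a'. a \<in> A \<Longrightarrow> a' \<in> A' \<Longrightarrow> a * a' \<in> A''" "\<And>b b'. b \<in> B \<Longrightarrow> b' \<in> B' \<Longrightarrow> b * b' \<in> B''"
    and "x \<in> min_tensor A B" "y \<in> min_tensor A' B'"
  shows "x * y \<in> min_tensor A'' B''"
  using assms(3,4) unfolding min_tensor_def[of A B] min_tensor_def[of A' B']
  by (rule closed_cspan_mult[OF _ csubspace_min_tensor closed_min_tensor, rotated])
     (auto simp: op_tensor_mult intro!: min_tensor_mem assms(1,2))

lemma compact_quantum_group_dual:
  "compact_quantum_group (UNIV :: 'g::ab_group_add dual cfun set) mult_op dual_comult"
proof -
  let ?\<rho> = "mult_op :: 'g dual cfun \<Rightarrow> 'g dual op"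
  let ?M = "min_tensor (range ?\<rho>) (range ?\<rho>)"
  have range: "range dual_comult \<subseteq> ?M"
    using compact_quantum_semigroup_dual[where 'g = 'g] unfolding compact_quantum_semigroup_def by blast
  have mult: "x * y \<in> ?M" if "x \<in> ?M" "y \<in> ?M" for x y
    using that by (rule min_tensor_mult[rotated 2]) (auto simp flip: mult_op_simps)
  have gen: "?M \<subseteq> W" if "csubspace W" "closed W"
    "\<And>a b. mult_op (character a) \<otimes> mult_op (character b) \<in> W" for W
  proof (rule min_tensor_generated[OF _ _ that(1,2)])
    have con: "continuous_on UNIV ?\<rho>"
      by (rule clinear_on_bounded_imp_continuous[OF star_homD(1)[OF star_hom_mult_op], where C = 1]) (auto simp: csubspace_def)
    show "range ?\<rho> \<subseteq> closure (cspan (range (\<lambda>a. mult_op (character a))))"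
      by (rule clinear_on_closed_cspan_subset[OF star_homD(1)[OF star_hom_mult_op] con
          characters_dense[symmetric] csubspace_closed_cspan closed_closure])
         (auto intro: subsetD[OF closed_cspan_superset])
    then show "range ?\<rho> \<subseteq> closure (cspan (range (\<lambda>a. mult_op (character a))))" .
  qed (use that(3) in blast)
  \<comment> \<open>Characters are group-like and invertible, so every elementary tensor of two of
    them is itself one of the products in each of the two density conditions.\<close>
  have rearr: "mult_op (character a) \<otimes> mult_op (character b)
      = dual_comult (character b) * (mult_op (character (a - b)) \<otimes> mult_op (character 0))"
    "mult_op (character a) \<otimes> mult_op (character b)
      = dual_comult (character a) * (mult_op (character 0) \<otimes> mult_op (character (b - a)))" for a b :: 'g
    by (simp_all add: dual_comult_character op_tensor_mult character_mult flip: mult_op_simps)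
  show ?thesis
    unfolding compact_quantum_group_def
  proof (intro conjI exI[of _ "character 0"])
    let ?X = "{dual_comult a * (?\<rho> b \<otimes> ?\<rho> (character 0)) | a b. a \<in> UNIV \<and> b \<in> UNIV}"
    show "closure (cspan ?X) = ?M"
    proof
      show "closure (cspan ?X) \<subseteq> ?M"
        by (rule closed_cspan_minimal[OF csubspace_min_tensor closed_min_tensor])
           (use range in \<open>auto intro!: mult min_tensor_mem\<close>)
      show "?M \<subseteq> closure (cspan ?X)"
      proof (rule gen[OF csubspace_closed_cspan closed_closure])
        show "mult_op (character a) \<otimes> mult_op (character b) \<in> closure (cspan ?X)" for a b
          unfolding rearr(1)[of a b] by (rule subsetD[OF closed_cspan_superset]) blast
      qed
    qed
    let ?X = "{dual_comult a * (?\<rho> (character 0) \<otimes> ?\<rho> b) | a b. a \<in> UNIV \<and> b \<in> UNIV}"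
    show "closure (cspan ?X) = ?M"
    proof
      show "closure (cspan ?X) \<subseteq> ?M"
        by (rule closed_cspan_minimal[OF csubspace_min_tensor closed_min_tensor])
           (use range in \<open>auto intro!: mult min_tensor_mem\<close>)
      show "?M \<subseteq> closure (cspan ?X)"
      proof (rule gen[OF csubspace_closed_cspan closed_closure])
        show "mult_op (character a) \<otimes> mult_op (character b) \<in> closure (cspan ?X)" for a b
          unfolding rearr(2)[of a b] by (rule subsetD[OF closed_cspan_superset]) blast
      qed
    qed
  qed (rule compact_quantum_semigroup_dual is_unit_character)+
qed

section \<open>Monomials and their degrees\<close>

locale generating_semigroup =
  fixes S :: "'g::ab_group_add set"
  assumes zero: "0 \<in> S"
    and add: "\<And>a b. a \<in> S \<Longrightarrow> b \<in> S \<Longrightarrow> a + b \<in> S"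
    and generating: "\<And>c. \<exists>a\<in>S. \<exists>b\<in>S. c = a - b"
begin

text \<open>The sets \<open>a + S\<close> form a filter base on \<open>S\<close>, along which monomials act as translations.\<close>

definition deep :: "('g \<Rightarrow> bool) \<Rightarrow> bool" where
  "deep P \<longleftrightarrow> (\<exists>a\<in>S. \<forall>s\<in>S. P (a + s))"

lemma deepI: "a \<in> S \<Longrightarrow> (\<And>s. s \<in> S \<Longrightarrow> P (a + s)) \<Longrightarrow> deep P"
  unfolding deep_def by blast

lemma deep_mono: "deep P \<Longrightarrow> (\<And>x. P x \<Longrightarrow> Q x) \<Longrightarrow> deep Q"
  unfolding deep_def by blast

lemma deep_ex: "deep P \<Longrightarrow> \<exists>x. P x"
  unfolding deep_def using zero by blast

lemma deep_conj:
  assumes "deep P" "deep Q"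
  shows "deep (\<lambda>x. P x \<and> Q x)"
proof -
  obtain a b where a: "a \<in> S" "\<And>s. s \<in> S \<Longrightarrow> P (a + s)" and b: "b \<in> S" "\<And>s. s \<in> S \<Longrightarrow> Q (b + s)"
    using assms unfolding deep_def by blast
  show ?thesis
  proof (rule deepI)
    show "a + b \<in> S" using a(1) b(1) by (rule add)
    fix s assume "s \<in> S"
    then show "P (a + b + s) \<and> Q (a + b + s)"
      using a(2)[OF add[OF b(1)], of s] b(2)[OF add[OF a(1)], of s] by (simp add: ac_simps)
  qed
qed

text \<open>Here \<open>g\<close> is any element of the group. For \<open>g = c - d\<close> the base
  point \<open>a + d\<close> cancels \<open>d\<close>, and \<open>S\<close> absorbs
  \<open>c\<close>.\<close>

lemma deep_translate:
  assumes "deep P"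
  shows "deep (\<lambda>x. P (x + g))"
proof -
  obtain a where a: "a \<in> S" "\<And>s. s \<in> S \<Longrightarrow> P (a + s)" using assms unfolding deep_def by blast
  obtain c d where cd: "c \<in> S" "d \<in> S" "g = c - d" using generating by blast
  show ?thesis
  proof (rule deepI)
    show "a + d \<in> S" using a(1) cd(2) by (rule add)
    fix s assume "s \<in> S"
    then have "P (a + (c + s))" by (intro a(2) add cd(1))
    moreover have "a + d + s + g = a + (c + s)" by (simp add: cd(3) algebra_simps)
    ultimately show "P (a + d + s + g)" by (simp only:)
  qed
qed

lemma deep_ball:
  assumes "finite F" "\<And>i. i \<in> F \<Longrightarrow> deep (P i)"
  shows "deep (\<lambda>x. \<forall>i\<in>F. P i x)"
  using assms
proof (induction F)
  case empty
  then show ?case using deepI[OF zero] by simp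
next
  case (insert i F)
  then have "deep (\<lambda>x. P i x \<and> (\<forall>i\<in>F. P i x))" by (intro deep_conj) auto
  then show ?case by simp
qed

lemma deep_mem: "b \<in> S \<Longrightarrow> deep (\<lambda>x. x - b \<in> S)"
  by (rule deepI) auto

section \<open>Degrees of monomials\<close>

definition has_degree :: "'g op \<Rightarrow> 'g \<Rightarrow> bool" where
  "has_degree V v \<longleftrightarrow> deep (\<lambda>x. V \<triangleright> ket x = ket (x + v))"

lemma ket_inject [simp]: "ket x = ket y \<longleftrightarrow> x = y" for x y :: 'g
  by (metis app_ket zero_neq_one)

lemma has_degree_unique: "has_degree V v \<Longrightarrow> has_degree V w \<Longrightarrow> v = w"
  using deep_ex[OF deep_conj] unfolding has_degree_def by fastforce

lemma has_degree_mult: "has_degree V v \<Longrightarrow> has_degree W w \<Longrightarrow> has_degree (V * W) (v + w)"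
  unfolding has_degree_def
  by (erule deep_mono[OF deep_conj[OF _ deep_translate]]) (auto simp: ac_simps)

lemma star_shift_ket: "star (shift S b) \<triangleright> ket x = (if x - b \<in> S then ket (x - b) else 0)"
  by (rule ell2_eqI) (auto simp: app_star_shift app_ket)

lemma has_degree_shift: "has_degree (shift S a) a"
  unfolding has_degree_def by (rule deepI[OF zero]) (simp add: shift_ket add.commute)

lemma has_degree_star_shift: "b \<in> S \<Longrightarrow> has_degree (star (shift S b)) (- b)"
  unfolding has_degree_def by (erule deep_mono[OF deep_mem]) (simp add: star_shift_ket)

text \<open>The adjoint is carried through the induction: that \<open>V\<close> translates deep
  basis vectors does not by itself determine \<open>star V\<close> on them.\<close>

lemma monomial_has_degree: "V \<in> monomials S \<Longrightarrow> \<exists>v. has_degree V v \<and> has_degree (star V) (- v)"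
proof (induction rule: monomials.induct)
  case (1 a)
  then show ?case using has_degree_shift has_degree_star_shift by blast
next
  case (2 b)
  then show ?case using has_degree_shift[of b] has_degree_star_shift
    by (intro exI[of _ "- b"]) (simp add: star_star)
next
  case (3 V W)
  then obtain v w where "has_degree V v" "has_degree (star V) (- v)" "has_degree W w" "has_degree (star W) (- w)"
    by blast
  then have "has_degree (V * W) (v + w)" "has_degree (star (V * W)) (- w + - v)"
    unfolding star_mult by (blast intro: has_degree_mult)+
  moreover have "- w + - v = - (v + w)" by simp
  ultimately show ?case by (intro exI[of _ "v + w"]) (simp only:)
qed

definition degree :: "'g op \<Rightarrow> 'g" where
  "degree V = (THE v. has_degree V v)"

lemma degree_eqI: "has_degree V v \<Longrightarrow> degree V = v"
  unfolding degree_def by (rule the_equality) (auto dest: has_degree_unique)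

lemma has_degree_degree:
  assumes "V \<in> monomials S"
  shows "has_degree V (degree V)" "has_degree (star V) (- degree V)"
  using monomial_has_degree[OF assms] by (auto simp: degree_eqI)

lemma monomials_star: "V \<in> monomials S \<Longrightarrow> star V \<in> monomials S"
  by (induction rule: monomials.induct) (auto simp: star_star star_mult intro: monomials.intros)

lemma degree_mult: "V \<in> monomials S \<Longrightarrow> W \<in> monomials S \<Longrightarrow> degree (V * W) = degree V + degree W"
  by (intro degree_eqI has_degree_mult has_degree_degree)

lemma degree_star: "V \<in> monomials S \<Longrightarrow> degree (star V) = - degree V"
  by (intro degree_eqI has_degree_degree)

lemma cstar_red_eq: "cstar_red S = closure (cspan (monomials S))"
proof
  have "cstar_subalgebra (closure (cspan (monomials S)))"
    by (rule cstar_subalgebra_closed_cspan) (auto intro: monomials.intros monomials_star)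
  moreover have "shift S ` S \<union> (\<lambda>a. star (shift S a)) ` S \<subseteq> closure (cspan (monomials S))"
    by (rule order_trans[OF _ closed_cspan_superset]) (auto intro: monomials.intros)
  ultimately show "cstar_red S \<subseteq> closure (cspan (monomials S))"
    unfolding cstar_red_def cstar_generated_def by blast
  show "closure (cspan (monomials S)) \<subseteq> cstar_red S"
    unfolding cstar_red_def cstar_generated_def
  proof (rule Inter_greatest, clarify)
    fix A and x assume A: "cstar_subalgebra A" "shift S ` S \<union> (\<lambda>a. star (shift S a)) ` S \<subseteq> A"
      and x: "x \<in> closure (cspan (monomials S))"
    have "V \<in> A" if "V \<in> monomials S" for V
      using that by induction (use A cstar_subalgebraD[OF A(1)] in auto)
    then have "closure (cspan (monomials S)) \<subseteq> A"
      by (intro closed_cspan_minimal cstar_subalgebraD[OF A(1)]) blast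
    then show "x \<in> A" using x by blast
  qed
qed

lemma cstar_subalgebra_cstar_red: "cstar_subalgebra (cstar_red S)"
  unfolding cstar_red_eq
  by (rule cstar_subalgebra_closed_cspan) (auto intro: monomials.intros monomials_star)

lemmas cstar_red_simps = cstar_subalgebraD[OF cstar_subalgebra_cstar_red]
  csubspaceD[OF cstar_subalgebraD(1)[OF cstar_subalgebra_cstar_red]]

lemma monomials_subset: "monomials S \<subseteq> cstar_red S"
  unfolding cstar_red_eq by (rule closed_cspan_superset)

section \<open>The symbol map\<close>

lemma norm_shift_apply_le: "norm (shift T a \<triangleright> f) \<le> norm f" for T :: "'g set"
proof -
  have inj: "inj_on (\<lambda>x. x - a) {x. x - a \<in> T}" by (auto simp: inj_on_def)
  have "shift T a \<triangleright> f = reindex_vec (\<lambda>x. x - a \<in> T) (\<lambda>x. x - a) f"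
    by (rule ell2_eqI) (simp add: app_reindex_vec[OF inj] app_shift)
  then show ?thesis using norm_reindex_vec_le[OF inj] by simp
qed

lemma norm_shift_le: "norm (shift T a) \<le> 1" for T :: "'g set"
  by (rule norm_op_le) (simp_all add: norm_shift_apply_le)

lemma norm_translation: "norm (shift UNIV (a :: 'g) \<triangleright> f) = norm f"
proof (rule antisym[OF norm_shift_apply_le])
  have "f = shift UNIV (- a) \<triangleright> shift UNIV a \<triangleright> f" by (rule ell2_eqI) (simp add: app_shift)
  then show "norm f \<le> norm (shift UNIV a \<triangleright> f)" using norm_shift_apply_le by metis
qed

text \<open>
  On a finitely supported vector, a linear combination of monomials acts like the one of the
  corresponding translations, once the vector has been translated deep into \<open>S\<close>.
\<close>

lemma norm_translation_sum_le_monomials: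
  assumes J: "finite J" "J \<subseteq> monomials S"
  shows "norm (\<Sum>V\<in>J. c V *\<^sub>C shift UNIV (degree V)) \<le> norm (\<Sum>V\<in>J. c V *\<^sub>C V)"
proof (rule norm_op_le_finite)
  fix F :: "'g set" and d assume F: "finite F"
  define f where "f = (\<Sum>x\<in>F. cscale (d x) (ket x))"
  have "deep (\<lambda>y. \<forall>V\<in>J. \<forall>x\<in>F. V \<triangleright> ket (y + x) = ket (y + x + degree V))"
  proof (intro deep_ball J(1) F)
    fix V x assume "V \<in> J"
    then have "has_degree V (degree V)" using has_degree_degree J(2) by blast
    then show "deep (\<lambda>y. V \<triangleright> ket (y + x) = ket (y + x + degree V))"
      unfolding has_degree_def by (rule deep_translate)
  qed
  then obtain y where "\<And>V x. V \<in> J \<Longrightarrow> x \<in> F \<Longrightarrow> V \<triangleright> ket (y + x) = ket (y + x + degree V)"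
    using deep_ex by blast
  then have y: "V \<triangleright> ket (y + x) = ket (y + (degree V + x))" if "V \<in> J" "x \<in> F" for V x
    using that by (simp add: ac_simps)
  have "shift UNIV y \<triangleright> (\<Sum>V\<in>J. c V *\<^sub>C shift UNIV (degree V)) \<triangleright> f = (\<Sum>V\<in>J. c V *\<^sub>C V) \<triangleright> shift UNIV y \<triangleright> f"
    unfolding f_def op_sum_apply op_apply_sum op_apply_scaleC op_apply_cscale
    by (intro sum.cong refl) (simp add: shift_ket y cong: sum.cong)
  then have "norm ((\<Sum>V\<in>J. c V *\<^sub>C shift UNIV (degree V)) \<triangleright> f) = norm ((\<Sum>V\<in>J. c V *\<^sub>C V) \<triangleright> shift UNIV y \<triangleright> f)"
    by (metis norm_translation)
  also have "\<dots> \<le> norm (\<Sum>V\<in>J. c V *\<^sub>C V) * norm f"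
    using norm_op_apply_le[of _ "shift UNIV y \<triangleright> f"] by (simp add: norm_translation)
  finally show "norm ((\<Sum>V\<in>J. c V *\<^sub>C shift UNIV (degree V)) \<triangleright> f) \<le> norm (\<Sum>V\<in>J. c V *\<^sub>C V) * norm f" .
qed simp

text \<open>Translations of the whole group mediate between monomials and characters. Linear
  relations among monomials, also between those of equal degree, are settled all at once by the norm
  estimate.\<close>

lemma symbol_map_exists:
  "\<exists>\<pi> :: 'g op \<Rightarrow> 'g dual cfun. star_hom (cstar_red S) \<pi> \<and>
    (\<forall>x\<in>cstar_red S. norm (\<pi> x) \<le> 1 * norm x) \<and> (\<forall>V\<in>monomials S. \<pi> V = character (degree V))"
proof -
  have "norm (\<Sum>V\<in>J. c V *\<^sub>C character (degree V)) \<le> 1 * norm (\<Sum>V\<in>J. c V *\<^sub>C V)"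
    if "finite J" "J \<subseteq> monomials S" for J c
  proof -
    have "norm (\<Sum>V\<in>J. c V *\<^sub>C character (degree V)) \<le> norm (\<Sum>V\<in>J. c V *\<^sub>C shift UNIV (degree V))"
    proof (rule norm_cfun_le)
      fix \<phi>
      show "cmod (cfun_apply (\<Sum>V\<in>J. c V *\<^sub>C character (degree V)) \<phi>)
          \<le> norm (\<Sum>V\<in>J. c V *\<^sub>C shift UNIV (degree V))"
        using norm_character_sum_le[OF that(1), of c \<phi> degree] by (simp add: cfun_apply_sum)
    qed
    also have "\<dots> \<le> norm (\<Sum>V\<in>J. c V *\<^sub>C V)" using that by (rule norm_translation_sum_le_monomials)
    finally show ?thesis by simp
  qed
  from bounded_extension[of "monomials S" "\<lambda>V. character (degree V)" 1 "\<lambda>V. V", OF this]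
  obtain \<pi> where \<pi>: "clinear_on (cstar_red S) \<pi>" "\<And>x. x \<in> cstar_red S \<Longrightarrow> norm (\<pi> x) \<le> 1 * norm x"
    "\<And>V. V \<in> monomials S \<Longrightarrow> \<pi> V = character (degree V)"
    unfolding image_ident cstar_red_eq[symmetric] by blast
  have "star_hom (cstar_red S) \<pi>"
  proof (rule star_homI[OF \<pi>(1) _ cstar_red_eq])
    show "continuous_on (cstar_red S) \<pi>"
      using \<pi>(1) cstar_red_simps(1) \<pi>(2) by (rule clinear_on_bounded_imp_continuous)
  qed (auto simp: \<pi>(3) monomials.intros monomials_star degree_mult degree_star character_mult character_star)
  then show ?thesis using \<pi> by blast
qed

lemma toeplitz_monomial: "toeplitz S c \<in> monomials S"
proof -
  obtain a b where ab: "a \<in> S" "b \<in> S" "c = b - a" using generating by blast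
  then show ?thesis by (auto simp: toeplitz_diff intro!: monomials.intros)
qed

lemma toeplitz_compression: "toeplitz S c = shift S 0 * shift UNIV c * shift S 0"
proof -
  obtain a b where ab: "a \<in> S" "b \<in> S" "c = b - a" using generating by blast
  have e: "a + x - b = x - c" for x using ab(3) by simp
  show ?thesis
    unfolding ab(3) toeplitz_diff[OF ab(1,2)] unfolding ab(3)[symmetric]
    by (intro op_eqI ell2_eqI) (simp add: app_star_shift app_shift e)
qed

lemma degree_toeplitz: "degree (toeplitz S c) = c"
proof -
  obtain a b where ab: "a \<in> S" "b \<in> S" "c = b - a" using generating by blast
  have "has_degree (star (shift S a) * shift S b) (- a + b)"
    using ab by (intro has_degree_mult has_degree_shift has_degree_star_shift)
  then show ?thesis unfolding ab(3) toeplitz_diff[OF ab(1,2)] by (intro degree_eqI) simp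
qed

text \<open>
  The Toeplitz operators provide a bounded linear section of the symbol map, since
  \<open>\<Sum>c\<^sub>j T\<^sub>v\<^sub>j\<close> is a compression of \<open>\<Sum>c\<^sub>j U\<^sub>v\<^sub>j\<close>.
\<close>

lemma symbol_map_surjective:
  assumes torsion_free: "\<And>(a :: 'g) n. 0 < n \<Longrightarrow> nmult n a = 0 \<Longrightarrow> a = 0"
    and \<pi>: "clinear_on (cstar_red S) \<pi>" "continuous_on (cstar_red S) \<pi>"
      "\<And>V. V \<in> monomials S \<Longrightarrow> \<pi> V = character (degree V)"
  shows "\<pi> ` cstar_red S = UNIV"
proof -
  have "norm (\<Sum>v\<in>J. c v *\<^sub>C toeplitz S v) \<le> 1 * norm (\<Sum>v\<in>J. c v *\<^sub>C character v)"
    if J: "finite J" for J and c :: "'g \<Rightarrow> complex"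
  proof -
    have "(\<Sum>v\<in>J. c v *\<^sub>C toeplitz S v) = shift S 0 * (\<Sum>v\<in>J. c v *\<^sub>C shift UNIV v) * shift S 0"
      unfolding toeplitz_compression sum_distrib_left sum_distrib_right
      by (simp add: mult_scaleC_left mult_scaleC_right)
    also have "norm \<dots> \<le> 1 * norm (\<Sum>v\<in>J. c v *\<^sub>C shift UNIV v) * 1"
      by (intro order_trans[OF norm_mult_ineq] mult_mono norm_shift_le) auto
    also have "\<dots> \<le> norm (\<Sum>v\<in>J. c v *\<^sub>C character v)"
      unfolding mult_1 mult_1_right
    proof (rule norm_translation_sum_le[OF torsion_free J])
      fix \<phi>
      show "cmod (\<Sum>v\<in>J. c v * dual_apply \<phi> v) \<le> norm (\<Sum>v\<in>J. c v *\<^sub>C character v)"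
        using norm_cfun_apply_le[of "\<Sum>v\<in>J. c v *\<^sub>C character v" \<phi>] by (simp add: cfun_apply_sum)
    qed
    finally show ?thesis by simp
  qed
  from bounded_extension[of UNIV "toeplitz S" 1 character, OF this, unfolded characters_dense]
  obtain \<tau> where \<tau>: "clinear_on UNIV \<tau>" "\<And>x. norm (\<tau> x) \<le> 1 * norm x" "\<And>v. \<tau> (character v) = toeplitz S v"
    by auto
  have con: "continuous_on UNIV \<tau>"
    using \<tau>(1) _ \<tau>(2) by (rule clinear_on_bounded_imp_continuous) (simp add: csubspace_def)
  have range: "range \<tau> \<subseteq> cstar_red S"
    by (rule clinear_on_closed_cspan_subset[OF \<tau>(1) con characters_dense[symmetric] cstar_red_simps(1,2)])
       (use toeplitz_monomial monomials_subset \<tau>(3) in auto)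
  have "\<pi> (\<tau> f) = f" for f
  proof (rule clinear_on_eqI[where \<phi> = "\<lambda>f. \<pi> (\<tau> f)" and \<psi> = "\<lambda>f. f", OF _ _ _ _ characters_dense[symmetric]])
    show "clinear_on UNIV (\<lambda>f. \<pi> (\<tau> f))"
      using \<pi>(1) \<tau>(1) range by (auto simp: clinear_on_def image_subset_iff)
    show "continuous_on UNIV (\<lambda>f. \<pi> (\<tau> f))"
      by (rule continuous_on_compose2[OF \<pi>(2) con range])
  qed (auto simp: clinear_on_def \<tau>(3) \<pi>(3) toeplitz_monomial degree_toeplitz)
  then show ?thesis using range by (metis UNIV_I equalityI image_subset_iff subsetI subset_UNIV image_eqI)
qed

section \<open>The comultiplication and the commutator ideal\<close>

lemma shift_zero_mult:
  "a \<in> S \<Longrightarrow> shift S 0 * shift S a = shift S a" "shift S a * shift S 0 = shift S a"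
  by (auto intro!: op_ket_eqI simp: shift_ket add)

lemma star_shift_zero [simp]: "star (shift S 0) = shift S 0"
  by (rule op_ket_eqI) (simp add: star_shift_ket shift_ket)

lemma monomials_unit:
  assumes "V \<in> monomials S"
  shows "shift S 0 * V = V" "V * shift S 0 = V"
proof -
  have "shift S 0 * V = V \<and> V * shift S 0 = V"
    using assms
  proof induction
    case (1 a)
    then show ?case using shift_zero_mult[of a] by simp
  next
    case (2 b)
    have "star (shift S b * shift S 0) = star (shift S b)" "star (shift S 0 * shift S b) = star (shift S b)"
      using shift_zero_mult[of b] 2 by simp_all
    then show ?case by (simp add: star_mult)
  next
    case (3 V W)
    then show ?case by (metis mult.assoc)
  qed
  then show "shift S 0 * V = V" "V * shift S 0 = V" by auto
qed

lemma is_unit_cstar_red: "is_unit (cstar_red S) (shift S 0)"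
proof -
  have "cstar_red S \<subseteq> {x. shift S 0 * x = x \<and> x * shift S 0 = x}"
    unfolding cstar_red_eq
  proof (rule closed_cspan_minimal)
    show "csubspace {x. shift S 0 * x = x \<and> x * shift S 0 = x}"
      by (auto simp: csubspace_def distrib_left distrib_right mult_scaleC_left mult_scaleC_right)
    show "closed {x. shift S 0 * x = x \<and> x * shift S 0 = x}"
      by (intro closed_Collect_conj closed_Collect_eq continuous_intros)
  qed (auto simp: monomials_unit)
  then show ?thesis
    unfolding is_unit_def using monomials_subset monomials.intros(1)[OF zero] by blast
qed

section \<open>The diagonal comultiplication as a *-homomorphism\<close>

lemma diagonal_comult_sum:
  assumes "is_diagonal_comult S \<Delta>" "\<And>i. i < n \<Longrightarrow> V i \<in> monomials S"
  shows "\<Delta> (\<Sum>i<(n::nat). c i *\<^sub>C V i) = (\<Sum>i<n. c i *\<^sub>C (V i \<otimes> V i))"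
  using assms(1)[unfolded is_diagonal_comult_def, THEN conjunct2, THEN conjunct2, THEN spec, THEN spec,
      THEN spec, THEN mp, of n V c] assms(2) by simp

text \<open>The hypothesis sums over initial segments of the naturals, \<open>cspan\<close> over
  finite sets; a bijection translates between them. Additivity follows once two elements of the span
  are written over a common set of monomials.\<close>

lemma diagonal_comult_clinear:
  assumes "is_diagonal_comult S \<Delta>"
  shows "clinear_on (cstar_red S) \<Delta>"
proof -
  have formula: "\<Delta> (\<Sum>V\<in>F. r V *\<^sub>C V) = (\<Sum>V\<in>F. r V *\<^sub>C (V \<otimes> V))"
    if F: "finite F" "F \<subseteq> monomials S" for F r
  proof -
    obtain h where h: "bij_betw h {..<card F} F"
      using ex_bij_betw_nat_finite[OF F(1)] by (auto simp: atLeast0LessThan)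
    have "h i \<in> monomials S" if "i < card F" for i using bij_betwE[OF h] that F(2) by auto
    then have "\<Delta> (\<Sum>i<card F. r (h i) *\<^sub>C h i) = (\<Sum>i<card F. r (h i) *\<^sub>C (h i \<otimes> h i))"
      by (rule diagonal_comult_sum[OF assms])
    then show ?thesis
      by (simp only: sum.reindex_bij_betw[OF h, of "\<lambda>V. r V *\<^sub>C V"]
          sum.reindex_bij_betw[OF h, of "\<lambda>V. r V *\<^sub>C (V \<otimes> V)"])
  qed
  have "clinear_on (cspan (monomials S)) \<Delta>"
    unfolding clinear_on_def
  proof (intro conjI ballI allI)
    fix x y assume "x \<in> cspan (monomials S)" "y \<in> cspan (monomials S)"
    from cspan_common[OF this] obtain r s F where F: "finite F" "F \<subseteq> monomials S"
      and xy: "x = (\<Sum>V\<in>F. r V *\<^sub>C V)" "y = (\<Sum>V\<in>F. s V *\<^sub>C V)" by (elim exE conjE)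
    have "x + y = (\<Sum>V\<in>F. (r V + s V) *\<^sub>C V)" by (simp add: xy scaleC_add_left sum.distrib)
    then show "\<Delta> (x + y) = \<Delta> x + \<Delta> y"
      by (simp only: formula[OF F] xy) (simp add: scaleC_add_left sum.distrib)
  next
    fix c x assume "x \<in> cspan (monomials S)"
    then obtain r F where F: "finite F" "F \<subseteq> monomials S" and x: "x = (\<Sum>V\<in>F. r V *\<^sub>C V)"
      unfolding cspan_def by blast
    have "c *\<^sub>C x = (\<Sum>V\<in>F. (c * r V) *\<^sub>C V)" by (simp add: x scaleC_sum_right scaleC_scaleC)
    then show "\<Delta> (c *\<^sub>C x) = c *\<^sub>C \<Delta> x"
      by (simp only: formula[OF F] x) (simp add: scaleC_sum_right scaleC_scaleC)
  qed
  then show ?thesis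
    using assms unfolding cstar_red_eq
    by (intro clinear_on_dense csubspace_cspan) (auto simp: is_diagonal_comult_def cstar_red_eq)
qed

lemma diagonal_comult_monomial:
  assumes "is_diagonal_comult S \<Delta>" "V \<in> monomials S"
  shows "\<Delta> V = V \<otimes> V"
  using diagonal_comult_sum[OF assms(1), of 1 "\<lambda>_. V" "\<lambda>_. 1"] assms(2) by simp

lemma diagonal_comult_star_hom:
  assumes "is_diagonal_comult S \<Delta>"
  shows "star_hom (cstar_red S) \<Delta>"
  by (rule star_homI[OF diagonal_comult_clinear[OF assms] _ cstar_red_eq])
     (use assms in \<open>auto simp: is_diagonal_comult_def diagonal_comult_monomial[OF assms] monomials.intros
        monomials_star op_tensor_mult op_tensor_star\<close>)

section \<open>Range projections and the commutator ideal\<close>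

text \<open>For \<open>b\<close> in \<open>S\<close>, the projection onto the vectors supported in
  \<open>b + S\<close>.\<close>

definition range_proj :: "'g \<Rightarrow> 'g op" where
  "range_proj b = shift S b * star (shift S b)"

lemma range_proj_ket: "range_proj b \<triangleright> ket x = (if x - b \<in> S then ket x else 0)"
  by (simp add: range_proj_def star_shift_ket shift_ket)

lemma range_proj_monomial: "b \<in> S \<Longrightarrow> range_proj b \<in> monomials S"
  unfolding range_proj_def by (intro monomials.intros)

lemma norm_range_proj_le: "norm (range_proj b) \<le> 1"
  unfolding range_proj_def
  using mult_mono[OF norm_shift_le[of S b] norm_shift_le[of S b]]
  by (intro order_trans[OF norm_mult_ineq]) simp

lemma norm_mult_range_proj_le: "norm (x * range_proj b) \<le> norm x"
  using mult_left_mono[OF norm_range_proj_le[of b] norm_ge_zero[of x]]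
  by (intro order_trans[OF norm_mult_ineq]) simp

lemma range_proj_mult: "s \<in> S \<Longrightarrow> range_proj b * range_proj (b + s) = range_proj (b + s)"
proof (rule op_ket_eqI)
  fix x assume "s \<in> S"
  then have "x - (b + s) \<in> S \<Longrightarrow> x - b \<in> S" using add[of "x - (b + s)" s] by (simp add: algebra_simps)
  then show "(range_proj b * range_proj (b + s)) \<triangleright> ket x = range_proj (b + s) \<triangleright> ket x"
    by (simp add: range_proj_ket)
qed

lemma norm_mult_range_proj_mono: "s \<in> S \<Longrightarrow> norm (x * range_proj (b + s)) \<le> norm (x * range_proj b)"
  using norm_mult_range_proj_le[of "x * range_proj b" "b + s"] by (simp add: mult.assoc range_proj_mult)

text \<open>Turns agreement deep in \<open>S\<close> into an identity between operators.\<close>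

lemma deep_range_proj:
  assumes "deep (\<lambda>x. V \<triangleright> ket x = W \<triangleright> ket x)"
  shows "\<exists>b\<in>S. V * range_proj b = W * range_proj b"
proof -
  obtain b where b: "b \<in> S" "\<And>s. s \<in> S \<Longrightarrow> V \<triangleright> ket (b + s) = W \<triangleright> ket (b + s)"
    using assms unfolding deep_def by blast
  have "V * range_proj b = W * range_proj b"
  proof (rule op_ket_eqI)
    fix x
    show "(V * range_proj b) \<triangleright> ket x = (W * range_proj b) \<triangleright> ket x"
      using b(2)[of "x - b"] by (simp add: range_proj_ket)
  qed
  then show ?thesis using b(1) by blast
qed

lemma closed_ideal_cstar_red: "closed_ideal (cstar_red S) (cstar_red S)"
  unfolding closed_ideal_def using cstar_red_simps by auto

lemma commutators_subset:
  "{toeplitz S c * toeplitz S d - toeplitz S d * toeplitz S c | c d. True} \<subseteq> cstar_red S"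
  using toeplitz_monomial monomials_subset by (auto intro!: cstar_red_simps)

lemma closed_ideal_commutator_ideal: "closed_ideal (cstar_red S) (commutator_ideal S)"
  using closed_ideal_cstar_red commutators_subset
  unfolding commutator_ideal_def closed_ideal_generated_def closed_ideal_def
  by (auto intro!: closed_Inter)

lemma commutator_mem: "toeplitz S c * toeplitz S d - toeplitz S d * toeplitz S c \<in> commutator_ideal S"
  unfolding commutator_ideal_def closed_ideal_generated_def by blast

text \<open>\<open>shift S b\<close> is an isometry of the subspace with unit
  \<open>shift S 0\<close>, so the commutator of \<open>toeplitz S (- b)\<close> with
  \<open>toeplitz S b\<close> is precisely this projection.\<close>

lemma range_proj_complement_mem:
  assumes "b \<in> S"
  shows "shift S 0 - range_proj b \<in> commutator_ideal S"
proof -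
  have "toeplitz S b = shift S b"
    using toeplitz_diff[OF zero assms] monomials_unit(1)[OF monomials.intros(1)[OF assms]] by simp
  moreover have "toeplitz S (- b) = star (shift S b)"
    using toeplitz_diff[OF assms zero] monomials_unit(2)[OF monomials.intros(2)[OF assms]] by simp
  moreover have "star (shift S b) * shift S b = shift S 0"
    by (rule op_ket_eqI) (simp add: shift_ket star_shift_ket)
  ultimately show ?thesis using commutator_mem[of "- b" b] by (simp add: range_proj_def)
qed

text \<open>
  The projections \<open>shift S 0 - range_proj b\<close> form an approximate unit of the commutator ideal: commutators vanish
  deep in \<open>S\<close>, because monomials act there as translations.
\<close>

lemma commutator_ideal_vanishing:
  assumes "k \<in> commutator_ideal S" "0 < e"
  shows "\<exists>b\<in>S. norm (k * range_proj b) < e"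
proof -
  define N where "N = {x \<in> cstar_red S. \<forall>e>0. \<exists>b\<in>S. norm (x * range_proj b) < e}"
  have N_sub: "csubspace N"
    unfolding csubspace_def
  proof (intro conjI ballI allI)
    show "0 \<in> N" using zero cstar_red_simps(5) by (auto simp: N_def)
    fix x y assume xy: "x \<in> N" "y \<in> N"
    have "\<exists>b\<in>S. norm ((x + y) * range_proj b) < e" if e: "0 < e" for e
    proof -
      obtain b c where bc: "b \<in> S" "norm (x * range_proj b) < e / 2" "c \<in> S" "norm (y * range_proj c) < e / 2"
        using xy half_gt_zero[OF e] unfolding N_def by blast
      have "norm ((x + y) * range_proj (b + c)) \<le> norm (x * range_proj (b + c)) + norm (y * range_proj (c + b))"
        by (simp add: distrib_right norm_triangle_ineq add.commute[of c b])
      also have "\<dots> \<le> norm (x * range_proj b) + norm (y * range_proj c)"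
        using bc by (intro add_mono norm_mult_range_proj_mono)
      also have "\<dots> < e" using bc by linarith
      finally show ?thesis using add[OF bc(1,3)] by blast
    qed
    then show "x + y \<in> N" using xy cstar_red_simps(6) by (auto simp: N_def)
  next
    fix c x assume x: "x \<in> N"
    have "\<exists>b\<in>S. norm ((c *\<^sub>C x) * range_proj b) < e" if e: "0 < e" for e
    proof (cases "c = 0")
      case False
      then have "0 < e / cmod c" using e by simp
      then obtain b where "b \<in> S" "norm (x * range_proj b) < e / cmod c" using x unfolding N_def by blast
      then show ?thesis using False by (intro bexI[of _ b]) (simp_all add: mult_scaleC_left field_simps)
    qed (use zero e in auto)
    then show "c *\<^sub>C x \<in> N" using x cstar_red_simps(7) by (auto simp: N_def)
  qed
  have N_closed: "closed N"
    unfolding closure_subset_eq[symmetric]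
  proof
    fix x assume x: "x \<in> closure N"
    have "N \<subseteq> cstar_red S" by (auto simp: N_def)
    then have "x \<in> cstar_red S" using x closure_minimal[OF _ cstar_red_simps(2)] by blast
    moreover have "\<exists>b\<in>S. norm (x * range_proj b) < e" if e: "0 < e" for e
    proof -
      obtain y where y: "y \<in> N" "dist y x < e / 2"
        using x half_gt_zero[OF e] unfolding closure_approachable by blast
      then obtain b where b: "b \<in> S" "norm (y * range_proj b) < e / 2" using half_gt_zero[OF e] unfolding N_def by blast
      have "norm (x * range_proj b) \<le> norm ((x - y) * range_proj b) + norm (y * range_proj b)"
        using norm_triangle_ineq[of "(x - y) * range_proj b" "y * range_proj b"] by (simp add: left_diff_distrib)
      also have "\<dots> \<le> norm (x - y) + norm (y * range_proj b)" by (intro add_right_mono norm_mult_range_proj_le)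
      also have "\<dots> < e" using b(2) y(2) by (simp add: dist_norm norm_minus_commute)
      finally show ?thesis using b(1) by blast
    qed
    ultimately show "x \<in> N" by (simp add: N_def)
  qed
  have N_left: "a * x \<in> N" if a: "a \<in> cstar_red S" and x: "x \<in> N" for a x
  proof -
    have "\<exists>b\<in>S. norm (a * x * range_proj b) < e" if e: "0 < e" for e
    proof -
      have "0 < e / (norm a + 1)" using e by (simp add: add_nonneg_pos)
      then obtain b where b: "b \<in> S" "norm (x * range_proj b) < e / (norm a + 1)" using x unfolding N_def by blast
      have "norm (a * x * range_proj b) \<le> norm a * norm (x * range_proj b)" by (simp add: mult.assoc norm_mult_ineq)
      also have "\<dots> \<le> (norm a + 1) * norm (x * range_proj b)" by (intro mult_right_mono) auto
      also have "\<dots> < e"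
        using b(2) by (simp add: pos_less_divide_eq add_nonneg_pos mult.commute)
      finally show ?thesis using b(1) by blast
    qed
    then show ?thesis using a x cstar_red_simps(3) by (simp add: N_def)
  qed
  have N_right_monomial: "x * V \<in> N" if x: "x \<in> N" and V: "V \<in> monomials S" for x V
  proof -
    have "\<exists>c\<in>S. norm (x * V * range_proj c) < e" if e: "0 < e" for e
    proof -
      have "0 < e / (norm V + 1)" using e by (simp add: add_nonneg_pos)
      then obtain b where b: "b \<in> S" "norm (x * range_proj b) < e / (norm V + 1)" using x unfolding N_def by blast
      \<comment> \<open>The projection stands to the right of \<open>V\<close> and has to be moved
        past it: \<open>c\<close> is taken so deep that \<open>V\<close> maps vectors supported in
        \<open>c + S\<close> to vectors supported in \<open>b + S\<close>.\<close>
      have "deep (\<lambda>y. V \<triangleright> ket y = ket (y + degree V) \<and> y + degree V - b \<in> S)"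
        using has_degree_degree(1)[OF V] unfolding has_degree_def
        by (intro deep_conj deep_translate deep_mem b(1))
      then have "deep (\<lambda>y. V \<triangleright> ket y = (range_proj b * V) \<triangleright> ket y)"
        by (rule deep_mono) (simp add: range_proj_ket)
      then obtain c where c: "c \<in> S" "V * range_proj c = range_proj b * V * range_proj c"
        using deep_range_proj by blast
      have "norm (x * V * range_proj c) = norm ((x * range_proj b) * V * range_proj c)"
        using c(2) by (simp add: mult.assoc)
      also have "\<dots> \<le> norm ((x * range_proj b) * V)" by (rule norm_mult_range_proj_le)
      also have "\<dots> \<le> norm (x * range_proj b) * (norm V + 1)"
        by (rule order_trans[OF norm_mult_ineq]) (simp add: mult_left_mono)
      also have "\<dots> < e" using b(2) by (simp add: pos_less_divide_eq add_nonneg_pos)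
      finally show ?thesis using c(1) by blast
    qed
    then show ?thesis using x V cstar_red_simps(3) monomials_subset by (auto simp: N_def)
  qed
  have N_right: "x * a \<in> N" if "x \<in> N" "a \<in> cstar_red S" for x a
    using that(2) unfolding cstar_red_eq
    by (rule closed_cspan_mult_left[OF _ N_sub N_closed, rotated]) (rule N_right_monomial[OF that(1)])
  have "toeplitz S c * toeplitz S d - toeplitz S d * toeplitz S c \<in> N" for c d
  proof -
    let ?V = "toeplitz S c * toeplitz S d" and ?W = "toeplitz S d * toeplitz S c"
    have "?V \<in> monomials S" "?W \<in> monomials S" by (intro monomials.intros toeplitz_monomial)+
    moreover have "degree ?V = degree ?W"
      by (simp add: degree_mult toeplitz_monomial add.commute)
    ultimately have "deep (\<lambda>x. ?V \<triangleright> ket x = ket (x + degree ?V) \<and> ?W \<triangleright> ket x = ket (x + degree ?V))"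
      using has_degree_degree(1)[of ?V] has_degree_degree(1)[of ?W] unfolding has_degree_def
      by (intro deep_conj) auto
    then have "deep (\<lambda>x. ?V \<triangleright> ket x = ?W \<triangleright> ket x)" by (rule deep_mono) simp
    then obtain b where b: "b \<in> S" "?V * range_proj b = ?W * range_proj b" using deep_range_proj by blast
    then have "(?V - ?W) * range_proj b = 0" by (simp add: left_diff_distrib)
    then have "\<exists>b\<in>S. norm ((?V - ?W) * range_proj b) < e" if "0 < e" for e using b(1) that by (intro bexI[of _ b]) simp_all
    moreover have "?V - ?W \<in> cstar_red S" using commutators_subset by blast
    ultimately show ?thesis by (simp add: N_def)
  qed
  then have "{toeplitz S c * toeplitz S d - toeplitz S d * toeplitz S c | c d. True} \<subseteq> N" by blast
  moreover have "closed_ideal (cstar_red S) N"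
    unfolding closed_ideal_def
    using N_closed csubspaceD[OF N_sub] N_left N_right by (auto simp: N_def)
  ultimately have "commutator_ideal S \<subseteq> N"
    unfolding commutator_ideal_def closed_ideal_generated_def by blast
  then show ?thesis using assms by (auto simp: N_def)
qed

text \<open>
  With \<open>k\<^sub>n\<^sub>+\<^sub>1 = k\<^sub>n q\<^sub>n\<close> of rapidly decreasing norm, \<open>k = \<Sum>k\<^sub>n p\<^sub>n\<close> for \<open>p\<^sub>n = 1 - q\<^sub>n\<close>. Since
  \<open>\<Delta>(p) = p \<otimes> 1 + q \<otimes> p\<close>, this splits \<open>\<Delta>(k)\<close> into two convergent series, and it is not necessary to know
  that the sum of the two closed ideals is closed.
\<close>

lemma diagonal_comult_coideal:
  assumes comult: "is_diagonal_comult S \<Delta>"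
  shows "coideal (cstar_red S) id \<Delta> (commutator_ideal S)"
proof -
  let ?A = "cstar_red S" and ?K = "commutator_ideal S" and ?P = "shift S 0"
  have hom: "star_hom ?A \<Delta>" using comult by (rule diagonal_comult_star_hom)
  have lin: "clinear_on ?A \<Delta>" using hom by (rule star_homD)
  have range: "\<Delta> ` ?A \<subseteq> min_tensor ?A ?A" and con: "continuous_on ?A \<Delta>"
    using comult by (auto simp: is_diagonal_comult_def)
  obtain C where C: "\<And>x. x \<in> ?A \<Longrightarrow> norm (\<Delta> x) \<le> C * norm x"
    using clinear_on_continuous_imp_bounded[OF lin cstar_red_simps(1) con] by blast
  have KA: "?K \<subseteq> ?A" and K_mult: "\<And>a x. a \<in> ?A \<Longrightarrow> x \<in> ?K \<Longrightarrow> a * x \<in> ?K" "\<And>a x. a \<in> ?A \<Longrightarrow> x \<in> ?K \<Longrightarrow> x * a \<in> ?K"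
    using closed_ideal_commutator_ideal by (auto simp: closed_ideal_def)
  have PA: "?P \<in> ?A" and unit: "\<And>x. x \<in> ?A \<Longrightarrow> x * ?P = x"
    using is_unit_cstar_red by (auto simp: is_unit_def)
  have qA: "range_proj b \<in> ?A" if "b \<in> S" for b using range_proj_monomial[OF that] monomials_subset by blast
  have "\<exists>x\<in>min_tensor ?K ?A. \<exists>y\<in>min_tensor ?A ?K. \<Delta> k = x + y" if k: "k \<in> ?K" for k
  proof -
    define b where "b x n = (SOME b. b \<in> S \<and> norm (x * range_proj b) < (1/2) ^ n)" for x n
    have b: "b x n \<in> S" "norm (x * range_proj (b x n)) < (1/2) ^ n" if "x \<in> ?K" for x n
      using commutator_ideal_vanishing[OF that, of "(1/2) ^ n"] someI_ex[of "\<lambda>b. b \<in> S \<and> norm (x * range_proj b) < (1/2) ^ n"]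
      unfolding b_def by auto
    define f where "f = rec_nat k (\<lambda>n x. x * range_proj (b x n))"
    define q where "q n = range_proj (b (f n) n)" for n
    define p where "p n = ?P - q n" for n
    have f0: "f 0 = k" and f_Suc: "f (Suc n) = f n * q n" for n by (simp_all add: f_def q_def)
    have fK: "f n \<in> ?K" for n
      by (induction n) (auto simp: f0 k f_Suc q_def intro!: K_mult(2) qA b(1))
    have qS: "q n \<in> ?A" and pK: "p n \<in> ?K" for n
      using qA range_proj_complement_mem b(1)[OF fK] by (auto simp: q_def p_def)
    \<comment> \<open>The summand \<open>norm k\<close> covers \<open>n = 0\<close>, and the summand
      2 makes up for the shift of the index in the choice of \<open>b\<close>.\<close>
    have f_norm: "norm (f n) \<le> (norm k + 2) * (1/2) ^ n" for n
    proof (cases n)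
      case (Suc m)
      have "norm (f n) < (1/2) ^ m" unfolding Suc f_Suc q_def by (rule b(2)[OF fK])
      also have "\<dots> = 2 * (1/2) ^ n" by (simp add: Suc)
      also have "\<dots> \<le> (norm k + 2) * (1/2) ^ n" by (intro mult_right_mono) auto
      finally show ?thesis by simp
    qed (simp add: f0)
    have \<Delta>f: "\<Delta> (f n) \<in> min_tensor ?A ?A" for n using range KA fK by blast
    have \<Delta>f_norm: "norm (\<Delta> (f n)) \<le> \<bar>C\<bar> * (norm k + 2) * (1/2) ^ n" for n
    proof -
      have "norm (\<Delta> (f n)) \<le> C * norm (f n)" using C KA fK by blast
      also have "\<dots> \<le> \<bar>C\<bar> * ((norm k + 2) * (1/2) ^ n)" by (intro mult_mono f_norm) auto
      finally show ?thesis by (simp add: mult.assoc)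
    qed
    \<comment> \<open>The triangle inequality suffices; bounding both tensor factors by 2 gives the
      factor 4 below.\<close>
    have p_norm: "norm (p n) \<le> 2" for n
      using norm_triangle_ineq4[of ?P "q n"] norm_shift_le[of S 0] norm_range_proj_le[of "b (f n) n"]
      unfolding p_def q_def by linarith
    have summable: "summable (\<lambda>n. \<Delta> (f n) * (x n \<otimes> y n))"
      if xy: "\<And>n. norm (x n) \<le> 2" "\<And>n. norm (y n) \<le> 2" for x y :: "nat \<Rightarrow> 'g op"
    proof (rule summable_comparison_test')
      show "summable (\<lambda>n. \<bar>C\<bar> * (norm k + 2) * (1/2) ^ n * 4)"
        by (intro summable_mult summable_mult2 summable_geometric) simp
      have "norm (x n \<otimes> y n) \<le> 4" for n
        using norm_op_tensor_le[of "x n" "y n"] mult_mono[OF xy(1)[of n] xy(2)[of n]] by simp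
      then show "norm (\<Delta> (f n) * (x n \<otimes> y n)) \<le> \<bar>C\<bar> * (norm k + 2) * (1/2) ^ n * 4" for n
        by (intro order_trans[OF norm_mult_ineq] mult_mono \<Delta>f_norm) auto
    qed
    define u where "u n = \<Delta> (f n) * (p n \<otimes> ?P)" for n
    define v where "v n = \<Delta> (f n) * (q n \<otimes> p n)" for n
    have su: "u sums suminf u" and sv: "v sums suminf v"
      unfolding u_def v_def
      using norm_shift_le[of S 0] norm_range_proj_le order_trans[OF _ one_le_numeral]
      by (intro summable_sums summable p_norm; force simp: q_def)+
    have "suminf u \<in> min_tensor ?K ?A"
    proof (rule closed_sequentially[OF closed_min_tensor _ su[unfolded sums_def]])
      show "(\<Sum>n<N. u n) \<in> min_tensor ?K ?A" for N
        unfolding u_def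
        by (intro csubspace_sum[OF csubspace_min_tensor] min_tensor_mult[OF _ _ \<Delta>f min_tensor_mem[OF pK PA]]
            K_mult cstar_red_simps(3))
    qed
    moreover have "suminf v \<in> min_tensor ?A ?K"
    proof (rule closed_sequentially[OF closed_min_tensor _ sv[unfolded sums_def]])
      show "(\<Sum>n<N. v n) \<in> min_tensor ?A ?K" for N
        unfolding v_def
        by (intro csubspace_sum[OF csubspace_min_tensor] min_tensor_mult[OF _ _ \<Delta>f min_tensor_mem[OF qS pK]]
            K_mult cstar_red_simps(3))
    qed
    moreover have "\<Delta> k = suminf u + suminf v"
    proof (rule LIMSEQ_unique)
      \<comment> \<open>\<open>p n \<otimes> shift S 0 + q n \<otimes> p n\<close> is the difference
        of the values of \<open>\<Delta>\<close> at the unit and at \<open>q n\<close>, which makes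
        the partial sums telescope.\<close>
      have step: "u n + v n = \<Delta> (f n) - \<Delta> (f (Suc n))" for n
      proof -
        have "\<Delta> (q n) = q n \<otimes> q n" "\<Delta> ?P = ?P \<otimes> ?P"
          using diagonal_comult_monomial[OF comult] range_proj_monomial[OF b(1)[OF fK]] monomials.intros(1)[OF zero]
          by (auto simp: q_def)
        then have "p n \<otimes> ?P + q n \<otimes> p n = \<Delta> ?P - \<Delta> (q n)" by (simp add: p_def op_tensor_simps)
        moreover have "u n + v n = \<Delta> (f n) * (p n \<otimes> ?P + q n \<otimes> p n)" by (simp add: u_def v_def distrib_left)
        ultimately have "u n + v n = \<Delta> (f n) * \<Delta> ?P - \<Delta> (f n) * \<Delta> (q n)" by (simp add: right_diff_distrib)
        also have "\<dots> = \<Delta> (f n * ?P) - \<Delta> (f n * q n)"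
          using star_homD(2)[OF hom] KA fK PA qS by (simp add: subset_iff)
        finally show ?thesis using unit KA fK by (simp add: f_Suc subset_iff)
      qed
      have "(\<Sum>n<N. u n) + (\<Sum>n<N. v n) = \<Delta> k - \<Delta> (f N)" for N
      proof (induction N)
        case (Suc N)
        have "(\<Sum>n<Suc N. u n) + (\<Sum>n<Suc N. v n) = ((\<Sum>n<N. u n) + (\<Sum>n<N. v n)) + (u N + v N)"
          by (simp add: ac_simps)
        then show ?case by (simp only: Suc step) simp
      qed (simp add: f0)
      moreover have "(\<lambda>N. (\<Sum>n<N. u n) + (\<Sum>n<N. v n)) \<longlonglongrightarrow> suminf u + suminf v"
        using su sv unfolding sums_def by (rule tendsto_add)
      ultimately show "(\<lambda>N. \<Delta> k - \<Delta> (f N)) \<longlonglongrightarrow> suminf u + suminf v" by simp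
      have "(\<lambda>N. \<Delta> (f N)) \<longlonglongrightarrow> 0"
      proof (rule Lim_null_comparison)
        show "\<forall>\<^sub>F N in sequentially. norm (\<Delta> (f N)) \<le> \<bar>C\<bar> * (norm k + 2) * (1/2) ^ N"
          using \<Delta>f_norm by simp
        show "(\<lambda>N. \<bar>C\<bar> * (norm k + 2) * (1/2) ^ N) \<longlonglongrightarrow> 0"
          by (intro tendsto_mult_right_zero LIMSEQ_power_zero) simp
      qed
      then show "(\<lambda>N. \<Delta> k - \<Delta> (f N)) \<longlonglongrightarrow> \<Delta> k" using tendsto_diff[OF tendsto_const] by fastforce
    qed
    ultimately show ?thesis by blast
  qed
  then show ?thesis
    unfolding coideal_def image_id id_apply image_subset_iff using closed_ideal_commutator_ideal by blast
qed

lemma compact_quantum_semigroup_cstar_red: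
  assumes comult: "is_diagonal_comult S \<Delta>"
  shows "compact_quantum_semigroup (cstar_red S) id \<Delta>"
proof -
  have con: "continuous_on (cstar_red S) \<Delta>" using comult by (simp add: is_diagonal_comult_def)
  obtain C where C: "\<And>x. x \<in> cstar_red S \<Longrightarrow> norm (\<Delta> x) \<le> C * norm (id x)"
    using clinear_on_continuous_imp_bounded[OF diagonal_comult_clinear[OF comult] cstar_red_simps(1) con] by auto
  show ?thesis
  proof (rule compact_quantum_semigroup_grouplike[OF cstar_subalgebra_cstar_red cstar_red_eq _
        diagonal_comult_star_hom[OF comult] C con _ is_unit_cstar_red])
    show "faithful_rep (cstar_red S) id"
      by (simp add: faithful_rep_def star_hom_def clinear_on_def)
  qed (use monomials.intros(1)[OF zero] in \<open>auto simp: diagonal_comult_monomial[OF comult]\<close>)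
qed

lemma compact_quantum_subgroup_dual:
  assumes torsion_free: "\<And>(a :: 'g) n. 0 < n \<Longrightarrow> nmult n a = 0 \<Longrightarrow> a = 0"
    and comult: "is_diagonal_comult S \<Delta>"
  shows "compact_quantum_subgroup (UNIV :: 'g dual cfun set) mult_op dual_comult (cstar_red S) id \<Delta>"
proof -
  obtain \<pi> :: "'g op \<Rightarrow> 'g dual cfun" where \<pi>: "star_hom (cstar_red S) \<pi>"
    "\<And>x. x \<in> cstar_red S \<Longrightarrow> norm (\<pi> x) \<le> 1 * norm x" "\<And>V. V \<in> monomials S \<Longrightarrow> \<pi> V = character (degree V)"
    using symbol_map_exists by auto
  have con: "continuous_on (cstar_red S) \<pi>"
    using star_homD(1)[OF \<pi>(1)] cstar_red_simps(1) \<pi>(2) by (rule clinear_on_bounded_imp_continuous)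
  have "compact_quantum_subsemigroup (UNIV :: 'g dual cfun set) mult_op dual_comult (cstar_red S) id \<Delta>"
  proof (rule compact_quantum_subsemigroup_grouplike[OF compact_quantum_semigroup_dual
        compact_quantum_semigroup_cstar_red[OF comult] cstar_red_eq _ _ \<pi>(1)])
    show "continuous_on (cstar_red S) \<Delta>" using comult by (simp add: is_diagonal_comult_def)
    show "continuous_on (cstar_red S) (\<lambda>a. dual_comult (\<pi> a))"
      by (rule continuous_on_compose2[OF continuous_on_dual_comult con subset_UNIV])
    show "\<pi> ` cstar_red S = UNIV"
      using torsion_free star_homD(1)[OF \<pi>(1)] con \<pi>(3) by (rule symbol_map_surjective)
    show "norm (mult_op (\<pi> a)) \<le> 1 * norm (id a)" if "a \<in> cstar_red S" for a using \<pi>(2)[OF that] by simp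
  qed (auto simp: diagonal_comult_monomial[OF comult] \<pi>(3) dual_comult_character)
  then show ?thesis unfolding compact_quantum_subgroup_def using compact_quantum_group_dual by blast
qed

end

theorem theorem11:
  fixes S :: "'g::ab_group_add set" and \<Delta> :: "'g op \<Rightarrow> ('g \<times> 'g) op"
  assumes torsion_free: "\<And>(a :: 'g) (n :: nat). 0 < n \<Longrightarrow> (\<Sum>i<n. a) = 0 \<Longrightarrow> a = 0"
    and zero: "0 \<in> S"
    and add: "\<And>a b. a \<in> S \<Longrightarrow> b \<in> S \<Longrightarrow> a + b \<in> S"
    and generating: "UNIV = {a - b | a b. a \<in> S \<and> b \<in> S}"
    and comult: "is_diagonal_comult S \<Delta>"
  shows "coideal (cstar_red S) id \<Delta> (commutator_ideal S) \<and>
    compact_quantum_subgroup (UNIV :: 'g dual cfun set) mult_op dual_comult (cstar_red S) id \<Delta>"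
proof -
  interpret generating_semigroup S
  proof
    show "\<exists>a\<in>S. \<exists>b\<in>S. c = a - b" for c using generating by blast
  qed (fact zero add)+
  have "a = 0" if "0 < n" "nmult n a = 0" for a :: 'g and n
    using that torsion_free unfolding nmult_def by blast
  then show ?thesis using diagonal_comult_coideal[OF comult] compact_quantum_subgroup_dual[OF _ comult] by blast
qed

end
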